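(* Let $$\mu(d\xi)=c\,e^{-\xi}\xi^{-\alpha}\ell(\xi)\,d\xi,\qquad \xi\ge 0,$$ where $c>0$, $\alpha\in(1,2)$, and $\ell$ is slowly varying at infinity and bounded at zero (i.e. bounded in a neighborhood of zero), $\mu$ being a Lévy measure on $\mathbb{R}_{\ge 0}$ with $\int_1^\infty e^\xi\,\mu(d\xi)<\infty$. Let $b=\int_0^\infty(e^\xi-1-\xi)\,\mu(d\xi)$, and let $X$ be the càdlàg Feller process with state space $\mathbb{R}_{\ge 0}$, deterministic starting point $X_0>0$, and generator $$\mathcal{A}f(x) = -b\,x f'(x) + x\int_0^\infty \bigl(f(x+\xi)-f(x)-f'(x)\xi\bigr)\,\mu(d\xi),\qquad f\in C_c^\infty(\mathbb{R}_{\ge 0}).$$ Then the process $S=e^X-1$ is a strict local martingale.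
   Context: A filtered probability space $(\Omega,\mathcal{F},(\mathcal{F}_t)_{t\ge 0},\mathbb{P})$ satisfying the usual conditions is given; $X$ is adapted to this filtration and is a Feller (Markov) process with respect to it. A Lévy measure on $\mathbb{R}_{\ge 0}$ is a Borel measure $\mu$ with $\mu(\{0\})=0$ and $\int_0^\infty \min(1,\xi^2)\,\mu(d\xi)<\infty$. A positive measurable function $\ell$ on $(0,\infty)$ is slowly varying at infinity if $\lim_{x\to\infty}\ell(\lambda x)/\ell(x)=1$ for every $\lambda>0$. The constant $b$ is finite and positive. $C_c^\infty(\mathbb{R}_{\ge 0})$ is a core of $\mathcal{A}$. Such a process $X$ exists, is non-explosive, and is unique in law (it is a conservative non-negative affine process). If $J(\omega,d\xi,ds)$ denotes the random measure of jumps of $X$ and $\overline{J}(\omega,X_{s-},d\xi,ds)=J(\omega,d\xi,ds)-X_{s-}\,\mu(d\xi)\,ds$ its compensated version, then $$X_t = X_0 + \int_{\mathbb{R}_{\ge 0}\times[0,t]}\xi\,\overline{J}(\omega,X_{s-},d\xi,ds) - b\int_0^t X_{s-}\,ds .$$ A strict local martingale is a local martingale that is not a true martingale. *)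

theory Defs
  imports "HOL-Probability.Probability"
begin

subsection \<open>Filtered probability spaces and local martingales\<close>

text \<open>Time is the half-line of non-negative reals. Filtrations and processes are indexed by the
  type \<^typ>\<open>real\<close>; only their values at times \<open>t \<ge> 0\<close> matter.\<close>

definition filtered_prob_space :: "'a measure \<Rightarrow> (real \<Rightarrow> 'a measure) \<Rightarrow> bool" where
  "filtered_prob_space M F \<longleftrightarrow>
     prob_space M \<and>
     (\<forall>t\<ge>0. subalgebra M (F t)) \<and>
     (\<forall>s\<ge>0. \<forall>t\<ge>s. sets (F s) \<subseteq> sets (F t))"

definition usual_conditions :: "'a measure \<Rightarrow> (real \<Rightarrow> 'a measure) \<Rightarrow> bool" where
  "usual_conditions M F \<longleftrightarrow>
     complete_measure M \<and>
     null_sets M \<subseteq> sets (F 0) \<and>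
     (\<forall>t\<ge>0. sets (F t) = (\<Inter>s\<in>{t<..}. sets (F s)))"

definition cadlag :: "'a measure \<Rightarrow> (real \<Rightarrow> 'a \<Rightarrow> real) \<Rightarrow> bool" where
  "cadlag M Y \<longleftrightarrow>
     (\<forall>\<omega>\<in>space M.
        (\<forall>t\<ge>0. ((\<lambda>s. Y s \<omega>) \<longlongrightarrow> Y t \<omega>) (at_right t)) \<and>
        (\<forall>t>0. \<exists>l. ((\<lambda>s. Y s \<omega>) \<longlongrightarrow> l) (at_left t)))"

definition adapted :: "(real \<Rightarrow> 'a measure) \<Rightarrow> 'b measure \<Rightarrow> (real \<Rightarrow> 'a \<Rightarrow> 'b) \<Rightarrow> bool" where
  "adapted F S Y \<longleftrightarrow> (\<forall>t\<ge>0. Y t \<in> F t \<rightarrow>\<^sub>M S)"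

definition is_martingale :: "'a measure \<Rightarrow> (real \<Rightarrow> 'a measure) \<Rightarrow> (real \<Rightarrow> 'a \<Rightarrow> real) \<Rightarrow> bool" where
  "is_martingale M F Y \<longleftrightarrow>
     adapted F borel Y \<and>
     (\<forall>t\<ge>0. integrable M (Y t)) \<and>
     (\<forall>s\<ge>0. \<forall>t\<ge>s. AE \<omega> in M. real_cond_exp M (F s) (Y t) \<omega> = Y s \<omega>)"

text \<open>The filtration is extended to the index set \<open>[0,\<infinity>]\<close>, so that \<^const>\<open>stopping_time\<close> covers
  stopping times that may take the value \<open>\<infinity>\<close>. The choice at \<open>\<infinity>\<close> is irrelevant for this,
  since \<open>T \<le> \<infinity>\<close> always holds.\<close>

definition extended_filtration :: "'a measure \<Rightarrow> (real \<Rightarrow> 'a measure) \<Rightarrow> ennreal \<Rightarrow> 'a measure" where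
  "extended_filtration M F t = (if t = \<infinity> then M else F (enn2real t))"

definition stopped :: "('a \<Rightarrow> ennreal) \<Rightarrow> (real \<Rightarrow> 'a \<Rightarrow> 'b) \<Rightarrow> real \<Rightarrow> 'a \<Rightarrow> 'b" where
  "stopped T Y t \<omega> = Y (enn2real (min (ennreal t) (T \<omega>))) \<omega>"

definition is_local_martingale :: "'a measure \<Rightarrow> (real \<Rightarrow> 'a measure) \<Rightarrow> (real \<Rightarrow> 'a \<Rightarrow> real) \<Rightarrow> bool" where
  "is_local_martingale M F Y \<longleftrightarrow>
     adapted F borel Y \<and> cadlag M Y \<and>
     (\<exists>T :: nat \<Rightarrow> 'a \<Rightarrow> ennreal.
        (\<forall>n. stopping_time (extended_filtration M F) (T n)) \<and>
        (AE \<omega> in M. incseq (\<lambda>n. T n \<omega>) \<and> (\<lambda>n. T n \<omega>) \<longlonglongrightarrow> \<infinity>) \<and>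
        (\<forall>n. is_martingale M F (\<lambda>t \<omega>. stopped (T n) Y t \<omega> - Y 0 \<omega>)))"

definition strict_local_martingale :: "'a measure \<Rightarrow> (real \<Rightarrow> 'a measure) \<Rightarrow> (real \<Rightarrow> 'a \<Rightarrow> real) \<Rightarrow> bool" where
  "strict_local_martingale M F Y \<longleftrightarrow> is_local_martingale M F Y \<and> \<not> is_martingale M F Y"

subsection \<open>Feller semigroups, generators and Feller processes\<close>

text \<open>Real-valued functions on the state space \<open>E\<close> are represented by functions on the ambient
  type; everything below depends only on their values on \<open>E\<close>.\<close>

definition C0 :: "'e::topological_space set \<Rightarrow> ('e \<Rightarrow> real) set" where
  "C0 E = {f. continuous_on E f \<and>
              (\<forall>\<epsilon>>0. \<exists>K. compact K \<and> K \<subseteq> E \<and> (\<forall>x\<in>E - K. \<bar>f x\<bar> < \<epsilon>))}"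

text \<open>Semigroup of (conservative) Markov kernels; the second equation is Chapman-Kolmogorov.\<close>

definition markov_semigroup :: "'e measure \<Rightarrow> (real \<Rightarrow> 'e \<Rightarrow> 'e measure) \<Rightarrow> bool" where
  "markov_semigroup S P \<longleftrightarrow>
     (\<forall>t\<ge>0. P t \<in> S \<rightarrow>\<^sub>M prob_algebra S) \<and>
     (\<forall>x\<in>space S. P 0 x = return S x) \<and>
     (\<forall>s\<ge>0. \<forall>t\<ge>0. \<forall>x\<in>space S. P (s + t) x = P s x \<bind> P t)"

definition transition_op :: "(real \<Rightarrow> 'e \<Rightarrow> 'e measure) \<Rightarrow> real \<Rightarrow> ('e \<Rightarrow> real) \<Rightarrow> 'e \<Rightarrow> real" where
  "transition_op P t f x = (\<integral>y. f y \<partial>P t x)"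

definition feller_semigroup :: "'e::topological_space set \<Rightarrow> (real \<Rightarrow> 'e \<Rightarrow> 'e measure) \<Rightarrow> bool" where
  "feller_semigroup E P \<longleftrightarrow>
     markov_semigroup (restrict_space borel E) P \<and>
     (\<forall>t\<ge>0. \<forall>f\<in>C0 E. transition_op P t f \<in> C0 E) \<and>
     (\<forall>f\<in>C0 E. uniform_limit E (\<lambda>t. transition_op P t f) f (at_right 0))"

text \<open>The graph of the (infinitesimal) generator, an operator in \<open>C0 E\<close> with the uniform norm.\<close>

definition generator :: "'e::topological_space set \<Rightarrow> (real \<Rightarrow> 'e \<Rightarrow> 'e measure)
    \<Rightarrow> (('e \<Rightarrow> real) \<times> ('e \<Rightarrow> real)) set" where
  "generator E P = {(f, g). f \<in> C0 E \<and> g \<in> C0 E \<and>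
     uniform_limit E (\<lambda>t x. (transition_op P t f x - f x) / t) g (at_right 0)}"

text \<open>\<open>D\<close> is a core: it lies in the domain, and the graph of the generator is contained in the
  (uniform) closure of the graph of its restriction to \<open>D\<close>.\<close>

definition is_core :: "'e::topological_space set \<Rightarrow> (real \<Rightarrow> 'e \<Rightarrow> 'e measure) \<Rightarrow> ('e \<Rightarrow> real) set \<Rightarrow> bool" where
  "is_core E P D \<longleftrightarrow>
     D \<subseteq> Domain (generator E P) \<and>
     (\<forall>(f, g)\<in>generator E P. \<exists>\<phi> \<gamma>.
        (\<forall>n. \<phi> n \<in> D \<and> (\<phi> n, \<gamma> n) \<in> generator E P) \<and>
        uniform_limit E \<phi> f sequentially \<and> uniform_limit E \<gamma> g sequentially)"

definition feller_process :: "'a measure \<Rightarrow> (real \<Rightarrow> 'a measure) \<Rightarrow> 'e::topological_space set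
    \<Rightarrow> (real \<Rightarrow> 'e \<Rightarrow> 'e measure) \<Rightarrow> (real \<Rightarrow> 'a \<Rightarrow> 'e) \<Rightarrow> bool" where
  "feller_process M F E P X \<longleftrightarrow>
     feller_semigroup E P \<and>
     adapted F (restrict_space borel E) X \<and>
     (\<forall>s\<ge>0. \<forall>t\<ge>0. \<forall>f\<in>borel_measurable (restrict_space borel E). bounded (f ` E) \<longrightarrow>
        (AE \<omega> in M. real_cond_exp M (F s) (\<lambda>\<omega>. f (X (s + t) \<omega>)) \<omega> = transition_op P t f (X s \<omega>)))"

subsection \<open>Functions and measures on the non-negative half-line\<close>

text \<open>Derivative of a function on \<open>[0,\<infinity>)\<close>, one-sided at \<open>0\<close>.\<close>

definition deriv_nonneg :: "(real \<Rightarrow> real) \<Rightarrow> real \<Rightarrow> real" where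
  "deriv_nonneg f x = vector_derivative f (at x within {0..})"

text \<open>Smooth functions with compact support in \<open>[0,\<infinity>)\<close>; they need not vanish near \<open>0\<close>.\<close>

definition Cc_infinity_nonneg :: "(real \<Rightarrow> real) set" where
  "Cc_infinity_nonneg = {f.
     (\<forall>n. \<forall>x\<ge>0. (deriv_nonneg ^^ n) f differentiable (at x within {0..})) \<and>
     (\<exists>R. \<forall>x\<ge>0. x > R \<longrightarrow> f x = 0)}"

definition levy_measure_nonneg :: "real measure \<Rightarrow> bool" where
  "levy_measure_nonneg \<mu> \<longleftrightarrow>
     sets \<mu> = sets (restrict_space borel {0..}) \<and>
     emeasure \<mu> {0} = 0 \<and>
     (\<integral>\<^sup>+\<xi>. ennreal (min 1 (\<xi>\<^sup>2)) \<partial>\<mu>) < \<infinity>"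

definition slowly_varying :: "(real \<Rightarrow> real) \<Rightarrow> bool" where
  "slowly_varying l \<longleftrightarrow>
     l \<in> borel_measurable (restrict_space borel {0<..}) \<and>
     (\<forall>x>0. l x > 0) \<and>
     (\<forall>k>0. ((\<lambda>x. l (k * x) / l x) \<longlongrightarrow> 1) at_top)"

definition bounded_at_zero :: "(real \<Rightarrow> real) \<Rightarrow> bool" where
  "bounded_at_zero l \<longleftrightarrow> (\<exists>\<delta>>0. bounded (l ` {0<..<\<delta>}))"

definition affine_generator :: "real \<Rightarrow> real measure \<Rightarrow> (real \<Rightarrow> real) \<Rightarrow> real \<Rightarrow> real" where
  "affine_generator b \<mu> f x =
     - b * x * deriv_nonneg f x + x * (\<integral>\<xi>. f (x + \<xi>) - f x - deriv_nonneg f x * \<xi> \<partial>\<mu>)"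

end

theory Submission
  imports Defs "HOL-Real_Asymp.Real_Asymp"
begin

text \<open>
Put \<open>R(u) = - b u + \<integral> (exp (u \<xi>) - 1 - u \<xi>) \<mu>(d\<xi>)\<close>. The generator acts on exponentials by
\<open>\<A> exp (u x) = x R(u) exp (u x)\<close>, and the choice of \<open>b\<close> makes \<open>R(1) = 0\<close>. This is why \<open>exp X\<close> is a local
martingale (\<open>exp_local_martingale\<close>): stopped at the first passage above a level, it is a martingale by
Dynkin's formula.

It is strict because of the behaviour of \<open>R\<close> at 1. Up to a slowly varying factor, \<open>- R(1 - y)\<close> is of
order \<open>y powr (\<alpha> - 1)\<close> as \<open>y\<close> tends to 0, so \<open>1 / (- R(1 - y))\<close> is integrable at 0. Consequently the
Riccati equation \<open>\<psi>' = R(\<psi>)\<close> with \<open>\<psi>(0) = 1\<close> has, besides the constant 1, a solution that decreases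
at once, and the expectation of \<open>exp X\<^sub>t\<close> follows the latter. The proof extracts the consequence without
solving the equation. For \<open>u < 1\<close> close to 1, Dynkin's formula and \<open>R(u) < 0\<close> give
\<open>- R(u) E \<integral>\<^sub>0\<^sup>t X\<^sub>s exp (u X\<^sub>s) ds \<le> exp (u x0)\<close> (\<open>nn_integral_exp_bound\<close>). Take \<open>u = 1 - y\<close> with
\<open>y = 1 / 2 ^ k\<close>, divide by \<open>- R(1 - y)\<close>, multiply by \<open>y\<close>, and sum over \<open>k\<close>. On the right this leaves the
sum of \<open>y / (- R(1 - y))\<close>, which is finite (\<open>summable_inverse_branching_mechanism\<close>); on the left, for
every \<open>x\<close> one of the terms \<open>y x exp ((1 - y) x)\<close> is at least a fixed multiple of \<open>exp x - 1\<close>. Hence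
\<open>E \<integral>\<^sub>0\<^sup>t (exp X\<^sub>s - 1) ds\<close> is bounded in \<open>t\<close>. If \<open>exp X - 1\<close> were a martingale, this integral would equal
\<open>t (exp x0 - 1)\<close>.

For the summability, \<open>- R(1 - 1 / 2 ^ k)\<close> is at least half the integral of \<open>exp \<xi> \<mu>(d\<xi>)\<close> over
\<open>[2 ^ k, 2 ^ (k + 1))\<close>. Slow variation compares consecutive integrals of this kind, and the ratio test
applies because \<open>\<alpha> < 2\<close>.

Dynkin's formula at stopping times (\<open>stopped_dynkin_formula\<close>) is derived for functions in the domain
of the generator by summing the defining estimate of the generator over a fine time grid; that
estimate is uniform in the state, so the errors add up to something small. Exponentials are reached
through the smooth, compactly supported functions \<open>exp (u x - 1 / (m - x))\<close>, which increase to
\<open>exp (u x)\<close> as \<open>m\<close> tends to infinity.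
\<close>

section \<open>Smooth compactly supported approximations of exponentials\<close>

text \<open>Test functions: \<open>exp (u x)\<close> times a polynomial in \<open>v = 1 / (m - x)\<close> times \<open>exp (- v)\<close>, cut off at
\<open>m\<close>. The factor \<open>exp (- v)\<close> is flat at \<open>m\<close>, so these functions have compact support, and
differentiation only changes the polynomial, because \<open>v\<close> has derivative \<open>v\<^sup>2\<close>. As \<open>m\<close> grows,
\<open>v\<close> tends to 0 and the functions with polynomial 1 increase to \<open>exp (u x)\<close>, while all derivatives
stay below a constant times \<open>exp (u x)\<close>.\<close>

definition damped_exp :: "real \<Rightarrow> real \<Rightarrow> real poly \<Rightarrow> real \<Rightarrow> real" where
  "damped_exp u m q x =
     (if x < m then exp (u * x) * poly q (1 / (m - x)) * exp (- (1 / (m - x))) else 0)"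

definition damped_exp_deriv :: "real \<Rightarrow> real poly \<Rightarrow> real poly" where
  "damped_exp_deriv u q = smult u q + monom 1 2 * (pderiv q - q)"

lemma poly_exp_minus_tendsto_0: "((\<lambda>v::real. poly q v * exp (- v)) \<longlongrightarrow> 0) at_top"
proof -
  have "((\<lambda>v::real. v ^ k * poly q v * exp (- v)) \<longlongrightarrow> 0) at_top" for k
  proof (induction q arbitrary: k)
    case 0
    then show ?case by simp
  next
    case (pCons a q)
    have "((\<lambda>v::real. a * (v ^ k / exp v) + v ^ Suc k * poly q v * exp (- v)) \<longlongrightarrow> a * 0 + 0) at_top"
      by (intro tendsto_intros tendsto_power_div_exp_0 pCons.IH)
    then show ?case by (simp add: algebra_simps exp_minus divide_inverse)
  qed
  from this[of 0] show ?thesis by simp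
qed

lemma poly_exp_minus_bounded:
  obtains C :: real where "C \<ge> 0" "\<And>v. v \<ge> 0 \<Longrightarrow> \<bar>poly q v * exp (- v)\<bar> \<le> C"
proof -
  have "eventually (\<lambda>v::real. \<bar>poly q v * exp (- v)\<bar> < 1) at_top"
    using tendstoD[OF poly_exp_minus_tendsto_0[of q], of 1] by (simp add: dist_real_def)
  then obtain V where V: "\<And>v. v \<ge> V \<Longrightarrow> \<bar>poly q v * exp (- v)\<bar> < 1"
    by (auto simp: eventually_at_top_linorder)
  have "bounded ((\<lambda>v. poly q v * exp (- v)) ` {0..V})"
    by (intro compact_imp_bounded compact_continuous_image continuous_intros) auto
  then obtain B where "\<forall>v\<in>{0..V}. \<bar>poly q v * exp (- v)\<bar> \<le> B"
    by (auto simp: bounded_iff)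
  then have B: "\<bar>poly q v * exp (- v)\<bar> \<le> B" if "v \<in> {0..V}" for v
    using that by blast
  show ?thesis
  proof (rule that[of "max B 1"])
    fix v :: real assume "v \<ge> 0"
    then show "\<bar>poly q v * exp (- v)\<bar> \<le> max B 1"
      using B[of v] V[of v] by (cases "v \<le> V") auto
  qed simp
qed

text \<open>Away from \<open>m\<close> this is the product rule. At \<open>m\<close> the left difference quotient is again a polynomial in
\<open>v\<close> times \<open>exp (- v)\<close>, with \<open>v\<close> tending to infinity.\<close>

lemma damped_exp_has_derivative:
  "(damped_exp u m q has_real_derivative damped_exp u m (damped_exp_deriv u q) x) (at x)"
proof -
  consider "x < m" | "x > m" | "x = m" by linarith
  then show ?thesis
  proof cases
    case 1
    have "((\<lambda>x. exp (u * x) * poly q (1 / (m - x)) * exp (- (1 / (m - x))))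
        has_real_derivative damped_exp u m (damped_exp_deriv u q) x) (at x)"
      using 1 by (auto intro!: derivative_eq_intros poly_DERIV[THEN DERIV_chain2]
          simp: damped_exp_def damped_exp_deriv_def poly_monom field_simps power2_eq_square)
    moreover have "eventually (\<lambda>y. y < m) (nhds x)"
      using 1 by (rule order_tendstoD[OF filterlim_ident])
    then have "eventually (\<lambda>y. damped_exp u m q y
        = exp (u * y) * poly q (1 / (m - y)) * exp (- (1 / (m - y)))) (nhds x)"
      by eventually_elim (simp add: damped_exp_def)
    ultimately show ?thesis
      by (simp cong: DERIV_cong_ev)
  next
    case 2
    have "eventually (\<lambda>y. y > m) (nhds x)"
      using 2 by (rule order_tendstoD[OF filterlim_ident])
    then have "eventually (\<lambda>y. damped_exp u m q y = 0) (nhds x)"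
      by eventually_elim (simp add: damped_exp_def)
    with 2 show ?thesis
      by (simp add: damped_exp_def cong: DERIV_cong_ev)
  next
    case 3
    let ?Q = "\<lambda>y. (damped_exp u m q y - damped_exp u m q m) / (y - m)"
    have "(?Q \<longlongrightarrow> 0) (at_right m)"
      by (rule tendsto_eventually)
         (auto simp: eventually_at_filter damped_exp_def)
    moreover have "(?Q \<longlongrightarrow> 0) (at_left m)"
    proof -
      have "filterlim (\<lambda>y. 1 / (m - y)) at_top (at_left m)"
        by real_asymp
      then have "((\<lambda>y. poly (pCons 0 q) (1 / (m - y)) * exp (- (1 / (m - y)))) \<longlongrightarrow> 0) (at_left m)"
        by (rule filterlim_compose[OF poly_exp_minus_tendsto_0])
      moreover have "((\<lambda>y. - exp (u * y)) \<longlongrightarrow> - exp (u * m)) (at_left m)"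
        by (intro tendsto_intros)
      ultimately have "((\<lambda>y. - exp (u * y) * (poly (pCons 0 q) (1 / (m - y)) * exp (- (1 / (m - y)))))
           \<longlongrightarrow> - exp (u * m) * 0) (at_left m)"
        by (rule tendsto_mult[rotated])
      moreover have "eventually (\<lambda>y. y < m) (at_left m)"
        by (auto simp: eventually_at_filter)
      then have "eventually (\<lambda>y. - exp (u * y) * (poly (pCons 0 q) (1 / (m - y)) * exp (- (1 / (m - y))))
           = ?Q y) (at_left m)"
        by eventually_elim (auto simp: damped_exp_def field_simps)
      ultimately show ?thesis
        by (auto intro: Lim_transform_eventually)
    qed
    ultimately have "(?Q \<longlongrightarrow> 0) (at m)"
      by (simp add: filterlim_split_at)
    then show ?thesis
      using 3 by (simp add: has_field_derivative_iff damped_exp_def)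
  qed
qed

text \<open>The one-sided derivative on the half-line sees only values on the half-line, which is what an
induction over iterated derivatives can provide.\<close>

lemma deriv_nonneg_eqI:
  assumes "(f has_real_derivative D) (at x)" "x \<ge> 0" "\<And>y. y \<ge> 0 \<Longrightarrow> g y = f y"
  shows "deriv_nonneg g x = D" "g differentiable (at x within {0..})"
proof -
  have "(f has_vector_derivative D) (at x within {0..})"
    using assms(1) by (auto simp: has_real_derivative_iff_has_vector_derivative
        intro: has_vector_derivative_at_within)
  then have *: "(g has_vector_derivative D) (at x within {0..})"
    using assms(2,3) by (rule_tac has_vector_derivative_transform[where f=f]) auto
  have "at_right x \<le> at x within {0..}"
    using assms(2) by (intro at_le) auto
  then have "at x within {0..} \<noteq> bot"
    by (metis bot.extremum_uniqueI trivial_limit_at_right_real)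
  with * show "deriv_nonneg g x = D"
    unfolding deriv_nonneg_def by (intro vector_derivative_within)
  from * show "g differentiable (at x within {0..})"
    by (rule differentiableI_vector)
qed

lemma iterated_deriv_damped_exp:
  "x \<ge> 0 \<Longrightarrow> (deriv_nonneg ^^ n) (damped_exp u m q) x
     = damped_exp u m ((damped_exp_deriv u ^^ n) q) x"
proof (induction n arbitrary: x)
  case (Suc n)
  then show ?case
    using deriv_nonneg_eqI(1)[OF damped_exp_has_derivative Suc.prems Suc.IH]
    by simp
qed simp

lemma damped_exp_in_Cc: "damped_exp u m q \<in> Cc_infinity_nonneg"
proof -
  have "(deriv_nonneg ^^ n) (damped_exp u m q) differentiable (at x within {0..})" if "x \<ge> 0" for n x
    by (rule deriv_nonneg_eqI(2)[OF damped_exp_has_derivative that iterated_deriv_damped_exp])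
  moreover have "\<exists>R. \<forall>x\<ge>0. R < x \<longrightarrow> damped_exp u m q x = 0"
    by (auto simp: damped_exp_def intro!: exI[of _ m])
  ultimately show ?thesis
    by (simp add: Cc_infinity_nonneg_def)
qed

text \<open>The bound does not depend on the cut-off \<open>m\<close>; this uniformity is what permits dominated convergence
as \<open>m\<close> tends to infinity.\<close>

lemma damped_exp_bound:
  obtains C where "C \<ge> 0" "\<And>m x. \<bar>damped_exp u m q x\<bar> \<le> C * exp (u * x)"
proof -
  obtain C where C: "C \<ge> 0" "\<And>v. v \<ge> 0 \<Longrightarrow> \<bar>poly q v * exp (- v)\<bar> \<le> C"
    using poly_exp_minus_bounded[of q] by blast
  have "\<bar>damped_exp u m q x\<bar> \<le> C * exp (u * x)" for m x
  proof (cases "x < m")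
    case True
    then have "exp (u * x) * \<bar>poly q (1 / (m - x)) * exp (- (1 / (m - x)))\<bar> \<le> exp (u * x) * C"
      by (intro mult_left_mono C(2)) auto
    with True show ?thesis
      by (simp add: damped_exp_def abs_mult mult_ac)
  qed (use C(1) in \<open>simp add: damped_exp_def\<close>)
  with C(1) show ?thesis by (rule that)
qed

lemma damped_exp_tendsto:
  "(\<lambda>n. damped_exp u (real n) q x) \<longlonglongrightarrow> exp (u * x) * poly q 0"
proof -
  have inv: "(\<lambda>n. 1 / (real n - x)) \<longlonglongrightarrow> 0"
    by real_asymp
  have "(\<lambda>n. exp (u * x) * poly q (1 / (real n - x)) * exp (- (1 / (real n - x))))
      \<longlonglongrightarrow> exp (u * x) * poly q 0 * exp (- 0)"
    by (intro tendsto_intros inv)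
  moreover have "eventually (\<lambda>n. x < real n) sequentially"
    by real_asymp
  then have "eventually (\<lambda>n. exp (u * x) * poly q (1 / (real n - x)) * exp (- (1 / (real n - x)))
      = damped_exp u (real n) q x) sequentially"
    by eventually_elim (simp add: damped_exp_def)
  ultimately show ?thesis
    by (auto intro: Lim_transform_eventually)
qed

lemma damped_exp_1_mono:
  assumes "m \<le> m'"
  shows "damped_exp u m 1 x \<le> damped_exp u m' 1 x"
  using assms by (auto simp: damped_exp_def intro!: divide_left_mono)

lemma damped_exp_1_nonneg: "damped_exp u m 1 x \<ge> 0"
  by (simp add: damped_exp_def)

lemma damped_exp_1_le: "damped_exp u m 1 x \<le> exp (u * x)"
  by (auto simp: damped_exp_def mult_le_cancel_left1)

section \<open>The generator on exponentials\<close>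

text \<open>A \<open>\<mu>\<close>-integrable majorant, up to constants, of the compensated increments
\<open>f (x + \<xi>) - f x - f' x * \<xi>\<close> of functions that grow at most like \<open>exp x\<close>: quadratic for small jumps,
exponential for large ones.\<close>

definition levy_bound :: "real \<Rightarrow> real" where
  "levy_bound \<xi> = (if \<xi> \<le> 1 then \<xi>\<^sup>2 else exp \<xi>)"

text \<open>The function \<open>R\<close> with \<open>\<A> exp (u x) = x R(u) exp (u x)\<close> for the generator \<open>\<A>\<close>; the Laplace exponent
of the process solves the Riccati equation \<open>\<psi>' = R(\<psi>)\<close>.\<close>

definition branching_mechanism :: "real \<Rightarrow> real measure \<Rightarrow> real \<Rightarrow> real" where
  "branching_mechanism b \<mu> u = - b * u + (\<integral>\<xi>. exp (u * \<xi>) - 1 - u * \<xi> \<partial>\<mu>)"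

lemma levy_bound_nonneg: "levy_bound \<xi> \<ge> 0"
  by (simp add: levy_bound_def)

text \<open>For small jumps the mean value theorem, applied twice, leaves a second derivative at a point at
most \<open>x + 1\<close>. For large jumps the three terms are bounded one by one: the quadratic bound would
cost a factor \<open>\<xi>\<^sup>2\<close>, which \<open>exp \<xi> \<mu>(d\<xi>)\<close> need not integrate when \<open>u = 1\<close>.\<close>

lemma damped_exp_taylor_bound:
  assumes u: "0 \<le> u" "u \<le> 1"
  obtains C where "C \<ge> 0"
    "\<And>m x \<xi>. x \<ge> 0 \<Longrightarrow> \<xi> \<ge> 0 \<Longrightarrow>
      \<bar>damped_exp u m q (x + \<xi>) - damped_exp u m q x - damped_exp u m (damped_exp_deriv u q) x * \<xi>\<bar>
        \<le> C * exp x * levy_bound \<xi>"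
proof -
  let ?q1 = "damped_exp_deriv u q"
  let ?q2 = "damped_exp_deriv u ?q1"
  obtain C0 where C0: "C0 \<ge> 0" "\<And>m x. \<bar>damped_exp u m q x\<bar> \<le> C0 * exp (u * x)"
    using damped_exp_bound[of u q] by blast
  obtain C1 where C1: "C1 \<ge> 0" "\<And>m x. \<bar>damped_exp u m ?q1 x\<bar> \<le> C1 * exp (u * x)"
    using damped_exp_bound[of u ?q1] by blast
  obtain C2 where C2: "C2 \<ge> 0" "\<And>m x. \<bar>damped_exp u m ?q2 x\<bar> \<le> C2 * exp (u * x)"
    using damped_exp_bound[of u ?q2] by blast
  have ux: "u * x \<le> x" if "x \<ge> 0" for x :: real
    using u that by (simp add: mult_left_le_one_le)
  define C where "C = C2 * exp 1 + 2 * C0 + C1"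
  show ?thesis
  proof (rule that[of C])
    show "C \<ge> 0" using C0 C1 C2 by (simp add: C_def)
    fix m x \<xi> :: real
    assume x: "x \<ge> 0" and \<xi>: "\<xi> \<ge> 0"
    let ?D = "damped_exp u m q (x + \<xi>) - damped_exp u m q x - damped_exp u m ?q1 x * \<xi>"
    consider "\<xi> = 0" | "0 < \<xi>" "\<xi> \<le> 1" | "\<xi> > 1" using \<xi> by linarith
    then show "\<bar>?D\<bar> \<le> C * exp x * levy_bound \<xi>"
    proof cases
      case 1
      then show ?thesis by (simp add: levy_bound_def)
    next
      case 2
      obtain z where z: "x < z" "z < x + \<xi>"
        "damped_exp u m q (x + \<xi>) - damped_exp u m q x = (x + \<xi> - x) * damped_exp u m ?q1 z"
        using MVT2[of x "x + \<xi>" "damped_exp u m q"] 2 damped_exp_has_derivative by fastforce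
      obtain w where w: "x < w" "w < z"
        "damped_exp u m ?q1 z - damped_exp u m ?q1 x = (z - x) * damped_exp u m ?q2 w"
        using MVT2[of x z "damped_exp u m ?q1"] z damped_exp_has_derivative by fastforce
      have "?D = \<xi> * (damped_exp u m ?q1 z - damped_exp u m ?q1 x)"
        using z(3) by (simp add: algebra_simps)
      also have "\<dots> = \<xi> * (z - x) * damped_exp u m ?q2 w"
        using w(3) by simp
      also have "\<bar>\<dots>\<bar> \<le> (\<xi> * \<xi>) * (C2 * exp (x + 1))"
        unfolding abs_mult
      proof (intro mult_mono)
        have "\<bar>damped_exp u m ?q2 w\<bar> \<le> C2 * exp (u * w)" by (rule C2)
        also have "u * w \<le> x + 1" using ux[of w] x w z 2 by linarith
        then have "C2 * exp (u * w) \<le> C2 * exp (x + 1)"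
          using C2(1) by (intro mult_left_mono) auto
        finally show "\<bar>damped_exp u m ?q2 w\<bar> \<le> C2 * exp (x + 1)" .
      qed (use z w 2 in auto)
      also have "\<dots> = (C2 * exp 1) * exp x * \<xi>\<^sup>2"
        by (simp add: exp_add power2_eq_square)
      also have "\<dots> \<le> C * exp x * \<xi>\<^sup>2"
        using C0 C1 by (intro mult_right_mono) (auto simp: C_def)
      finally show ?thesis using 2 by (simp add: levy_bound_def)
    next
      case 3
      have e1: "exp (u * (x + \<xi>)) \<le> exp x * exp \<xi>"
        using ux[of "x + \<xi>"] x 3 by (simp add: exp_add[symmetric])
      have "exp (u * x) * 1 \<le> exp x * exp \<xi>"
        using ux[of x] x 3 by (intro mult_mono) auto
      then have e2: "exp (u * x) \<le> exp x * exp \<xi>" by simp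
      have "exp (u * x) * \<xi> \<le> exp x * exp \<xi>"
        using ux[of x] x 3 exp_ge_add_one_self[of \<xi>] order_trans[of \<xi> "1 + \<xi>" "exp \<xi>"] by (intro mult_mono) auto
      then have e3: "C1 * exp (u * x) * \<xi> \<le> C1 * (exp x * exp \<xi>)"
        using C1(1) by (simp add: mult.assoc mult_left_mono)
      have tri: "\<bar>a - b - c\<bar> \<le> \<bar>a\<bar> + \<bar>b\<bar> + \<bar>c\<bar>" for a b c :: real
        by arith
      have "\<bar>?D\<bar> \<le> \<bar>damped_exp u m q (x + \<xi>)\<bar> + \<bar>damped_exp u m q x\<bar> + \<bar>damped_exp u m ?q1 x\<bar> * \<xi>"
        using tri[of "damped_exp u m q (x + \<xi>)" "damped_exp u m q x" "damped_exp u m ?q1 x * \<xi>"] 3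
        by (simp add: abs_mult)
      also have "\<dots> \<le> C0 * exp (u * (x + \<xi>)) + C0 * exp (u * x) + C1 * exp (u * x) * \<xi>"
        using 3 by (intro add_mono mult_right_mono C0 C1) auto
      also have "\<dots> \<le> C0 * (exp x * exp \<xi>) + C0 * (exp x * exp \<xi>) + C1 * (exp x * exp \<xi>)"
        using C0(1) C1(1) by (intro add_mono mult_left_mono e1 e2 e3) auto
      also have "\<dots> = (2 * C0 + C1) * (exp x * exp \<xi>)"
        by (simp add: algebra_simps)
      also have "\<dots> \<le> C * (exp x * exp \<xi>)"
        using C2(1) by (intro mult_right_mono) (auto simp: C_def)
      finally show ?thesis using 3 by (simp add: levy_bound_def mult.assoc)
    qed
  qed
qed

lemma levy_bound_measurable [measurable]: "levy_bound \<in> borel_measurable borel"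
  unfolding levy_bound_def by measurable

lemma damped_exp_measurable [measurable]: "damped_exp u m q \<in> borel_measurable borel"
proof -
  have "continuous_on UNIV (damped_exp u m q)"
    by (meson DERIV_continuous_on damped_exp_has_derivative has_field_derivative_at_within)
  then show ?thesis by (rule borel_measurable_continuous_onI)
qed

text \<open>The bound for the approximations is uniform in the cut-off, so it passes to their limit.\<close>

lemma exp_taylor_bound:
  assumes "0 \<le> u" "u \<le> 1"
  obtains C where "C \<ge> 0"
    "\<And>x \<xi>. x \<ge> 0 \<Longrightarrow> \<xi> \<ge> 0 \<Longrightarrow>
      \<bar>exp (u * (x + \<xi>)) - exp (u * x) - u * exp (u * x) * \<xi>\<bar> \<le> C * exp x * levy_bound \<xi>"
proof -
  obtain C where C: "C \<ge> 0"
    "\<And>m x \<xi>. x \<ge> 0 \<Longrightarrow> \<xi> \<ge> 0 \<Longrightarrow>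
      \<bar>damped_exp u m 1 (x + \<xi>) - damped_exp u m 1 x - damped_exp u m (damped_exp_deriv u 1) x * \<xi>\<bar>
        \<le> C * exp x * levy_bound \<xi>"
    using damped_exp_taylor_bound[OF assms, of 1] by blast
  have "\<bar>exp (u * (x + \<xi>)) - exp (u * x) - u * exp (u * x) * \<xi>\<bar> \<le> C * exp x * levy_bound \<xi>"
    if "x \<ge> 0" "\<xi> \<ge> 0" for x \<xi>
  proof (rule LIMSEQ_le_const2)
    show "(\<lambda>n. \<bar>damped_exp u (real n) 1 (x + \<xi>) - damped_exp u (real n) 1 x
        - damped_exp u (real n) (damped_exp_deriv u 1) x * \<xi>\<bar>)
      \<longlonglongrightarrow> \<bar>exp (u * (x + \<xi>)) - exp (u * x) - u * exp (u * x) * \<xi>\<bar>"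
      by (rule tendsto_eq_intros damped_exp_tendsto refl)+
         (simp add: damped_exp_deriv_def poly_monom mult_ac)
  qed (use C(2) that in auto)
  with C(1) show ?thesis by (rule that)
qed

locale exponential_levy_measure =
  fixes \<mu> :: "real measure"
  assumes levy: "levy_measure_nonneg \<mu>"
    and exp_moment: "(\<integral>\<^sup>+\<xi>\<in>{1..}. ennreal (exp \<xi>) \<partial>\<mu>) < \<infinity>"
begin

lemma sets_\<mu>: "sets \<mu> = sets (restrict_space borel {0..})"
  using levy by (simp add: levy_measure_nonneg_def)

lemma space_\<mu>: "space \<mu> = {0..}"
  using sets_eq_imp_space_eq[OF sets_\<mu>] by (simp add: space_restrict_space)

lemma borel_measurable_\<mu> [measurable (raw)]:
  "f \<in> borel_measurable borel \<Longrightarrow> f \<in> borel_measurable \<mu>"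
  by (subst measurable_cong_sets[OF sets_\<mu> refl]) (rule measurable_restrict_space1)

lemma integrable_levy_bound: "integrable \<mu> levy_bound"
proof (rule integrableI_nonneg)
  have "(\<integral>\<^sup>+\<xi>. ennreal (levy_bound \<xi>) \<partial>\<mu>)
      \<le> (\<integral>\<^sup>+\<xi>. ennreal (min 1 (\<xi>\<^sup>2)) + ennreal (exp \<xi>) * indicator {1..} \<xi> \<partial>\<mu>)"
    by (intro nn_integral_mono)
       (auto simp: levy_bound_def space_\<mu> indicator_def min_def abs_le_square_iff[symmetric] power_le_one_iff
             intro!: ennreal_leI)
  also have "\<dots> = (\<integral>\<^sup>+\<xi>. ennreal (min 1 (\<xi>\<^sup>2)) \<partial>\<mu>) + (\<integral>\<^sup>+\<xi>\<in>{1..}. ennreal (exp \<xi>) \<partial>\<mu>)"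
    by (intro nn_integral_add) measurable
  also have "\<dots> < \<infinity>"
    using levy exp_moment by (simp add: levy_measure_nonneg_def)
  finally show "(\<integral>\<^sup>+\<xi>. ennreal (levy_bound \<xi>) \<partial>\<mu>) < \<infinity>" .
qed (auto simp: levy_bound_nonneg)

lemma integrable_compensated_exp:
  assumes "0 \<le> u" "u \<le> 1"
  shows "integrable \<mu> (\<lambda>\<xi>. exp (u * \<xi>) - 1 - u * \<xi>)"
proof -
  obtain C where C: "C \<ge> 0" "\<And>x \<xi>. x \<ge> 0 \<Longrightarrow> \<xi> \<ge> 0 \<Longrightarrow>
      \<bar>exp (u * (x + \<xi>)) - exp (u * x) - u * exp (u * x) * \<xi>\<bar> \<le> C * exp x * levy_bound \<xi>"
    using exp_taylor_bound[OF assms] by blast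
  show ?thesis
  proof (rule Bochner_Integration.integrable_bound)
    show "integrable \<mu> (\<lambda>\<xi>. C * levy_bound \<xi>)"
      using integrable_levy_bound by simp
    show "AE \<xi> in \<mu>. norm (exp (u * \<xi>) - 1 - u * \<xi>) \<le> norm (C * levy_bound \<xi>)"
      using C(2)[of 0] C(1) by (auto simp: space_\<mu> levy_bound_nonneg)
  qed measurable
qed

lemma affine_generator_damped_exp:
  assumes "x \<ge> 0"
  shows "affine_generator b \<mu> (damped_exp u m q) x =
    - b * x * damped_exp u m (damped_exp_deriv u q) x
    + x * (\<integral>\<xi>. damped_exp u m q (x + \<xi>) - damped_exp u m q x
              - damped_exp u m (damped_exp_deriv u q) x * \<xi> \<partial>\<mu>)"
  unfolding affine_generator_def
  using deriv_nonneg_eqI(1)[OF damped_exp_has_derivative assms, of _ u m q] by simp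

text \<open>The cut-off functions lie in the domain of the generator, the exponential does not; this limit is
the substitute for applying the generator to \<open>exp (u x)\<close>.\<close>

lemma affine_generator_damped_exp_tendsto:
  assumes u: "0 \<le> u" "u \<le> 1" and x: "x \<ge> 0"
  shows "(\<lambda>n. affine_generator b \<mu> (damped_exp u (real n) 1) x)
    \<longlonglongrightarrow> x * exp (u * x) * branching_mechanism b \<mu> u"
proof -
  obtain C where C: "C \<ge> 0"
    "\<And>m x \<xi>. x \<ge> 0 \<Longrightarrow> \<xi> \<ge> 0 \<Longrightarrow>
      \<bar>damped_exp u m 1 (x + \<xi>) - damped_exp u m 1 x - damped_exp u m (damped_exp_deriv u 1) x * \<xi>\<bar>
        \<le> C * exp x * levy_bound \<xi>"
    using damped_exp_taylor_bound[OF u, of 1] by blast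
  have poly0: "poly (damped_exp_deriv u 1) 0 = u"
    by (simp add: damped_exp_deriv_def poly_monom)
  have "(\<lambda>n. \<integral>\<xi>. damped_exp u (real n) 1 (x + \<xi>) - damped_exp u (real n) 1 x
              - damped_exp u (real n) (damped_exp_deriv u 1) x * \<xi> \<partial>\<mu>)
    \<longlonglongrightarrow> (\<integral>\<xi>. exp (u * (x + \<xi>)) - exp (u * x) - u * exp (u * x) * \<xi> \<partial>\<mu>)"
  proof (rule integral_dominated_convergence)
    show "integrable \<mu> (\<lambda>\<xi>. C * exp x * levy_bound \<xi>)"
      using integrable_levy_bound by simp
    show "AE \<xi> in \<mu>. (\<lambda>n. damped_exp u (real n) 1 (x + \<xi>) - damped_exp u (real n) 1 x
              - damped_exp u (real n) (damped_exp_deriv u 1) x * \<xi>)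
        \<longlonglongrightarrow> exp (u * (x + \<xi>)) - exp (u * x) - u * exp (u * x) * \<xi>"
    proof (rule AE_I2)
      show "(\<lambda>n. damped_exp u (real n) 1 (x + \<xi>) - damped_exp u (real n) 1 x
              - damped_exp u (real n) (damped_exp_deriv u 1) x * \<xi>)
        \<longlonglongrightarrow> exp (u * (x + \<xi>)) - exp (u * x) - u * exp (u * x) * \<xi>" for \<xi>
        by (rule tendsto_eq_intros damped_exp_tendsto refl)+ (simp add: poly0 mult_ac)
    qed
    show "AE \<xi> in \<mu>. norm (damped_exp u (real n) 1 (x + \<xi>) - damped_exp u (real n) 1 x
              - damped_exp u (real n) (damped_exp_deriv u 1) x * \<xi>) \<le> C * exp x * levy_bound \<xi>" for n
      using C(2)[OF x] by (auto simp: space_\<mu>)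
  qed measurable
  also have "(\<integral>\<xi>. exp (u * (x + \<xi>)) - exp (u * x) - u * exp (u * x) * \<xi> \<partial>\<mu>)
      = (\<integral>\<xi>. exp (u * x) * (exp (u * \<xi>) - 1 - u * \<xi>) \<partial>\<mu>)"
    by (rule Bochner_Integration.integral_cong) (auto simp: algebra_simps exp_add)
  also have "\<dots> = exp (u * x) * (\<integral>\<xi>. exp (u * \<xi>) - 1 - u * \<xi> \<partial>\<mu>)"
    by simp
  finally have "(\<lambda>n. - b * x * damped_exp u (real n) (damped_exp_deriv u 1) x
      + x * (\<integral>\<xi>. damped_exp u (real n) 1 (x + \<xi>) - damped_exp u (real n) 1 x
              - damped_exp u (real n) (damped_exp_deriv u 1) x * \<xi> \<partial>\<mu>))
    \<longlonglongrightarrow> - b * x * (exp (u * x) * poly (damped_exp_deriv u 1) 0)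
      + x * (exp (u * x) * (\<integral>\<xi>. exp (u * \<xi>) - 1 - u * \<xi> \<partial>\<mu>))"
    by (intro tendsto_intros damped_exp_tendsto)
  then show ?thesis
    by (simp add: affine_generator_damped_exp[OF x] branching_mechanism_def poly0 algebra_simps)
qed

text \<open>Bounds the generator along paths that have not yet left \<open>[0, N]\<close>, uniformly in the cut-off.\<close>

lemma affine_generator_damped_exp_bounded:
  assumes u: "0 \<le> u" "u \<le> 1"
  obtains C where "C \<ge> 0"
    "\<And>m x. 0 \<le> x \<Longrightarrow> x \<le> N \<Longrightarrow> \<bar>affine_generator b \<mu> (damped_exp u m 1) x\<bar> \<le> C"
proof -
  obtain C where C: "C \<ge> 0"
    "\<And>m x \<xi>. x \<ge> 0 \<Longrightarrow> \<xi> \<ge> 0 \<Longrightarrow>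
      \<bar>damped_exp u m 1 (x + \<xi>) - damped_exp u m 1 x - damped_exp u m (damped_exp_deriv u 1) x * \<xi>\<bar>
        \<le> C * exp x * levy_bound \<xi>"
    using damped_exp_taylor_bound[OF u, of 1] by blast
  obtain C1 where C1: "C1 \<ge> 0" "\<And>m x. \<bar>damped_exp u m (damped_exp_deriv u 1) x\<bar> \<le> C1 * exp (u * x)"
    using damped_exp_bound[of u "damped_exp_deriv u 1"] by blast
  let ?I = "\<integral>\<xi>. levy_bound \<xi> \<partial>\<mu>"
  let ?B = "\<bar>b\<bar> * \<bar>N\<bar> * (C1 * exp \<bar>N\<bar>) + \<bar>N\<bar> * (C * exp \<bar>N\<bar> * ?I)"
  have I: "?I \<ge> 0" by (intro integral_nonneg_AE) (auto simp: levy_bound_nonneg)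
  show ?thesis
  proof (rule that[of ?B])
    show "?B \<ge> 0" using I C(1) C1(1) by auto
    fix m x assume x: "0 \<le> x" "x \<le> N"
    let ?D = "\<lambda>\<xi>. damped_exp u m 1 (x + \<xi>) - damped_exp u m 1 x
              - damped_exp u m (damped_exp_deriv u 1) x * \<xi>"
    have "\<bar>\<integral>\<xi>. ?D \<xi> \<partial>\<mu>\<bar> \<le> (\<integral>\<xi>. C * exp x * levy_bound \<xi> \<partial>\<mu>)"
      unfolding real_norm_def[symmetric]
    proof (rule Bochner_Integration.integral_norm_bound_integral)
      show bound: "norm (?D \<xi>) \<le> C * exp x * levy_bound \<xi>" if "\<xi> \<in> space \<mu>" for \<xi>
        using C(2)[OF x(1)] that by (simp add: space_\<mu>)
      show int: "integrable \<mu> (\<lambda>\<xi>. C * exp x * levy_bound \<xi>)"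
        using integrable_levy_bound by simp
      show "integrable \<mu> ?D"
        by (rule Bochner_Integration.integrable_bound[OF int])
           (use bound in \<open>auto simp: C(1) levy_bound_nonneg\<close>)
    qed
    also have "\<dots> = C * exp x * ?I" by simp
    also have "\<dots> \<le> C * exp \<bar>N\<bar> * ?I"
      using x C(1) I by (intro mult_right_mono mult_left_mono) auto
    finally have 1: "\<bar>\<integral>\<xi>. ?D \<xi> \<partial>\<mu>\<bar> \<le> C * exp \<bar>N\<bar> * ?I" .
    have "u * x \<le> N" using u x by (meson mult_left_le_one_le order_trans)
    then have 2: "\<bar>damped_exp u m (damped_exp_deriv u 1) x\<bar> \<le> C1 * exp \<bar>N\<bar>"
      by (intro order_trans[OF C1(2)] mult_left_mono C1(1)) auto
    have "\<bar>affine_generator b \<mu> (damped_exp u m 1) x\<bar>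
      \<le> \<bar>b\<bar> * \<bar>x\<bar> * \<bar>damped_exp u m (damped_exp_deriv u 1) x\<bar> + \<bar>x\<bar> * \<bar>\<integral>\<xi>. ?D \<xi> \<partial>\<mu>\<bar>"
      unfolding affine_generator_damped_exp[OF x(1)]
      by (rule order_trans[OF abs_triangle_ineq]) (simp add: abs_mult)
    also have "\<dots> \<le> ?B"
      using x C1(1) by (intro add_mono mult_mono 1 2) auto
    finally show "\<bar>affine_generator b \<mu> (damped_exp u m 1) x\<bar> \<le> ?B" .
  qed
qed

end

section \<open>Slow variation and the branching mechanism near one\<close>

lemma slowly_varying_eventually_ge:
  assumes "slowly_varying l" "k > 0" "q < 1"
  obtains x0 where "x0 > 0" "\<And>x. x \<ge> x0 \<Longrightarrow> q * l x \<le> l (k * x)"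
proof -
  have "((\<lambda>x. l (k * x) / l x) \<longlongrightarrow> 1) at_top"
    using assms by (simp add: slowly_varying_def)
  then have "eventually (\<lambda>x. l (k * x) / l x > q) at_top"
    using assms(3) by (rule order_tendstoD)
  then obtain x1 where x1: "\<And>x. x \<ge> x1 \<Longrightarrow> l (k * x) / l x > q"
    by (auto simp: eventually_at_top_linorder)
  show ?thesis
  proof (rule that[of "max x1 1"])
    fix x assume "x \<ge> max x1 1"
    then show "q * l x \<le> l (k * x)"
      using x1[of x] assms(1) by (auto simp: slowly_varying_def field_simps)
  qed simp
qed

text \<open>Jumps of size about \<open>2 ^ k\<close>, weighted by \<open>exp \<xi>\<close>. They govern the branching mechanism at distance
\<open>1 / 2 ^ k\<close> from 1.\<close>

definition dyadic_mass :: "real measure \<Rightarrow> nat \<Rightarrow> real" where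
  "dyadic_mass \<mu> k = (\<integral>\<xi>. exp \<xi> * indicator {2 ^ k..<2 ^ Suc k} \<xi> \<partial>\<mu>)"

context exponential_levy_measure
begin

lemma integrable_dyadic: "integrable \<mu> (\<lambda>\<xi>. exp \<xi> * indicator {2 ^ k..<2 ^ Suc k} \<xi>)"
proof (rule Bochner_Integration.integrable_bound)
  show "integrable \<mu> (\<lambda>\<xi>. exp 1 * levy_bound \<xi>)"
    using integrable_levy_bound by simp
  have "norm (exp \<xi> * indicator {2 ^ k..<2 ^ Suc k} \<xi>) \<le> norm (exp 1 * levy_bound \<xi>)" for \<xi>
  proof (cases "\<xi> \<in> {2 ^ k..<2 ^ Suc k}")
    case True
    moreover have "(1::real) \<le> 2 ^ k" by simp
    ultimately have "1 \<le> \<xi>" by (metis atLeastLessThan_iff order_trans)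
    with True show ?thesis
      by (cases "\<xi> = 1") (auto simp: levy_bound_def)
  qed simp
  then show "AE \<xi> in \<mu>. norm (exp \<xi> * indicator {2 ^ k..<2 ^ Suc k} \<xi>) \<le> norm (exp 1 * levy_bound \<xi>)"
    by simp
qed measurable

text \<open>Inserting the value of \<open>b\<close> merges the two compensators, and the integrand that results is
nonnegative by convexity of the exponential.\<close>

lemma minus_branching_mechanism:
  assumes b: "b = (\<integral>\<xi>. exp \<xi> - 1 - \<xi> \<partial>\<mu>)" and y: "0 \<le> y" "y \<le> 1"
  shows "integrable \<mu> (\<lambda>\<xi>. (1 - y) * exp \<xi> + y - exp ((1 - y) * \<xi>))"
    "- branching_mechanism b \<mu> (1 - y) = (\<integral>\<xi>. (1 - y) * exp \<xi> + y - exp ((1 - y) * \<xi>) \<partial>\<mu>)"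
proof -
  have i1: "integrable \<mu> (\<lambda>\<xi>. exp \<xi> - 1 - \<xi>)"
    using integrable_compensated_exp[of 1] by simp
  have iy: "integrable \<mu> (\<lambda>\<xi>. exp ((1 - y) * \<xi>) - 1 - (1 - y) * \<xi>)"
    using y by (intro integrable_compensated_exp) auto
  have eq: "(1 - y) * exp \<xi> + y - exp ((1 - y) * \<xi>)
      = (1 - y) * (exp \<xi> - 1 - \<xi>) - (exp ((1 - y) * \<xi>) - 1 - (1 - y) * \<xi>)" for \<xi>
    by (simp add: algebra_simps)
  show "integrable \<mu> (\<lambda>\<xi>. (1 - y) * exp \<xi> + y - exp ((1 - y) * \<xi>))"
    unfolding eq using i1 iy by simp
  show "- branching_mechanism b \<mu> (1 - y) = (\<integral>\<xi>. (1 - y) * exp \<xi> + y - exp ((1 - y) * \<xi>) \<partial>\<mu>)"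
    unfolding eq branching_mechanism_def b using i1 iy by simp
qed

lemma branching_mechanism_1:
  assumes "b = (\<integral>\<xi>. exp \<xi> - 1 - \<xi> \<partial>\<mu>)"
  shows "branching_mechanism b \<mu> 1 = 0"
  using assms by (simp add: branching_mechanism_def)

text \<open>Since the integrand is nonnegative, the integral may be restricted to jumps in
\<open>[2 ^ k, 2 ^ (k + 1))\<close>. There \<open>exp ((1 - y) \<xi>)\<close> with \<open>y = 1 / 2 ^ k\<close> is at most \<open>exp \<xi> / exp 1\<close>, and the
integrand is at least half of \<open>exp \<xi>\<close>.\<close>

lemma minus_branching_mechanism_ge:
  assumes b: "b = (\<integral>\<xi>. exp \<xi> - 1 - \<xi> \<partial>\<mu>)" and k: "k \<ge> 4"
  shows "dyadic_mass \<mu> k / 2 \<le> - branching_mechanism b \<mu> (1 - 1 / 2 ^ k)"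
proof -
  define y :: real where "y = 1 / 2 ^ k"
  have "(2::real) ^ 4 \<le> 2 ^ k" using k by (intro power_increasing) auto
  then have y: "0 < y" "y \<le> 1 / 16" by (auto simp: y_def field_simps)
  have e1: "exp (1::real) \<ge> 5 / 2"
    using exp_lower_Taylor_quadratic[of 1] by simp
  have ptw: "exp \<xi> * indicator {2 ^ k..<2 ^ Suc k} \<xi> / 2 \<le> (1 - y) * exp \<xi> + y - exp ((1 - y) * \<xi>)" for \<xi> :: real
  proof (cases "\<xi> \<in> {2 ^ k..<2 ^ Suc k}")
    case True
    then have "1 \<le> y * \<xi>" by (simp add: y_def field_simps)
    then have "exp ((1 - y) * \<xi>) \<le> exp (\<xi> - 1)" by (simp add: algebra_simps)
    also have "\<dots> = exp \<xi> / exp 1" by (simp add: exp_diff)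
    also have "\<dots> \<le> exp \<xi> / (5 / 2)" by (intro divide_left_mono e1) auto
    finally have "exp ((1 - y) * \<xi>) \<le> exp \<xi> * (2 / 5)" by simp
    moreover have "y * exp \<xi> \<le> 1 / 16 * exp \<xi>" using y by (intro mult_right_mono) auto
    moreover have "(1 - y) * exp \<xi> = exp \<xi> - y * exp \<xi>" by (simp add: algebra_simps)
    ultimately have "(1 - y) * exp \<xi> + y - exp ((1 - y) * \<xi>) \<ge> exp \<xi> / 2"
      using y exp_gt_zero[of \<xi>] by linarith
    with True show ?thesis by simp
  next
    case False
    have "exp ((1 - y) *\<^sub>R \<xi> + y *\<^sub>R 0) \<le> (1 - y) * exp \<xi> + y * exp 0"
      using y by (intro convex_onD[OF exp_convex]) auto
    with False show ?thesis by simp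
  qed
  have "dyadic_mass \<mu> k / 2 = (\<integral>\<xi>. exp \<xi> * indicator {2 ^ k..<2 ^ Suc k} \<xi> / 2 \<partial>\<mu>)"
    by (simp add: dyadic_mass_def)
  also have "\<dots> \<le> (\<integral>\<xi>. (1 - y) * exp \<xi> + y - exp ((1 - y) * \<xi>) \<partial>\<mu>)"
    using integrable_dyadic[of k] minus_branching_mechanism(1)[OF b, of y] y ptw
    by (intro integral_mono) auto
  also have "\<dots> = - branching_mechanism b \<mu> (1 - y)"
    using minus_branching_mechanism(2)[OF b, of y] y by simp
  finally show ?thesis by (simp add: y_def)
qed

end

locale tempered_levy_measure = exponential_levy_measure +
  fixes c \<alpha> :: real and l :: "real \<Rightarrow> real"
  assumes c: "c > 0" and \<alpha>: "1 < \<alpha>" "\<alpha> < 2"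
    and l: "slowly_varying l"
    and \<mu>: "\<mu> = density (restrict_space lborel {0..})
                   (\<lambda>\<xi>. ennreal (c * exp (- \<xi>) * \<xi> powr (- \<alpha>) * l \<xi>))"
begin

lemma l_pos: "x > 0 \<Longrightarrow> l x > 0"
  using l by (simp add: slowly_varying_def)

lemma l_measurable [measurable]: "(\<lambda>x. indicator {0<..} x * l x) \<in> borel_measurable borel"
  using l borel_measurable_restrict_space_iff[of "{0<..}" "borel::real measure" l]
  by (simp add: slowly_varying_def)

text \<open>Replaces \<open>l\<close> by a function that is Borel measurable on the whole line. At the
origin both densities vanish because \<open>0 powr (- \<alpha>) = 0\<close>.\<close>

lemma \<mu>_density:
  "\<mu> = density (restrict_space lborel {0..})
     (\<lambda>\<xi>. ennreal (c * exp (- \<xi>) * \<xi> powr (- \<alpha>) * (indicator {0<..} \<xi> * l \<xi>)))"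
  (is "_ = density _ ?g")
proof -
  have g: "?g \<in> borel_measurable (restrict_space lborel {0..})"
    by (rule measurable_restrict_space1) measurable
  have eq: "ennreal (c * exp (- \<xi>) * \<xi> powr (- \<alpha>) * l \<xi>) = ?g \<xi>"
    if "\<xi> \<in> space (restrict_space lborel {0..})" for \<xi>
    using that by (cases "\<xi> = 0") (auto simp: space_restrict_space)
  show ?thesis
    unfolding \<mu>
  proof (rule density_cong)
    show "(\<lambda>\<xi>. ennreal (c * exp (- \<xi>) * \<xi> powr (- \<alpha>) * l \<xi>))
        \<in> borel_measurable (restrict_space lborel {0..})"
      using g by (subst measurable_cong[OF eq])
  qed (use g eq in auto)
qed

lemma nn_integral_\<mu>:
  assumes [measurable]: "f \<in> borel_measurable borel"
  shows "(\<integral>\<^sup>+\<xi>. ennreal (exp \<xi>) * f \<xi> \<partial>\<mu>)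
    = (\<integral>\<^sup>+\<xi>. ennreal (c * \<xi> powr (- \<alpha>) * (indicator {0<..} \<xi> * l \<xi>)) * f \<xi> \<partial>lborel)"
proof -
  have pos: "c * \<xi> powr (- \<alpha>) * (indicator {0<..} \<xi> * l \<xi>) \<ge> 0" for \<xi>
    using c l_pos[of \<xi>] by (auto simp: indicator_def)
  have "(\<integral>\<^sup>+\<xi>. ennreal (exp \<xi>) * f \<xi> \<partial>\<mu>)
    = (\<integral>\<^sup>+\<xi>. ennreal (c * exp (- \<xi>) * \<xi> powr (- \<alpha>) * (indicator {0<..} \<xi> * l \<xi>))
          * (ennreal (exp \<xi>) * f \<xi>) * indicator {0..} \<xi> \<partial>lborel)"
    unfolding \<mu>_density
    by (subst nn_integral_density)
       (auto intro!: measurable_restrict_space1 simp: nn_integral_restrict_space)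
  also have "\<dots> = (\<integral>\<^sup>+\<xi>. ennreal (c * \<xi> powr (- \<alpha>) * (indicator {0<..} \<xi> * l \<xi>)) * f \<xi> \<partial>lborel)"
  proof (rule nn_integral_cong)
    fix \<xi> :: real
    have "ennreal (c * exp (- \<xi>) * \<xi> powr (- \<alpha>) * (indicator {0<..} \<xi> * l \<xi>)) * ennreal (exp \<xi>)
       = ennreal (c * \<xi> powr (- \<alpha>) * (indicator {0<..} \<xi> * l \<xi>))"
      using pos[of \<xi>] by (subst ennreal_mult'[symmetric]) (auto simp: exp_minus field_simps)
    then show "ennreal (c * exp (- \<xi>) * \<xi> powr (- \<alpha>) * (indicator {0<..} \<xi> * l \<xi>))
          * (ennreal (exp \<xi>) * f \<xi>) * indicator {0..} \<xi>
        = ennreal (c * \<xi> powr (- \<alpha>) * (indicator {0<..} \<xi> * l \<xi>)) * f \<xi>"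
      by (cases "\<xi> > 0") (auto simp: mult.assoc[symmetric])
  qed
  finally show ?thesis .
qed

lemma ennreal_dyadic_mass:
  "ennreal (dyadic_mass \<mu> k)
    = (\<integral>\<^sup>+\<xi>. ennreal (c * \<xi> powr (- \<alpha>) * (indicator {0<..} \<xi> * l \<xi>))
        * indicator {2 ^ k..<2 ^ Suc k} \<xi> \<partial>lborel)"
proof -
  have "ennreal (dyadic_mass \<mu> k) = (\<integral>\<^sup>+\<xi>. ennreal (exp \<xi> * indicator {2 ^ k..<2 ^ Suc k} \<xi>) \<partial>\<mu>)"
    unfolding dyadic_mass_def
    using integrable_dyadic by (intro nn_integral_eq_integral[symmetric]) auto
  also have "\<dots> = (\<integral>\<^sup>+\<xi>. ennreal (exp \<xi>) * indicator {2 ^ k..<2 ^ Suc k} \<xi> \<partial>\<mu>)"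
    by (intro nn_integral_cong) (simp add: indicator_def)
  finally show ?thesis by (simp add: nn_integral_\<mu>)
qed

lemma dyadic_mass_pos: "dyadic_mass \<mu> k > 0"
proof -
  let ?f = "\<lambda>\<xi>. ennreal (c * \<xi> powr (- \<alpha>) * (indicator {0<..} \<xi> * l \<xi>))
        * indicator {2 ^ k..<2 ^ Suc k} \<xi>"
  have pos: "?f \<xi> > 0" if "\<xi> \<in> {2 ^ k..<2 ^ Suc k}" for \<xi>
  proof -
    have "(0::real) < 2 ^ k" by simp
    then have "\<xi> > 0" using that by (metis atLeastLessThan_iff less_le_trans)
    then show ?thesis using c l_pos[of \<xi>] that by simp
  qed
  have "(\<integral>\<^sup>+\<xi>. ?f \<xi> \<partial>lborel) \<noteq> 0"
  proof
    assume "(\<integral>\<^sup>+\<xi>. ?f \<xi> \<partial>lborel) = 0"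
    then have "AE \<xi> in lborel. ?f \<xi> = 0"
      by (subst (asm) nn_integral_0_iff_AE) auto
    then have "AE \<xi> in lborel. \<xi> \<notin> {2 ^ k..<2 ^ Suc k::real}"
      by eventually_elim (use pos in force)
    then have "emeasure lborel {2 ^ k..<2 ^ Suc k::real} = 0"
      by (subst (asm) AE_iff_measurable[where N="{2 ^ k..<2 ^ Suc k}"]) auto
    then show False by simp
  qed
  then have "ennreal (dyadic_mass \<mu> k) \<noteq> 0"
    by (simp only: ennreal_dyadic_mass not_False_eq_True)
  then show ?thesis
    by (metis ennreal_neg linorder_not_le)
qed

text \<open>Substituting \<open>2 \<xi>\<close> for \<open>\<xi>\<close> maps one dyadic block to the next; the factor is 2 from \<open>d\<xi>\<close>,
\<open>2 powr (- \<alpha>)\<close> from the power, and \<open>q\<close> from \<open>l\<close>.\<close>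

lemma dyadic_mass_Suc_ge:
  assumes q: "0 < q"
    and ge: "\<And>x. x \<ge> 2 ^ k \<Longrightarrow> q * l x \<le> l (2 * x)"
  shows "dyadic_mass \<mu> (Suc k) \<ge> 2 powr (1 - \<alpha>) * q * dyadic_mass \<mu> k"
proof -
  define h where "h = (\<lambda>\<xi>. c * \<xi> powr (- \<alpha>) * (indicator {0<..} \<xi> * l \<xi>))"
  have [measurable]: "h \<in> borel_measurable borel" unfolding h_def by measurable
  have h_nonneg: "h \<xi> \<ge> 0" for \<xi>
    using c l_pos[of \<xi>] by (auto simp: h_def indicator_def)
  have "ennreal (dyadic_mass \<mu> (Suc k))
      = (\<integral>\<^sup>+\<xi>. ennreal (h \<xi>) * indicator {2 ^ Suc k..<2 ^ Suc (Suc k)} \<xi> \<partial>lborel)"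
    by (simp only: ennreal_dyadic_mass h_def)
  also have "\<dots> = 2 * (\<integral>\<^sup>+\<xi>. ennreal (h (2 * \<xi>)) * indicator {2 ^ Suc k..<2 ^ Suc (Suc k)} (2 * \<xi>) \<partial>lborel)"
    by (subst nn_integral_real_affine[where c=2 and t=0]) auto
  also have "\<dots> = (\<integral>\<^sup>+\<xi>. 2 * (ennreal (h (2 * \<xi>)) * indicator {2 ^ k..<2 ^ Suc k} \<xi>) \<partial>lborel)"
    by (subst nn_integral_cmult[symmetric]) (auto intro!: nn_integral_cong simp: indicator_def)
  also have "\<dots> \<ge> (\<integral>\<^sup>+\<xi>. ennreal (2 powr (1 - \<alpha>) * q) * (ennreal (h \<xi>) * indicator {2 ^ k..<2 ^ Suc k} \<xi>) \<partial>lborel)"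
  proof (rule nn_integral_mono)
    fix \<xi> :: real
    show "ennreal (2 powr (1 - \<alpha>) * q) * (ennreal (h \<xi>) * indicator {2 ^ k..<2 ^ Suc k} \<xi>)
        \<le> 2 * (ennreal (h (2 * \<xi>)) * indicator {2 ^ k..<2 ^ Suc k} \<xi>)"
    proof (cases "\<xi> \<in> {2 ^ k..<2 ^ Suc k}")
      case True
      have "(0::real) < 2 ^ k" by simp
      then have \<xi>: "\<xi> > 0" using True by (metis atLeastLessThan_iff less_le_trans)
      have powr2: "2 powr (1 - \<alpha>) = 2 * 2 powr (- \<alpha>)"
        using powr_add[of 2 1 "- \<alpha>"] by simp
      have "2 powr (1 - \<alpha>) * q * h \<xi> = (2 * c * 2 powr (- \<alpha>) * \<xi> powr (- \<alpha>)) * (q * l \<xi>)"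
        using \<xi> by (simp add: h_def powr2)
      also have "\<dots> \<le> (2 * c * 2 powr (- \<alpha>) * \<xi> powr (- \<alpha>)) * l (2 * \<xi>)"
        using True c by (intro mult_left_mono ge) auto
      also have "\<dots> = 2 * h (2 * \<xi>)"
        using \<xi> by (simp add: h_def powr_mult)
      finally have *: "2 powr (1 - \<alpha>) * q * h \<xi> \<le> 2 * h (2 * \<xi>)" .
      have "ennreal (2 powr (1 - \<alpha>) * q) * ennreal (h \<xi>) = ennreal (2 powr (1 - \<alpha>) * q * h \<xi>)"
        using q h_nonneg by (intro ennreal_mult[symmetric]) auto
      also have "\<dots> \<le> ennreal (2 * h (2 * \<xi>))" using * by (rule ennreal_leI)
      also have "\<dots> = 2 * ennreal (h (2 * \<xi>))"
        using h_nonneg by (simp add: ennreal_mult)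
      finally show ?thesis using True by simp
    qed simp
  qed
  also have "(\<integral>\<^sup>+\<xi>. ennreal (2 powr (1 - \<alpha>) * q) * (ennreal (h \<xi>) * indicator {2 ^ k..<2 ^ Suc k} \<xi>) \<partial>lborel)
      = ennreal (2 powr (1 - \<alpha>) * q) * ennreal (dyadic_mass \<mu> k)"
    by (subst nn_integral_cmult) (auto simp only: ennreal_dyadic_mass h_def, auto)
  also have "\<dots> = ennreal (2 powr (1 - \<alpha>) * q * dyadic_mass \<mu> k)"
    using q dyadic_mass_pos[of k] by (intro ennreal_mult[symmetric]) auto
  finally show ?thesis
    using dyadic_mass_pos[of "Suc k"] by (subst (asm) ennreal_le_iff) auto
qed

text \<open>This is where \<open>\<alpha> < 2\<close> matters. From one block to the next the mass shrinks at
most by a factor close to \<open>2 powr (1 - \<alpha>)\<close>, which exceeds \<open>1 / 2\<close>, so the ratio test applies. The sum is the dyadic form of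
the integral of \<open>1 / (- R(1 - y))\<close> near \<open>y = 0\<close>, whose convergence lets a second solution of the
Riccati equation leave the equilibrium 1.\<close>

lemma summable_inverse_dyadic_mass: "summable (\<lambda>k. 1 / 2 ^ k / dyadic_mass \<mu> k)"
proof -
  \<comment> \<open>Half (geometrically) of the gap between \<open>2 powr (\<alpha> - 2)\<close> and 1 is spent on the slowly varying factor, half is kept as ratio.\<close>
  define q where "q = 2 powr ((\<alpha> - 2) / 2)"
  have "2 powr ((\<alpha> - 2) / 2) < 2 powr (0::real)"
    using \<alpha> by (intro powr_less_mono) auto
  then have q: "0 < q" "q < 1" by (simp_all add: q_def)
  obtain x0 where x0: "x0 > 0" "\<And>x. x \<ge> x0 \<Longrightarrow> q * l x \<le> l (2 * x)"
    using slowly_varying_eventually_ge[OF l _ q(2), of 2] by auto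
  obtain k0 :: nat where k0: "x0 < 2 ^ k0"
    using real_arch_pow[of 2 x0] by auto
  show ?thesis
  proof (rule summable_ratio_test[OF q(2)])
    fix k assume k: "k \<ge> k0"
    have "(2::real) ^ k0 \<le> 2 ^ k" using k by (intro power_increasing) auto
    then have "x0 \<le> x" if "x \<ge> 2 ^ k" for x
      using that k0 by linarith
    then have le: "2 powr (1 - \<alpha>) * q * dyadic_mass \<mu> k \<le> dyadic_mass \<mu> (Suc k)"
      by (intro dyadic_mass_Suc_ge q x0(2)) auto
    have "2 powr (1 - \<alpha>) * q * q = 2 powr (1 - \<alpha> + (\<alpha> - 2) / 2 + (\<alpha> - 2) / 2)"
      by (simp only: q_def powr_add)
    also have "1 - \<alpha> + (\<alpha> - 2) / 2 + (\<alpha> - 2) / 2 = (-1::real)" by (simp add: field_simps)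
    finally have eq: "2 powr (1 - \<alpha>) * q = 1 / (2 * q)"
      using q by (simp add: powr_minus field_simps)
    have "dyadic_mass \<mu> k \<le> 2 * q * dyadic_mass \<mu> (Suc k)"
      using le q unfolding eq by (simp add: field_simps)
    then show "norm (1 / 2 ^ Suc k / dyadic_mass \<mu> (Suc k)) \<le> q * norm (1 / 2 ^ k / dyadic_mass \<mu> k)"
      using dyadic_mass_pos[of k] dyadic_mass_pos[of "Suc k"] by (simp add: field_simps)
  qed
qed

lemma summable_inverse_branching_mechanism:
  assumes b: "b = (\<integral>\<xi>. exp \<xi> - 1 - \<xi> \<partial>\<mu>)"
  shows "k \<ge> 4 \<Longrightarrow> branching_mechanism b \<mu> (1 - 1 / 2 ^ k) < 0"
    and "summable (\<lambda>k. 1 / 2 ^ k / (- branching_mechanism b \<mu> (1 - 1 / 2 ^ k)))"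
proof -
  show neg: "branching_mechanism b \<mu> (1 - 1 / 2 ^ k) < 0" if "k \<ge> 4" for k
    using minus_branching_mechanism_ge[OF b that] dyadic_mass_pos[of k] by linarith
  show "summable (\<lambda>k. 1 / 2 ^ k / (- branching_mechanism b \<mu> (1 - 1 / 2 ^ k)))"
  proof (rule summable_comparison_test)
    show "summable (\<lambda>k. 2 * (1 / 2 ^ k / dyadic_mass \<mu> k))"
      by (intro summable_mult summable_inverse_dyadic_mass)
    have "norm (1 / 2 ^ k / (- branching_mechanism b \<mu> (1 - 1 / 2 ^ k)))
        \<le> 2 * (1 / 2 ^ k / dyadic_mass \<mu> k)" if "k \<ge> 4" for k
    proof -
      have "1 / 2 ^ k / (- branching_mechanism b \<mu> (1 - 1 / 2 ^ k)) \<le> 1 / 2 ^ k / (dyadic_mass \<mu> k / 2)"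
        using minus_branching_mechanism_ge[OF b that] dyadic_mass_pos[of k] neg[OF that]
        by (intro divide_left_mono mult_pos_pos) auto
      moreover have "1 / 2 ^ k / (- branching_mechanism b \<mu> (1 - 1 / 2 ^ k)) \<ge> 0"
        using neg[OF that] by (intro divide_nonneg_pos) auto
      ultimately show ?thesis by simp
    qed
    then show "\<exists>N. \<forall>k\<ge>N. norm (1 / 2 ^ k / (- branching_mechanism b \<mu> (1 - 1 / 2 ^ k)))
        \<le> 2 * (1 / 2 ^ k / dyadic_mass \<mu> k)"
      by blast
  qed
qed

end

section \<open>Sampling a right-continuous path on a grid\<close>

definition stop_at :: "ennreal \<Rightarrow> real \<Rightarrow> real" where
  "stop_at T t = enn2real (min (ennreal t) T)"

definition grid :: "real \<Rightarrow> real \<Rightarrow> nat \<Rightarrow> nat \<Rightarrow> real" where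
  "grid s t N i = s + real i * ((t - s) / real (Suc N))"

lemma stopped_eq_stop_at: "stopped T Y t \<omega> = Y (stop_at (T \<omega>) t) \<omega>"
  by (simp add: stopped_def stop_at_def)

lemma stop_at_nonneg: "stop_at T t \<ge> 0"
  by (simp add: stop_at_def)

lemma ennreal_stop_at: "ennreal (stop_at T t) = min (ennreal t) T"
  unfolding stop_at_def by (intro ennreal_enn2real) (simp add: min_less_iff_disj)

lemma stop_at_le: "t \<ge> 0 \<Longrightarrow> stop_at T t \<le> t"
  using ennreal_stop_at[of T t] ennreal_le_iff[of t "stop_at T t"] by simp

lemma less_stop_at_iff:
  assumes "0 \<le> r" "r < t"
  shows "r < stop_at T t \<longleftrightarrow> ennreal r < T"
proof -
  have "r < stop_at T t \<longleftrightarrow> ennreal r < ennreal (stop_at T t)"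
    using assms by (simp add: ennreal_less_iff)
  also have "\<dots> \<longleftrightarrow> ennreal r < ennreal t \<and> ennreal r < T"
    by (simp only: ennreal_stop_at min_less_iff_conj)
  finally show ?thesis using assms by (simp add: ennreal_less_iff)
qed

lemma stop_at_before: "0 \<le> t \<Longrightarrow> ennreal t \<le> T \<Longrightarrow> stop_at T t = t"
  by (simp add: stop_at_def min_absorb1)

lemma stop_at_after: "T \<le> ennreal t \<Longrightarrow> stop_at T t = enn2real T"
  by (simp add: stop_at_def min_absorb2)

lemma stop_at_0: "stop_at T 0 = 0"
  by (simp add: stop_at_def)

lemma right_continuous_sequentially:
  fixes p :: "real \<Rightarrow> real"
  assumes p: "(p \<longlongrightarrow> p r) (at_right r)" and x: "x \<longlonglongrightarrow> r" "\<And>n. x n \<ge> r"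
  shows "(\<lambda>n. p (x n)) \<longlonglongrightarrow> p r"
proof (rule tendstoI)
  fix e :: real assume e: "e > 0"
  have "eventually (\<lambda>y. dist (p y) (p r) < e) (at_right r)"
    using p e by (rule tendstoD)
  then obtain z where z: "z > r" "\<And>y. r < y \<Longrightarrow> y < z \<Longrightarrow> dist (p y) (p r) < e"
    by (auto simp: eventually_at_right_field)
  have "eventually (\<lambda>n. x n < z) sequentially"
    using x(1) z(1) by (rule order_tendstoD)
  then show "eventually (\<lambda>n. dist (p (x n)) (p r) < e) sequentially"
  proof eventually_elim
    case (elim n)
    then show ?case using z(2)[of "x n"] x(2)[of n] e by (cases "x n = r") auto
  qed
qed

lemma grid_0: "grid s t N 0 = s"
  by (simp add: grid_def)

lemma grid_last: "grid s t N (Suc N) = t"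
  by (simp add: grid_def)

lemma grid_Suc: "grid s t N (Suc i) = grid s t N i + (t - s) / real (Suc N)"
  by (simp add: grid_def distrib_right del: times_divide_eq_right)

lemma grid_mono: "s \<le> t \<Longrightarrow> i \<le> j \<Longrightarrow> grid s t N i \<le> grid s t N j"
  unfolding grid_def by (intro add_mono mult_right_mono divide_nonneg_pos) auto

lemma grid_le: "s \<le> t \<Longrightarrow> i \<le> Suc N \<Longrightarrow> grid s t N i \<le> t"
  using grid_mono[of s t i "Suc N" N] grid_last by simp

lemma grid_ge: "s \<le> t \<Longrightarrow> s \<le> grid s t N i"
  using grid_mono[of s t 0 i N] grid_0 by simp

lemma grid_less: "s < t \<Longrightarrow> i \<le> N \<Longrightarrow> grid s t N i < t"
  using grid_le[of s t "Suc i" N] grid_Suc[of s t N i] divide_pos_pos[of "t - s" "real (Suc N)"]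
  by linarith

lemma mesh_tendsto_0: "(\<lambda>N. (t - s) / real (Suc N)) \<longlonglongrightarrow> 0"
  by real_asymp

text \<open>A downward closed property of grid indices holds exactly below some \<open>j\<close>, and the increments kept by
it telescope up to \<open>j\<close>.\<close>

lemma truncated_telescope:
  fixes a :: "nat \<Rightarrow> real"
  assumes Q: "\<And>i j. i \<le> j \<Longrightarrow> Q j \<Longrightarrow> Q i"
  obtains j where "j \<le> n" "\<And>i. i < n \<Longrightarrow> Q i \<longleftrightarrow> i < j"
    "(\<Sum>i<n. if Q i then a (Suc i) - a i else 0) = a j - a 0"
proof -
  have "\<exists>j\<le>n. (\<forall>i<n. Q i \<longleftrightarrow> i < j) \<and> (\<Sum>i<n. if Q i then a (Suc i) - a i else 0) = a j - a 0"
  proof (induction n)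
    case (Suc n)
    then obtain j where j: "j \<le> n" "\<forall>i<n. Q i \<longleftrightarrow> i < j"
      "(\<Sum>i<n. if Q i then a (Suc i) - a i else 0) = a j - a 0" by blast
    show ?case
    proof (cases "Q n")
      case True
      have "\<not> j < n" using j(2) Q[OF j(1) True] by blast
      then have "j = n" using j(1) by simp
      moreover have "Q i" if "i < Suc n" for i using Q[of i n] True that by simp
      ultimately show ?thesis using j(3) by (intro exI[of _ "Suc n"]) simp
    next
      case False
      with j show ?thesis by (intro exI[of _ j]) (auto simp: less_Suc_eq)
    qed
  qed auto
  then show ?thesis using that by blast
qed

text \<open>Keeping an increment only if its left end point comes before \<open>T\<close> stops the path at the first grid
point not before \<open>T\<close>. That point approaches the stopping time from the right, so right-continuity
suffices. The decision depends only on the information at the left end point, which makes the sum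
accessible to the Markov property.\<close>

lemma stopped_increments_tendsto:
  fixes p :: "real \<Rightarrow> real"
  assumes s: "0 \<le> s" "s \<le> t" and p: "\<And>r. r \<ge> 0 \<Longrightarrow> (p \<longlongrightarrow> p r) (at_right r)"
  shows "(\<lambda>N. \<Sum>i<Suc N. if ennreal (grid s t N i) < T
             then p (grid s t N (Suc i)) - p (grid s t N i) else 0)
    \<longlonglongrightarrow> p (stop_at T t) - p (stop_at T s)" (is "?S \<longlonglongrightarrow> _")
proof -
  consider "T \<le> ennreal s" | "s = t" | "ennreal s < T" "s < t" using s by fastforce
  then show ?thesis
  proof cases
    case 1
    then have "T \<le> ennreal t" using s by (meson ennreal_leI order_trans)
    moreover have "?S N = 0" for N
    proof (rule sum.neutral, safe)
      fix i
      have "T \<le> ennreal (grid s t N i)"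
        using 1 grid_ge[OF s(2), of N i] by (meson ennreal_leI order_trans)
      then have "\<not> ennreal (grid s t N i) < T" by (rule leD)
      then show "(if ennreal (grid s t N i) < T then p (grid s t N (Suc i)) - p (grid s t N i) else 0) = 0"
        by (rule if_not_P)
    qed
    ultimately show ?thesis using 1 by (simp add: stop_at_after)
  next
    case 2
    then have g: "grid s t N i = t" for N i by (simp add: grid_def)
    have "?S N = 0" for N by (simp only: g diff_self if_cancel sum.neutral_const)
    then show ?thesis using 2 by simp
  next
    case 3
    define \<theta> where "\<theta> = stop_at T t"
    have \<theta>: "s < \<theta>" "\<theta> \<le> t"
      using less_stop_at_iff[of s t T] 3 s stop_at_le[of t T] by (auto simp: \<theta>_def)
    have ex: "\<exists>j. \<theta> \<le> grid s t N j \<and> grid s t N j \<le> \<theta> + (t - s) / real (Suc N)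
        \<and> ?S N = p (grid s t N j) - p s" for N
    proof -
      have anti: "ennreal (grid s t N i) < T" if "i \<le> j" "ennreal (grid s t N j) < T" for i j
        using grid_mono[OF s(2) that(1), of N] that(2) by (meson ennreal_leI order_le_less_trans)
      obtain j where j: "j \<le> Suc N" "\<And>i. i < Suc N \<Longrightarrow> ennreal (grid s t N i) < T \<longleftrightarrow> i < j"
        "?S N = p (grid s t N j) - p (grid s t N 0)"
      proof (rule truncated_telescope[of "\<lambda>i. ennreal (grid s t N i) < T" "Suc N" "\<lambda>i. p (grid s t N i)"])
        show "ennreal (grid s t N i) < T" if "i \<le> j" "ennreal (grid s t N j) < T" for i j
          using that by (rule anti)
      qed (rule that)
      have below: "grid s t N i < \<theta> \<longleftrightarrow> i < j" if "i < Suc N" for i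
        using j(2)[OF that] less_stop_at_iff[of "grid s t N i" t T] grid_ge[OF s(2), of N i] s
          grid_less[OF 3(2), of i N] that by (simp add: \<theta>_def)
      have "\<theta> \<le> grid s t N j"
        using below[of j] j(1) \<theta>(2) grid_last[of s t N] by (cases "j = Suc N") auto
      moreover have "j > 0" using below[of 0] \<theta>(1) by (simp add: grid_0)
      then obtain i where i: "j = Suc i" by (cases j) auto
      then have "grid s t N j \<le> \<theta> + (t - s) / real (Suc N)"
        using below[of i] j(1) grid_Suc[of s t N i] by simp
      ultimately show ?thesis using j(3) unfolding grid_0 by blast
    qed
    from choice[OF allI[OF ex]] obtain j where
      j_all: "\<forall>N. \<theta> \<le> grid s t N (j N) \<and> grid s t N (j N) \<le> \<theta> + (t - s) / real (Suc N)
        \<and> ?S N = p (grid s t N (j N)) - p s" by (rule exE)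
    note j = j_all[THEN spec, THEN conjunct1] j_all[THEN spec, THEN conjunct2, THEN conjunct1]
      j_all[THEN spec, THEN conjunct2, THEN conjunct2]
    have "(\<lambda>N. \<theta> + (t - s) / real (Suc N)) \<longlonglongrightarrow> \<theta> + 0"
      by (intro tendsto_intros mesh_tendsto_0)
    then have up: "(\<lambda>N. \<theta> + (t - s) / real (Suc N)) \<longlonglongrightarrow> \<theta>" by simp
    have lim: "(\<lambda>N. grid s t N (j N)) \<longlonglongrightarrow> \<theta>"
      by (rule tendsto_sandwich[OF always_eventually always_eventually tendsto_const up])
         (use j(1,2) in blast)+
    have "\<theta> \<ge> 0" using \<theta> s by simp
    from right_continuous_sequentially[OF p[OF this] lim j(1)]
    have "(\<lambda>N. p (grid s t N (j N))) \<longlonglongrightarrow> p \<theta>" .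
    then have "(\<lambda>N. p (grid s t N (j N)) - p s) \<longlonglongrightarrow> p \<theta> - p s"
      by (intro tendsto_intros)
    moreover have "stop_at T s = s" using 3 s by (intro stop_at_before) auto
    ultimately show ?thesis unfolding j(3) by (simp add: \<theta>_def)
  qed
qed

lemma grid_cell:
  assumes "s \<le> r" "r < t"
  obtains j where "j < Suc N" "\<And>i. r \<in> {grid s t N i..<grid s t N (Suc i)} \<longleftrightarrow> i = j"
proof -
  have st: "s \<le> t" using assms by simp
  have anti: "grid s t N i \<le> r" if "i \<le> j" "grid s t N j \<le> r" for i j
    using grid_mono[OF st that(1), of N] that(2) by simp
  obtain k where k: "k \<le> Suc N" "\<And>i. i < Suc N \<Longrightarrow> grid s t N i \<le> r \<longleftrightarrow> i < k"
  proof (rule truncated_telescope[of "\<lambda>i. grid s t N i \<le> r" "Suc N" "\<lambda>_. 0"])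
    show "grid s t N i \<le> r" if "i \<le> j" "grid s t N j \<le> r" for i j
      using that by (rule anti)
  qed (rule that)
  have "k > 0" using k(2)[of 0] assms by (simp add: grid_0)
  then obtain j where j: "k = Suc j" by (cases k) auto
  have le: "grid s t N j \<le> r" using k j by auto
  have gt: "r < grid s t N (Suc j)"
  proof (cases "Suc j = Suc N")
    case True
    then show ?thesis using grid_last[of s t N] assms by simp
  next
    case False
    then have "Suc j < Suc N" using k(1) j by simp
    from k(2)[OF this] j show ?thesis by simp
  qed
  show ?thesis
  proof (rule that[of j])
    show "j < Suc N" using k j by simp
    fix i
    show "r \<in> {grid s t N i..<grid s t N (Suc i)} \<longleftrightarrow> i = j"
    proof
      assume i: "r \<in> {grid s t N i..<grid s t N (Suc i)}"
      have "\<not> Suc i \<le> j"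
        using grid_mono[OF st, of "Suc i" j N] i le by (metis atLeastLessThan_iff leD order_trans)
      moreover have "\<not> Suc j \<le> i"
        using grid_mono[OF st, of "Suc j" i N] i gt by (metis atLeastLessThan_iff leD order_trans)
      ultimately show "i = j" by simp
    next
      assume "i = j"
      then show "r \<in> {grid s t N i..<grid s t N (Suc i)}" using le gt by simp
    qed
  qed
qed

text \<open>The integrand is sampled at right end points, which approach \<open>r\<close> from the right, so that
right-continuity gives convergence at every \<open>r\<close> other than \<open>T\<close>. Left end points would require left
limits to agree with values.\<close>

lemma stopped_riemann_tendsto:
  fixes p :: "real \<Rightarrow> real"
  assumes r: "0 \<le> s" "s \<le> r" "r < t" "ennreal r \<noteq> T" and p: "(p \<longlongrightarrow> p r) (at_right r)"
  shows "(\<lambda>N. \<Sum>i<Suc N. (if ennreal (grid s t N i) < T then p (grid s t N (Suc i)) else 0)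
             * indicator {grid s t N i..<grid s t N (Suc i)} r)
    \<longlonglongrightarrow> (if ennreal r < T then p r else 0)" (is "?S \<longlonglongrightarrow> _")
proof -
  have ex: "\<exists>j. grid s t N j \<le> r \<and> r < grid s t N (Suc j)
    \<and> ?S N = (if ennreal (grid s t N j) < T then p (grid s t N (Suc j)) else 0)" for N
  proof -
    obtain j where j: "j < Suc N" "\<And>i. r \<in> {grid s t N i..<grid s t N (Suc i)} \<longleftrightarrow> i = j"
      using grid_cell[OF r(2,3), of N] by blast
    have ind: "indicator {grid s t N i..<grid s t N (Suc i)} r = (if i = j then 1 else 0 :: real)" for i
      unfolding indicator_def j(2) by simp
    have "?S N = (\<Sum>i<Suc N. if i = j then (if ennreal (grid s t N i) < T then p (grid s t N (Suc i)) else 0) else 0)"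
      by (intro sum.cong refl) (simp only: ind, simp)
    also have "\<dots> = (if ennreal (grid s t N j) < T then p (grid s t N (Suc j)) else 0)"
      using j(1) by (simp only: sum.delta finite_lessThan lessThan_iff if_True)
    finally have S: "?S N = (if ennreal (grid s t N j) < T then p (grid s t N (Suc j)) else 0)" .
    have "grid s t N j \<le> r \<and> r < grid s t N (Suc j)" using j(2)[of j] by simp
    then show ?thesis using S by blast
  qed
  from choice[OF allI[OF ex]] obtain j where
    j_all: "\<forall>N. grid s t N (j N) \<le> r \<and> r < grid s t N (Suc (j N))
      \<and> ?S N = (if ennreal (grid s t N (j N)) < T then p (grid s t N (Suc (j N))) else 0)" by (rule exE)
  note j = j_all[THEN spec, THEN conjunct1] j_all[THEN spec, THEN conjunct2, THEN conjunct1]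
    j_all[THEN spec, THEN conjunct2, THEN conjunct2]
  have "(\<lambda>N. r + (t - s) / real (Suc N)) \<longlonglongrightarrow> r + 0"
    and "(\<lambda>N. r - (t - s) / real (Suc N)) \<longlonglongrightarrow> r - 0"
    by (intro tendsto_intros mesh_tendsto_0)+
  then have up: "(\<lambda>N. r + (t - s) / real (Suc N)) \<longlonglongrightarrow> r"
    and down: "(\<lambda>N. r - (t - s) / real (Suc N)) \<longlonglongrightarrow> r"
    by simp_all
  have bounds: "grid s t N (Suc (j N)) \<le> r + (t - s) / real (Suc N)"
     "r - (t - s) / real (Suc N) \<le> grid s t N (j N)" for N
    using j(1,2)[of N] grid_Suc[of s t N "j N"] by auto
  show ?thesis
  proof (cases "ennreal r < T")
    case True
    then have "ennreal (grid s t N (j N)) < T" for N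
      using j(1)[of N] by (meson ennreal_leI order_le_less_trans)
    moreover have lim: "(\<lambda>N. grid s t N (Suc (j N))) \<longlonglongrightarrow> r"
      by (rule tendsto_sandwich[OF always_eventually always_eventually tendsto_const up])
         (use bounds less_imp_le[OF j(2)] in blast)+
    from right_continuous_sequentially[OF p lim less_imp_le[OF j(2)]]
    have "(\<lambda>N. p (grid s t N (Suc (j N)))) \<longlonglongrightarrow> p r" .
    ultimately show ?thesis using True by (simp only: j(3) if_True)
  next
    case False
    then have T: "T < ennreal r" using r(4) by auto
    then obtain \<tau> where \<tau>: "T = ennreal \<tau>" "0 \<le> \<tau>" "\<tau> < r"
      by (cases T) (auto simp: ennreal_less_iff)
    have "(\<lambda>N. grid s t N (j N)) \<longlonglongrightarrow> r"
      by (rule tendsto_sandwich[OF always_eventually always_eventually down tendsto_const])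
         (use bounds j(1) in blast)+
    then have "eventually (\<lambda>N. \<tau> < grid s t N (j N)) sequentially"
      using \<tau>(3) by (rule order_tendstoD)
    then have "eventually (\<lambda>N. ?S N = 0) sequentially"
    proof eventually_elim
      case (elim N)
      then show ?case unfolding j(3) using \<tau> by (simp add: ennreal_less_iff)
    qed
    then show ?thesis using False by (simp add: tendsto_eventually)
  qed
qed

section \<open>Dynkin's formula at stopping times\<close>

lemma C0_bounded:
  assumes "f \<in> C0 E"
  obtains B where "B \<ge> 0" "\<And>x. x \<in> E \<Longrightarrow> \<bar>f x\<bar> \<le> B"
proof -
  obtain K where K: "compact K" "K \<subseteq> E" "\<And>x. x \<in> E - K \<Longrightarrow> \<bar>f x\<bar> < 1"
    using assms unfolding C0_def by (auto dest: spec[of _ "1::real"])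
  have "compact (f ` K)"
    using assms K by (intro compact_continuous_image) (auto simp: C0_def intro: continuous_on_subset)
  then obtain B where "\<forall>y\<in>f ` K. norm y \<le> B"
    using compact_imp_bounded bounded_iff by metis
  then have B: "\<bar>f x\<bar> \<le> B" if "x \<in> K" for x using that by simp
  show ?thesis
  proof (rule that[of "max B 1"])
    fix x assume "x \<in> E"
    then show "\<bar>f x\<bar> \<le> max B 1"
      using B[of x] K(3)[of x] by (cases "x \<in> K") auto
  qed simp
qed

lemma C0_measurable: "f \<in> C0 E \<Longrightarrow> f \<in> borel_measurable (restrict_space borel E)"
  by (auto simp: C0_def intro: borel_measurable_continuous_on_restrict)

lemma finite_measure_interval: "finite_measure (restrict_space lborel {s..<t::real})"
  by (rule finite_measureI, cases "s \<le> t") (auto simp: space_restrict_space emeasure_restrict_space)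

lemma integral_interval_indicator:
  assumes "s \<le> a" "a \<le> b" "b \<le> (t::real)"
  shows "(\<integral>r. indicator {a..<b} r \<partial>restrict_space lborel {s..<t}) = b - a"
proof -
  have "(\<integral>r. (indicator {a..<b} r :: real) \<partial>restrict_space lborel {s..<t})
      = (\<integral>r. indicator {s..<t} r *\<^sub>R (indicator {a..<b} r :: real) \<partial>lborel)"
    by (subst integral_restrict_space) auto
  also have "\<dots> = (\<integral>r. (indicator {a..<b} r :: real) \<partial>lborel)"
    using assms by (intro Bochner_Integration.integral_cong refl) (auto simp: indicator_def)
  finally show ?thesis using assms by simp
qed

locale cadlag_feller_process =
  fixes M :: "'a measure" and F :: "real \<Rightarrow> 'a measure" and E :: "real set"
    and P :: "real \<Rightarrow> real \<Rightarrow> real measure" and X :: "real \<Rightarrow> 'a \<Rightarrow> real"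
  assumes filt: "filtered_prob_space M F"
    and feller: "feller_process M F E P X"
    and cadlag: "cadlag M X"
begin

sublocale prob_space M
  using filt by (simp add: filtered_prob_space_def)

lemma subalg: "t \<ge> 0 \<Longrightarrow> subalgebra M (F t)"
  using filt by (simp add: filtered_prob_space_def)

lemma space_F: "t \<ge> 0 \<Longrightarrow> space (F t) = space M"
  using subalg by (simp add: subalgebra_def)

lemma sets_F: "t \<ge> 0 \<Longrightarrow> A \<in> sets (F t) \<Longrightarrow> A \<in> sets M"
  using subalg by (auto simp: subalgebra_def)

lemma sets_F_mono: "0 \<le> s \<Longrightarrow> s \<le> t \<Longrightarrow> A \<in> sets (F s) \<Longrightarrow> A \<in> sets (F t)"
  using filt by (auto simp: filtered_prob_space_def)

lemma measurable_F_mono: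
  assumes "0 \<le> s" "s \<le> t" and f: "f \<in> F s \<rightarrow>\<^sub>M N"
  shows "f \<in> F t \<rightarrow>\<^sub>M N"
proof (rule measurableI)
  have sp: "space (F t) = space (F s)" using assms space_F[of s] space_F[of t] by simp
  fix x assume "x \<in> space (F t)"
  then show "f x \<in> space N" unfolding sp by (rule measurable_space[OF f])
next
  have sp: "space (F t) = space (F s)" using assms space_F[of s] space_F[of t] by simp
  fix A assume "A \<in> sets N"
  then show "f -` A \<inter> space (F t) \<in> sets (F t)"
    unfolding sp by (intro sets_F_mono[OF assms(1,2)] measurable_sets[OF f])
qed

lemma sigma_finite_subalgebra: "t \<ge> 0 \<Longrightarrow> sigma_finite_subalgebra M (F t)"
proof -
  assume "t \<ge> 0"
  then interpret finite_measure_subalgebra M "F t"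
    using subalg by unfold_locales
  show ?thesis by (rule sigma_finite_subalgebra_axioms)
qed

lemma X_measurable_restrict: "t \<ge> 0 \<Longrightarrow> X t \<in> F t \<rightarrow>\<^sub>M restrict_space borel E"
  using feller by (simp add: feller_process_def adapted_def)

lemma X_in: "t \<ge> 0 \<Longrightarrow> \<omega> \<in> space M \<Longrightarrow> X t \<omega> \<in> E"
  using measurable_space[OF X_measurable_restrict, of t \<omega>] space_F[of t]
  by (simp add: space_restrict_space)

lemma X_measurable_F: "t \<ge> 0 \<Longrightarrow> X t \<in> borel_measurable (F t)"
  using X_measurable_restrict[of t] by (simp add: measurable_restrict_space2_iff)

lemma X_measurable: "t \<ge> 0 \<Longrightarrow> X t \<in> borel_measurable M"
  using measurable_from_subalg[OF subalg X_measurable_F] .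

lemma C0_X_measurable_F: "t \<ge> 0 \<Longrightarrow> f \<in> C0 E \<Longrightarrow> (\<lambda>\<omega>. f (X t \<omega>)) \<in> borel_measurable (F t)"
  by (rule measurable_compose[OF X_measurable_restrict C0_measurable])

lemma C0_X_measurable: "t \<ge> 0 \<Longrightarrow> f \<in> C0 E \<Longrightarrow> (\<lambda>\<omega>. f (X t \<omega>)) \<in> borel_measurable M"
  using measurable_from_subalg[OF subalg C0_X_measurable_F] .

lemma C0_X_integrable: "t \<ge> 0 \<Longrightarrow> f \<in> C0 E \<Longrightarrow> integrable M (\<lambda>\<omega>. f (X t \<omega>))"
proof -
  assume t: "t \<ge> 0" and f: "f \<in> C0 E"
  obtain B where "\<And>x. x \<in> E \<Longrightarrow> \<bar>f x\<bar> \<le> B" using C0_bounded[OF f] by blast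
  then show ?thesis
    using t f by (intro integrable_const_bound[of _ B] AE_I2 C0_X_measurable) (auto simp: X_in)
qed

lemma C0_X_indicator_integrable:
  "t \<ge> 0 \<Longrightarrow> f \<in> C0 E \<Longrightarrow> B \<in> sets M \<Longrightarrow> integrable M (\<lambda>\<omega>. indicator B \<omega> * f (X t \<omega>))"
  using integrable_mult_indicator[OF _ C0_X_integrable, of B t f] by simp

lemma X_right_continuous: "t \<ge> 0 \<Longrightarrow> \<omega> \<in> space M \<Longrightarrow> ((\<lambda>s. X s \<omega>) \<longlongrightarrow> X t \<omega>) (at_right t)"
  using cadlag by (simp add: cadlag_def)

lemma C0_X_right_continuous:
  assumes "t \<ge> 0" "\<omega> \<in> space M" "f \<in> C0 E"
  shows "((\<lambda>s. f (X s \<omega>)) \<longlongrightarrow> f (X t \<omega>)) (at_right t)"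
proof (rule continuous_on_tendsto_compose[OF _ X_right_continuous])
  show "continuous_on E f" using assms by (simp add: C0_def)
  have "eventually (\<lambda>s. s > t) (at_right t)" by (auto simp: eventually_at_filter)
  then show "eventually (\<lambda>s. X s \<omega> \<in> E) (at_right t)"
    by eventually_elim (use assms in \<open>auto intro!: X_in\<close>)
qed (use assms in \<open>auto intro!: X_in\<close>)

lemma transition_op_C0: "h \<ge> 0 \<Longrightarrow> f \<in> C0 E \<Longrightarrow> transition_op P h f \<in> C0 E"
  using feller by (simp add: feller_process_def feller_semigroup_def)

text \<open>Integrated over an event, the Markov property lets the errors of different grid steps, each
restricted to its own event, be added.\<close>

lemma integral_transition:
  assumes f: "f \<in> C0 E" and s: "s \<ge> 0" and h: "h \<ge> 0" and B: "B \<in> sets (F s)"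
  shows "(\<integral>\<omega>. indicator B \<omega> * f (X (s + h) \<omega>) \<partial>M)
       = (\<integral>\<omega>. indicator B \<omega> * transition_op P h f (X s \<omega>) \<partial>M)"
proof -
  interpret sigma_finite_subalgebra M "F s" using s by (rule sigma_finite_subalgebra)
  have [measurable]: "B \<in> sets M" using B s by (rule_tac sets_F)
  obtain C where "\<And>x. x \<in> E \<Longrightarrow> \<bar>f x\<bar> \<le> C" using C0_bounded[OF f] by blast
  then have bdd: "bounded (f ` E)" by (auto simp: bounded_iff)
  have [measurable]: "(\<lambda>\<omega>. transition_op P h f (X s \<omega>)) \<in> borel_measurable M"
    using s h f by (intro C0_X_measurable transition_op_C0)
  have ae: "AE \<omega> in M. real_cond_exp M (F s) (\<lambda>\<omega>. f (X (s + h) \<omega>)) \<omega> = transition_op P h f (X s \<omega>)"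
    using feller s h C0_measurable[OF f] bdd by (simp add: feller_process_def)
  have "(\<integral>\<omega>. indicator B \<omega> * f (X (s + h) \<omega>) \<partial>M)
      = (\<integral>\<omega>. indicator B \<omega> * real_cond_exp M (F s) (\<lambda>\<omega>. f (X (s + h) \<omega>)) \<omega> \<partial>M)"
    using real_cond_exp_intA[OF C0_X_integrable[OF _ f] B, of "s + h"] s h
    by (simp add: set_lebesgue_integral_def)
  also have "\<dots> = (\<integral>\<omega>. indicator B \<omega> * transition_op P h f (X s \<omega>) \<partial>M)"
    using ae by (intro integral_cong_AE) auto
  finally show ?thesis .
qed

lemma expectation_bound:
  fixes f :: "'a \<Rightarrow> real"
  assumes "B \<in> sets M" "integrable M (\<lambda>\<omega>. indicator B \<omega> * f \<omega>)" "C \<ge> 0"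
    "\<And>\<omega>. \<omega> \<in> space M \<Longrightarrow> \<bar>f \<omega>\<bar> \<le> C"
  shows "\<bar>\<integral>\<omega>. indicator B \<omega> * f \<omega> \<partial>M\<bar> \<le> C"
proof -
  have "\<bar>\<integral>\<omega>. indicator B \<omega> * f \<omega> \<partial>M\<bar> \<le> (\<integral>\<omega>. \<bar>indicator B \<omega> * f \<omega>\<bar> \<partial>M)"
    using integral_norm_bound[of M "\<lambda>\<omega>. indicator B \<omega> * f \<omega>"] by simp
  also have "\<dots> \<le> (\<integral>\<omega>. C \<partial>M)"
    using assms by (intro integral_mono integrable_abs) (auto simp: indicator_def)
  finally have "\<bar>\<integral>\<omega>. indicator B \<omega> * f \<omega> \<partial>M\<bar> \<le> (\<integral>\<omega>. C \<partial>M)" .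
  then show ?thesis by (simp add: prob_space)
qed

text \<open>Both limits behind the estimate, \<open>(P\<^sub>h f - f) / h \<rightarrow> g\<close> and \<open>P\<^sub>h g \<rightarrow> g\<close>, are uniform on the state space. Hence
the same bound holds for every starting time and every event, and the errors of consecutive steps
add up to at most \<open>2 e\<close> times the elapsed time. The second limit moves \<open>g\<close> from the left to
the right end point of the step.\<close>

lemma generator_step:
  assumes gen: "(f, g) \<in> generator E P" and e: "e > 0"
  obtains d where "d > 0"
    "\<And>s h B. 0 \<le> s \<Longrightarrow> 0 \<le> h \<Longrightarrow> h < d \<Longrightarrow> B \<in> sets (F s) \<Longrightarrow>
      \<bar>(\<integral>\<omega>. indicator B \<omega> * f (X (s + h) \<omega>) \<partial>M) - (\<integral>\<omega>. indicator B \<omega> * f (X s \<omega>) \<partial>M)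
        - h * (\<integral>\<omega>. indicator B \<omega> * g (X (s + h) \<omega>) \<partial>M)\<bar> \<le> 2 * e * h"
proof -
  have f: "f \<in> C0 E" and g: "g \<in> C0 E"
    and lim: "uniform_limit E (\<lambda>t x. (transition_op P t f x - f x) / t) g (at_right 0)"
    using gen by (auto simp: generator_def)
  have "uniform_limit E (\<lambda>t. transition_op P t g) g (at_right 0)"
    using feller g by (simp add: feller_process_def feller_semigroup_def)
  then have "eventually (\<lambda>t. \<forall>x\<in>E. dist (transition_op P t g x) (g x) < e) (at_right 0)"
    using e by (rule uniform_limitD)
  then obtain d1 where d1: "d1 > 0"
    "\<And>h x. 0 < h \<Longrightarrow> h < d1 \<Longrightarrow> x \<in> E \<Longrightarrow> \<bar>transition_op P h g x - g x\<bar> < e"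
    by (auto simp: eventually_at_right_field dist_real_def)
  have "eventually (\<lambda>t. \<forall>x\<in>E. dist ((transition_op P t f x - f x) / t) (g x) < e) (at_right 0)"
    using lim e by (rule uniform_limitD)
  then obtain d2 where d2: "d2 > 0"
    "\<And>h x. 0 < h \<Longrightarrow> h < d2 \<Longrightarrow> x \<in> E \<Longrightarrow> \<bar>(transition_op P h f x - f x) / h - g x\<bar> < e"
    by (auto simp: eventually_at_right_field dist_real_def)
  show ?thesis
  proof (rule that[of "min d1 d2"])
    show "min d1 d2 > 0" using d1(1) d2(1) by simp
    fix s h B
    assume s: "0 \<le> s" and h: "0 \<le> h" "h < min d1 d2" and B: "B \<in> sets (F s)"
    show "\<bar>(\<integral>\<omega>. indicator B \<omega> * f (X (s + h) \<omega>) \<partial>M) - (\<integral>\<omega>. indicator B \<omega> * f (X s \<omega>) \<partial>M)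
        - h * (\<integral>\<omega>. indicator B \<omega> * g (X (s + h) \<omega>) \<partial>M)\<bar> \<le> 2 * e * h"
    proof (cases "h = 0")
      case False
      then have h0: "h > 0" using h by simp
      have BM: "B \<in> sets M" using B s by (rule_tac sets_F)
      have int: "integrable M (\<lambda>\<omega>. indicator B \<omega> * \<phi> (X s \<omega>))" if "\<phi> \<in> C0 E" for \<phi>
        using s that BM by (rule C0_X_indicator_integrable)
      have intf: "integrable M (\<lambda>\<omega>. indicator B \<omega> * f (X s \<omega>))"
        and intg: "integrable M (\<lambda>\<omega>. indicator B \<omega> * g (X s \<omega>))"
        and intPf: "integrable M (\<lambda>\<omega>. indicator B \<omega> * transition_op P h f (X s \<omega>))"
        and intPg: "integrable M (\<lambda>\<omega>. indicator B \<omega> * transition_op P h g (X s \<omega>))"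
        by (rule int[OF f], rule int[OF g], rule int[OF transition_op_C0[OF h(1) f]],
            rule int[OF transition_op_C0[OF h(1) g]])
      let ?a = "\<lambda>\<omega>. transition_op P h f (X s \<omega>) - f (X s \<omega>) - h * g (X s \<omega>)"
      let ?b = "\<lambda>\<omega>. transition_op P h g (X s \<omega>) - g (X s \<omega>)"
      have dista: "indicator B \<omega> * ?a \<omega> = indicator B \<omega> * transition_op P h f (X s \<omega>)
          - indicator B \<omega> * f (X s \<omega>) - h * (indicator B \<omega> * g (X s \<omega>))" for \<omega>
        by (simp add: algebra_simps)
      have distb: "indicator B \<omega> * ?b \<omega>
          = indicator B \<omega> * transition_op P h g (X s \<omega>) - indicator B \<omega> * g (X s \<omega>)" for \<omega>
        by (simp add: algebra_simps)
      have inta: "integrable M (\<lambda>\<omega>. indicator B \<omega> * ?a \<omega>)"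
        unfolding dista using intPf intf intg by simp
      have intb: "integrable M (\<lambda>\<omega>. indicator B \<omega> * ?b \<omega>)"
        unfolding distb using intPg intg by simp
      have eqa: "(\<integral>\<omega>. indicator B \<omega> * ?a \<omega> \<partial>M) = (\<integral>\<omega>. indicator B \<omega> * transition_op P h f (X s \<omega>) \<partial>M)
          - (\<integral>\<omega>. indicator B \<omega> * f (X s \<omega>) \<partial>M) - h * (\<integral>\<omega>. indicator B \<omega> * g (X s \<omega>) \<partial>M)"
        unfolding dista using intPf intf intg by simp
      have eqb: "(\<integral>\<omega>. indicator B \<omega> * ?b \<omega> \<partial>M) = (\<integral>\<omega>. indicator B \<omega> * transition_op P h g (X s \<omega>) \<partial>M)
          - (\<integral>\<omega>. indicator B \<omega> * g (X s \<omega>) \<partial>M)"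
        unfolding distb using intPg intg by simp
      have cancel: "((x - y) / h - z) * h = x - y - h * z" for x y z
        using h0 by (subst left_diff_distrib) simp
      have bounda: "\<bar>\<integral>\<omega>. indicator B \<omega> * ?a \<omega> \<partial>M\<bar> \<le> e * h"
      proof (rule expectation_bound[OF BM inta])
        fix \<omega> assume "\<omega> \<in> space M"
        then have "\<bar>(transition_op P h f (X s \<omega>) - f (X s \<omega>)) / h - g (X s \<omega>)\<bar> < e"
          using h by (intro d2(2)[OF h0 _ X_in[OF s]]) auto
        then have "\<bar>(transition_op P h f (X s \<omega>) - f (X s \<omega>)) / h - g (X s \<omega>)\<bar> * h \<le> e * h"
          using h0 by (intro mult_right_mono) auto
        also have "\<bar>(transition_op P h f (X s \<omega>) - f (X s \<omega>)) / h - g (X s \<omega>)\<bar> * h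
            = \<bar>((transition_op P h f (X s \<omega>) - f (X s \<omega>)) / h - g (X s \<omega>)) * h\<bar>"
          using h0 by (simp add: abs_mult)
        also have "((transition_op P h f (X s \<omega>) - f (X s \<omega>)) / h - g (X s \<omega>)) * h = ?a \<omega>"
          by (rule cancel)
        finally show "\<bar>?a \<omega>\<bar> \<le> e * h" .
      qed (use e h0 in simp)
      have boundb: "\<bar>\<integral>\<omega>. indicator B \<omega> * ?b \<omega> \<partial>M\<bar> \<le> e"
      proof (rule expectation_bound[OF BM intb])
        fix \<omega> assume "\<omega> \<in> space M"
        then have "\<bar>?b \<omega>\<bar> < e"
          using h by (intro d1(2)[OF h0 _ X_in[OF s]]) auto
        then show "\<bar>?b \<omega>\<bar> \<le> e" by simp
      qed (use e in simp)
      have combine: "\<bar>x - h * y\<bar> \<le> 2 * e * h" if "\<bar>x\<bar> \<le> e * h" "\<bar>y\<bar> \<le> e" for x y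
      proof -
        have "\<bar>h * y\<bar> \<le> h * e"
          unfolding abs_mult using that(2) h0 by (intro mult_mono) auto
        then have "\<bar>h * y\<bar> \<le> e * h" by (simp only: mult.commute)
        then have "\<bar>x - h * y\<bar> \<le> e * h + e * h" using that(1) by linarith
        then show ?thesis by (simp only: mult_2 distrib_right)
      qed
      have arith: "x - y - h * z = (x - y - h * w) - h * (z - w)" for x y z w
        by (simp add: right_diff_distrib)
      have "(\<integral>\<omega>. indicator B \<omega> * f (X (s + h) \<omega>) \<partial>M) - (\<integral>\<omega>. indicator B \<omega> * f (X s \<omega>) \<partial>M)
          - h * (\<integral>\<omega>. indicator B \<omega> * g (X (s + h) \<omega>) \<partial>M)
        = (\<integral>\<omega>. indicator B \<omega> * ?a \<omega> \<partial>M) - h * (\<integral>\<omega>. indicator B \<omega> * ?b \<omega> \<partial>M)"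
        unfolding integral_transition[OF f s h(1) B] integral_transition[OF g s h(1) B] eqa eqb
        by (rule arith)
      also have "\<bar>\<dots>\<bar> \<le> 2 * e * h"
        by (rule combine[OF bounda boundb])
      finally show ?thesis .
    qed simp
  qed
qed

abbreviation time_product :: "real \<Rightarrow> real \<Rightarrow> ('a \<times> real) measure" where
  "time_product s t \<equiv> M \<Otimes>\<^sub>M restrict_space lborel {s..<t}"

lemma space_time_product: "space (time_product s t) = space M \<times> {s..<t}"
  by (simp add: space_pair_measure space_restrict_space)

lemma finite_measure_time_product: "finite_measure (time_product s t)"
  by (intro finite_measure_pair_measure finite_measure_interval finite_measure_axioms)

text \<open>Joint measurability comes from right-continuity: the path is the limit of its samples at the right
end points of a grid, the case of an infinite stopping time.\<close>

lemma time_product_X_measurable: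
  assumes s: "0 \<le> s" "s \<le> t"
  shows "(\<lambda>z. X (snd z) (fst z)) \<in> borel_measurable (time_product s t)"
proof (rule borel_measurable_LIMSEQ_real)
  fix z assume z: "z \<in> space (time_product s t)"
  then show "(\<lambda>N. \<Sum>i<Suc N. (if ennreal (grid s t N i) < top then X (grid s t N (Suc i)) (fst z) else 0)
             * indicator {grid s t N i..<grid s t N (Suc i)} (snd z)) \<longlonglongrightarrow> X (snd z) (fst z)"
    using stopped_riemann_tendsto[of s "snd z" t top "\<lambda>r. X r (fst z)"] s
      X_right_continuous[of "snd z" "fst z"]
    by (auto simp: space_time_product)
next
  fix N
  show "(\<lambda>z. \<Sum>i<Suc N. (if ennreal (grid s t N i) < top then X (grid s t N (Suc i)) (fst z) else 0)
             * indicator {grid s t N i..<grid s t N (Suc i)} (snd z))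
        \<in> borel_measurable (time_product s t)"
  proof -
    have [measurable]: "X (grid s t N i) \<in> borel_measurable M" for i
      using s grid_ge[OF s(2), of N i] by (intro X_measurable) auto
    have [measurable]: "(indicator {a..<b} :: real \<Rightarrow> real) \<in> borel_measurable (restrict_space lborel {s..<t})" for a b
      by (intro measurable_restrict_space1) auto
    show ?thesis by measurable
  qed
qed

lemma sets_extended_filtration:
  "sets (extended_filtration M F t) \<subseteq> sets M" "space (extended_filtration M F t) = space M"
  using subalg[of "enn2real t"] by (auto simp: extended_filtration_def subalgebra_def)

lemma stopping_time_measurable:
  "stopping_time (extended_filtration M F) T \<Longrightarrow> T \<in> borel_measurable M"
  using sets_extended_filtration by (intro measurable_stopping_time[of "extended_filtration M F" T M]) auto

lemma stopping_time_greater: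
  assumes "stopping_time (extended_filtration M F) T" "t \<ge> 0"
  shows "{\<omega> \<in> space M. ennreal t < T \<omega>} \<in> sets (F t)"
  using stopping_timeD2[OF assms(1), of "ennreal t"] assms(2) space_F[of t]
  by (simp add: extended_filtration_def Measurable.pred_def)

lemma integral_time_product_step:
  fixes u :: "'a \<Rightarrow> real"
  assumes u: "integrable M u" and ab: "s \<le> a" "a \<le> b" "b \<le> t"
  shows "integrable (time_product s t) (\<lambda>z. u (fst z) * indicator {a..<b} (snd z))"
    "(\<integral>z. u (fst z) * indicator {a..<b} (snd z) \<partial>time_product s t) = (b - a) * (\<integral>\<omega>. u \<omega> \<partial>M)"
proof -
  interpret R: finite_measure "restrict_space lborel {s..<t}" by (rule finite_measure_interval)
  interpret Q: pair_sigma_finite M "restrict_space lborel {s..<t}" by unfold_locales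
  have [measurable]: "(indicator {a..<b} :: real \<Rightarrow> real) \<in> borel_measurable (restrict_space lborel {s..<t})"
    by (intro measurable_restrict_space1) auto
  have int_ind: "integrable (restrict_space lborel {s..<t}) (indicator {a..<b} :: real \<Rightarrow> real)"
    by (rule R.integrable_const_bound[where B=1]) (auto simp: indicator_def)
  have [measurable]: "u \<in> borel_measurable M" using u by simp
  show int: "integrable (time_product s t) (\<lambda>z. u (fst z) * indicator {a..<b} (snd z))"
  proof (rule Q.Fubini_integrable)
    show "integrable M (\<lambda>x. \<integral>y. norm (u (fst (x, y)) * indicator {a..<b} (snd (x, y)))
        \<partial>restrict_space lborel {s..<t})"
      using u int_ind by (simp add: abs_mult)
    show "AE x in M. integrable (restrict_space lborel {s..<t})
        (\<lambda>y. u (fst (x, y)) * indicator {a..<b} (snd (x, y)))"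
      using int_ind by simp
  qed measurable
  have "(\<integral>z. u (fst z) * indicator {a..<b} (snd z) \<partial>time_product s t)
      = (\<integral>\<omega>. (\<integral>r. u \<omega> * indicator {a..<b} r \<partial>restrict_space lborel {s..<t}) \<partial>M)"
    using Q.integral_fst'[OF int] by simp
  also have "\<dots> = (\<integral>\<omega>. u \<omega> * (b - a) \<partial>M)"
    using int_ind integral_interval_indicator[OF ab] by simp
  finally show "(\<integral>z. u (fst z) * indicator {a..<b} (snd z) \<partial>time_product s t) = (b - a) * (\<integral>\<omega>. u \<omega> \<partial>M)"
    by (simp add: mult.commute)
qed

text \<open>For each \<open>\<omega>\<close> only the single time \<open>T \<omega>\<close> is excluded.\<close>

lemma AE_time_product_neq:
  assumes T[measurable]: "T \<in> borel_measurable M" and s: "0 \<le> s"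
  shows "AE z in time_product s t. ennreal (snd z) \<noteq> T (fst z)"
proof -
  interpret R: finite_measure "restrict_space lborel {s..<t}" by (rule finite_measure_interval)
  interpret Q: pair_sigma_finite M "restrict_space lborel {s..<t}" by unfold_locales
  have [measurable]: "(\<lambda>r::real. ennreal r) \<in> borel_measurable (restrict_space lborel {s..<t})"
    by (intro measurable_restrict_space1) measurable
  show ?thesis
  proof (rule Q.AE_pair_measure)
    show "{z \<in> space (time_product s t). ennreal (snd z) \<noteq> T (fst z)} \<in> sets (time_product s t)"
      by measurable
    show "AE \<omega> in M. AE r in restrict_space lborel {s..<t}. ennreal (snd (\<omega>, r)) \<noteq> T (fst (\<omega>, r))"
    proof (rule AE_I2)
      fix \<omega>
      have neq: "ennreal r \<noteq> T \<omega>" if "r \<noteq> enn2real (T \<omega>)" "r \<in> {s..<t}" for r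
      proof
        assume "ennreal r = T \<omega>"
        then have "enn2real (T \<omega>) = enn2real (ennreal r)" by simp
        also have "\<dots> = r" using that(2) s by (intro enn2real_ennreal) simp
        finally show False using that(1) by simp
      qed
      have "AE r in lborel. r \<noteq> enn2real (T \<omega>)" by (rule AE_lborel_singleton)
      then have "AE r in lborel. r \<in> {s..<t} \<longrightarrow> ennreal r \<noteq> T \<omega>"
        by eventually_elim (use neq in blast)
      then show "AE r in restrict_space lborel {s..<t}. ennreal (snd (\<omega>, r)) \<noteq> T (fst (\<omega>, r))"
        by (subst AE_restrict_space_iff) simp_all
    qed
  qed
qed

lemma stopped_measurable:
  assumes T: "stopping_time (extended_filtration M F) T" and t: "t \<ge> 0"
  shows "(\<lambda>\<omega>. X (stop_at (T \<omega>) t) \<omega>) \<in> borel_measurable (F t)"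
proof -
  have meas_grid: "X (grid 0 t N i) \<in> borel_measurable (F t)" if "i \<le> Suc N" for i N
    using grid_ge[OF t, of N i] grid_le[OF t that]
    by (intro measurable_F_mono[OF _ _ X_measurable_F]) auto
  have set_grid: "{\<omega> \<in> space (F t). ennreal (grid 0 t N i) < T \<omega>} \<in> sets (F t)" if "i \<le> Suc N" for i N
    using grid_ge[OF t, of N i] grid_le[OF t that] space_F[OF t]
    by (simp only:) (intro sets_F_mono[OF _ _ stopping_time_greater[OF T]], auto)
  have "(\<lambda>\<omega>. X (stop_at (T \<omega>) t) \<omega> - X 0 \<omega>) \<in> borel_measurable (F t)"
  proof (rule borel_measurable_LIMSEQ_real)
    fix \<omega> assume "\<omega> \<in> space (F t)"
    then have "\<omega> \<in> space M" using space_F[OF t] by simp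
    then show "(\<lambda>N. \<Sum>i<Suc N. if ennreal (grid 0 t N i) < T \<omega>
             then X (grid 0 t N (Suc i)) \<omega> - X (grid 0 t N i) \<omega> else 0)
        \<longlonglongrightarrow> X (stop_at (T \<omega>) t) \<omega> - X 0 \<omega>"
      using stopped_increments_tendsto[of 0 t "\<lambda>r. X r \<omega>" "T \<omega>"] X_right_continuous t
      by (simp only: stop_at_0)
  next
    fix N
    show "(\<lambda>\<omega>. \<Sum>i<Suc N. if ennreal (grid 0 t N i) < T \<omega>
             then X (grid 0 t N (Suc i)) \<omega> - X (grid 0 t N i) \<omega> else 0) \<in> borel_measurable (F t)"
    proof (intro borel_measurable_sum measurable_If)
      fix i assume "i \<in> {..<Suc N}"
      then have "i \<le> Suc N" "Suc i \<le> Suc N" by auto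
      then show "{\<omega> \<in> space (F t). ennreal (grid 0 t N i) < T \<omega>} \<in> sets (F t)"
        "(\<lambda>\<omega>. X (grid 0 t N (Suc i)) \<omega> - X (grid 0 t N i) \<omega>) \<in> borel_measurable (F t)"
        by (intro set_grid borel_measurable_diff meas_grid; simp)+
    qed simp
  qed
  moreover have "X 0 \<in> borel_measurable (F t)"
    using t by (intro measurable_F_mono[OF _ _ X_measurable_F]) auto
  ultimately have "(\<lambda>\<omega>. (X (stop_at (T \<omega>) t) \<omega> - X 0 \<omega>) + X 0 \<omega>) \<in> borel_measurable (F t)"
    by (intro borel_measurable_add)
  then show ?thesis by simp
qed

lemma stopped_in: "\<omega> \<in> space M \<Longrightarrow> X (stop_at T t) \<omega> \<in> E"
  by (intro X_in stop_at_nonneg)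

lemma C0_stopped_measurable:
  assumes T: "stopping_time (extended_filtration M F) T" and t: "t \<ge> 0" and f: "f \<in> C0 E"
  shows "(\<lambda>\<omega>. f (X (stop_at (T \<omega>) t) \<omega>)) \<in> borel_measurable M"
proof -
  have "(\<lambda>\<omega>. X (stop_at (T \<omega>) t) \<omega>) \<in> M \<rightarrow>\<^sub>M restrict_space borel E"
    using measurable_from_subalg[OF subalg[OF t] stopped_measurable[OF T t]] stopped_in
    by (simp add: measurable_restrict_space2_iff)
  then show ?thesis by (rule measurable_compose[OF _ C0_measurable[OF f]])
qed

lemma C0_stopped_integrable:
  assumes T: "stopping_time (extended_filtration M F) T" and t: "t \<ge> 0" and f: "f \<in> C0 E"
  shows "integrable M (\<lambda>\<omega>. f (X (stop_at (T \<omega>) t) \<omega>))"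
proof -
  obtain B where B: "\<And>x. x \<in> E \<Longrightarrow> \<bar>f x\<bar> \<le> B" using C0_bounded[OF f] by blast
  show ?thesis
    by (rule integrable_const_bound[where B=B])
       (auto intro!: B stopped_in C0_stopped_measurable[OF T t f])
qed

lemma C0_stopped_indicator_integrable:
  assumes T: "stopping_time (extended_filtration M F) T" and t: "t \<ge> 0" and f: "f \<in> C0 E"
    and A: "A \<in> sets M"
  shows "integrable M (\<lambda>\<omega>. indicator A \<omega> * f (X (stop_at (T \<omega>) t) \<omega>))"
  using integrable_mult_indicator[OF A C0_stopped_integrable[OF T t f]] by simp

lemma time_product_integrand_measurable:
  assumes T[measurable]: "T \<in> borel_measurable M" and s: "0 \<le> s" "s \<le> t"
    and A[measurable]: "A \<in> sets M"
    and g: "g \<in> borel_measurable (restrict_space borel E)"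
  shows "(\<lambda>z. indicator A (fst z) * (if ennreal (snd z) < T (fst z) then g (X (snd z) (fst z)) else 0) :: real)
    \<in> borel_measurable (time_product s t)"
proof -
  have [measurable]: "(\<lambda>r::real. ennreal r) \<in> borel_measurable (restrict_space lborel {s..<t})"
    by (intro measurable_restrict_space1) measurable
  have "(\<lambda>z. X (snd z) (fst z)) \<in> time_product s t \<rightarrow>\<^sub>M restrict_space borel E"
    using time_product_X_measurable[OF s] X_in s
    by (auto simp: measurable_restrict_space2_iff space_time_product)
  then have [measurable]: "(\<lambda>z. g (X (snd z) (fst z))) \<in> borel_measurable (time_product s t)"
    by (rule measurable_compose[OF _ g])
  show ?thesis by measurable
qed

text \<open>Sum the one-step estimate over a grid on \<open>[s, t]\<close>, in the step from \<open>t\<^sub>i\<close> restricted to the event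
\<open>A \<inter> {T > t\<^sub>i}\<close>, which belongs to \<open>F t\<^sub>i\<close>. As the mesh tends to 0 the total error vanishes, the sum of
increments of \<open>f\<close> tends to the increment of the stopped process, and the sum of the \<open>g\<close>-terms tends to
the time integral up to \<open>T\<close>. In this way the martingale property at stopping times is obtained
directly, without optional stopping in continuous time.\<close>

theorem stopped_dynkin_formula:
  assumes gen: "(f, g) \<in> generator E P"
    and T: "stopping_time (extended_filtration M F) T"
    and st: "0 \<le> s" "s \<le> t" and A: "A \<in> sets (F s)"
  shows "(\<integral>\<omega>. indicator A \<omega> * f (X (stop_at (T \<omega>) t) \<omega>) \<partial>M)
       - (\<integral>\<omega>. indicator A \<omega> * f (X (stop_at (T \<omega>) s) \<omega>) \<partial>M)
     = (\<integral>z. indicator A (fst z) * (if ennreal (snd z) < T (fst z) then g (X (snd z) (fst z)) else 0)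
          \<partial>time_product s t)"
proof -
  have f: "f \<in> C0 E" and g: "g \<in> C0 E" using gen by (auto simp: generator_def)
  obtain Bf where Bf: "Bf \<ge> 0" "\<And>x. x \<in> E \<Longrightarrow> \<bar>f x\<bar> \<le> Bf" using C0_bounded[OF f] by blast
  obtain Bg where Bg: "Bg \<ge> 0" "\<And>x. x \<in> E \<Longrightarrow> \<bar>g x\<bar> \<le> Bg" using C0_bounded[OF g] by blast
  have t0: "0 \<le> t" using st by simp
  have AM: "A \<in> sets M" using A st by (rule_tac sets_F)
  have TM: "T \<in> borel_measurable M" using T by (rule stopping_time_measurable)
  define G where "G = grid s t"
  have G0: "0 \<le> G N i" for N i using grid_ge[OF st(2), of N i] st by (simp add: G_def)
  have G_Suc: "G N (Suc i) = G N i + (t - s) / real (Suc N)" for N i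
    by (simp only: G_def grid_Suc)
  define mesh where "mesh = (\<lambda>N. (t - s) / real (Suc N))"
  have mesh0: "mesh N \<ge> 0" for N using st by (simp add: mesh_def)
  have G_mesh: "G N (Suc i) = G N i + mesh N" for N i
    by (simp only: mesh_def G_Suc)
  define AA where "AA = (\<lambda>N i. A \<inter> {\<omega> \<in> space M. ennreal (G N i) < T \<omega>})"
  have AA_F: "AA N i \<in> sets (F (G N i))" for N i
    unfolding AA_def
    using sets_F_mono[OF st(1) _ A, of "G N i"] grid_ge[OF st(2), of N i] stopping_time_greater[OF T G0]
    by (intro sets.Int) (auto simp: G_def)
  have AA_M: "AA N i \<in> sets M" for N i using sets_F[OF G0 AA_F] .
  have int: "integrable M (\<lambda>\<omega>. indicator (AA N i) \<omega> * \<phi> (X (G N j) \<omega>))" if "\<phi> \<in> C0 E" for N i j \<phi>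
    by (rule C0_X_indicator_integrable[OF G0 that AA_M])
  \<comment> \<open>\<open>U\<close> approximates the increment of \<open>f\<close> along the stopped path, \<open>V\<close> the integrand of the time integral.\<close>
  define U where "U = (\<lambda>N \<omega>. \<Sum>i<Suc N. if ennreal (G N i) < T \<omega>
             then f (X (G N (Suc i)) \<omega>) - f (X (G N i) \<omega>) else 0)"
  define V where "V = (\<lambda>N z. \<Sum>i<Suc N. (if ennreal (G N i) < T (fst z) then g (X (G N (Suc i)) (fst z)) else 0)
             * indicator {G N i..<G N (Suc i)} (snd z))"
  have AU: "indicator A \<omega> * U N \<omega> = (\<Sum>i<Suc N. indicator (AA N i) \<omega> * f (X (G N (Suc i)) \<omega>)
      - indicator (AA N i) \<omega> * f (X (G N i) \<omega>))" if "\<omega> \<in> space M" for N \<omega>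
    unfolding U_def sum_distrib_left
    by (intro sum.cong refl) (use that in \<open>simp add: AA_def indicator_def\<close>)
  have AV: "indicator A (fst z) * V N z = (\<Sum>i<Suc N. (indicator (AA N i) (fst z) * g (X (G N (Suc i)) (fst z)))
       * indicator {G N i..<G N (Suc i)} (snd z))" if "z \<in> space (time_product s t)" for N z
    unfolding V_def sum_distrib_left
    by (intro sum.cong refl) (use that in \<open>simp add: AA_def indicator_def space_time_product mem_Times_iff\<close>)
  have EU: "(\<integral>\<omega>. indicator A \<omega> * U N \<omega> \<partial>M) = (\<Sum>i<Suc N. (\<integral>\<omega>. indicator (AA N i) \<omega> * f (X (G N (Suc i)) \<omega>) \<partial>M)
      - (\<integral>\<omega>. indicator (AA N i) \<omega> * f (X (G N i) \<omega>) \<partial>M))" for N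
  proof -
    have "(\<integral>\<omega>. indicator A \<omega> * U N \<omega> \<partial>M) = (\<integral>\<omega>. (\<Sum>i<Suc N. indicator (AA N i) \<omega> * f (X (G N (Suc i)) \<omega>)
      - indicator (AA N i) \<omega> * f (X (G N i) \<omega>)) \<partial>M)"
      by (rule Bochner_Integration.integral_cong[OF refl AU])
    also have "\<dots> = (\<Sum>i<Suc N. (\<integral>\<omega>. indicator (AA N i) \<omega> * f (X (G N (Suc i)) \<omega>)
      - indicator (AA N i) \<omega> * f (X (G N i) \<omega>) \<partial>M))"
      by (rule Bochner_Integration.integral_sum) (intro Bochner_Integration.integrable_diff int f)
    also have "\<dots> = (\<Sum>i<Suc N. (\<integral>\<omega>. indicator (AA N i) \<omega> * f (X (G N (Suc i)) \<omega>) \<partial>M)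
      - (\<integral>\<omega>. indicator (AA N i) \<omega> * f (X (G N i) \<omega>) \<partial>M))"
      by (rule sum.cong[OF refl], rule Bochner_Integration.integral_diff) (intro int f)+
    finally show ?thesis .
  qed
  have step: "integrable (time_product s t) (\<lambda>z. (indicator (AA N i) (fst z) * g (X (G N (Suc i)) (fst z)))
       * indicator {G N i..<G N (Suc i)} (snd z))"
     "(\<integral>z. (indicator (AA N i) (fst z) * g (X (G N (Suc i)) (fst z)))
       * indicator {G N i..<G N (Suc i)} (snd z) \<partial>time_product s t)
      = mesh N * (\<integral>\<omega>. indicator (AA N i) \<omega> * g (X (G N (Suc i)) \<omega>) \<partial>M)" if "i < Suc N" for N i
  proof -
    have ord: "s \<le> G N i" "G N i \<le> G N (Suc i)" "G N (Suc i) \<le> t"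
      using grid_ge[OF st(2), of N i] grid_mono[OF st(2), of i "Suc i" N] grid_le[OF st(2), of "Suc i" N] that
      by (simp_all add: G_def)
    note r = integral_time_product_step[OF int[OF g, of N i "Suc i"] ord]
    show "integrable (time_product s t) (\<lambda>z. (indicator (AA N i) (fst z) * g (X (G N (Suc i)) (fst z)))
       * indicator {G N i..<G N (Suc i)} (snd z))" by (rule r(1))
    have "G N (Suc i) - G N i = mesh N" by (simp only: G_mesh)
    with r(2) show "(\<integral>z. (indicator (AA N i) (fst z) * g (X (G N (Suc i)) (fst z)))
       * indicator {G N i..<G N (Suc i)} (snd z) \<partial>time_product s t)
      = mesh N * (\<integral>\<omega>. indicator (AA N i) \<omega> * g (X (G N (Suc i)) \<omega>) \<partial>M)" by (simp only:)
  qed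
  have EV: "(\<integral>z. indicator A (fst z) * V N z \<partial>time_product s t)
      = (\<Sum>i<Suc N. mesh N * (\<integral>\<omega>. indicator (AA N i) \<omega> * g (X (G N (Suc i)) \<omega>) \<partial>M))" for N
  proof -
    have "(\<integral>z. indicator A (fst z) * V N z \<partial>time_product s t)
      = (\<integral>z. (\<Sum>i<Suc N. (indicator (AA N i) (fst z) * g (X (G N (Suc i)) (fst z)))
       * indicator {G N i..<G N (Suc i)} (snd z)) \<partial>time_product s t)"
      by (rule Bochner_Integration.integral_cong[OF refl AV])
    also have "\<dots> = (\<Sum>i<Suc N. (\<integral>z. (indicator (AA N i) (fst z) * g (X (G N (Suc i)) (fst z)))
       * indicator {G N i..<G N (Suc i)} (snd z) \<partial>time_product s t))"
      by (rule Bochner_Integration.integral_sum, rule step(1)) (simp only: lessThan_iff)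
    also have "\<dots> = (\<Sum>i<Suc N. mesh N * (\<integral>\<omega>. indicator (AA N i) \<omega> * g (X (G N (Suc i)) \<omega>) \<partial>M))"
      by (rule sum.cong[OF refl], rule step(2)) (simp only: lessThan_iff)
    finally show ?thesis .
  qed
  have small: "(\<lambda>N. (\<integral>\<omega>. indicator A \<omega> * U N \<omega> \<partial>M) - (\<integral>z. indicator A (fst z) * V N z \<partial>time_product s t))
      \<longlonglongrightarrow> 0"
  proof (rule LIMSEQ_I)
    fix \<epsilon> :: real assume \<epsilon>: "\<epsilon> > 0"
    \<comment> \<open>The added 1 covers \<open>s = t\<close>.\<close>
    define e where "e = \<epsilon> / (4 * (t - s + 1))"
    have e: "e > 0" "2 * e * (t - s) < \<epsilon>"
      using \<epsilon> st by (auto simp: e_def field_simps add_strict_increasing)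
    obtain d where d: "d > 0" "\<And>s h B. 0 \<le> s \<Longrightarrow> 0 \<le> h \<Longrightarrow> h < d \<Longrightarrow> B \<in> sets (F s) \<Longrightarrow>
      \<bar>(\<integral>\<omega>. indicator B \<omega> * f (X (s + h) \<omega>) \<partial>M) - (\<integral>\<omega>. indicator B \<omega> * f (X s \<omega>) \<partial>M)
        - h * (\<integral>\<omega>. indicator B \<omega> * g (X (s + h) \<omega>) \<partial>M)\<bar> \<le> 2 * e * h"
      by (rule generator_step[OF gen e(1)]) (rule that)
    have "eventually (\<lambda>N. mesh N < d) sequentially"
      using mesh_tendsto_0[of t s] d(1) unfolding mesh_def by (rule order_tendstoD)
    then obtain N0 where N0: "\<And>N. N \<ge> N0 \<Longrightarrow> mesh N < d"
      by (auto simp: eventually_sequentially)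
    show "\<exists>N0. \<forall>N\<ge>N0. norm ((\<integral>\<omega>. indicator A \<omega> * U N \<omega> \<partial>M)
        - (\<integral>z. indicator A (fst z) * V N z \<partial>time_product s t) - 0) < \<epsilon>"
    proof (intro exI allI impI)
      fix N assume N: "N \<ge> N0"
      have "\<bar>(\<integral>\<omega>. indicator A \<omega> * U N \<omega> \<partial>M) - (\<integral>z. indicator A (fst z) * V N z \<partial>time_product s t)\<bar>
        \<le> (\<Sum>i<Suc N. 2 * e * mesh N)"
        unfolding EU EV sum_subtractf[symmetric] G_mesh
        by (rule order_trans[OF sum_abs], rule sum_mono, rule d(2)[OF G0 mesh0 N0[OF N] AA_F])
      also have "\<dots> = 2 * e * (real (Suc N) * mesh N)" by (simp add: algebra_simps)
      also have "real (Suc N) * mesh N = t - s" by (simp add: mesh_def del: of_nat_Suc)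
      finally show "norm ((\<integral>\<omega>. indicator A \<omega> * U N \<omega> \<partial>M)
        - (\<integral>z. indicator A (fst z) * V N z \<partial>time_product s t) - 0) < \<epsilon>"
        using e(2) by (simp only: real_norm_def diff_zero)
    qed
  qed
  have limU: "(\<lambda>N. \<integral>\<omega>. indicator A \<omega> * U N \<omega> \<partial>M)
    \<longlonglongrightarrow> (\<integral>\<omega>. indicator A \<omega> * (f (X (stop_at (T \<omega>) t) \<omega>) - f (X (stop_at (T \<omega>) s) \<omega>)) \<partial>M)"
  proof (rule integral_dominated_convergence)
    show "(\<lambda>\<omega>. indicator A \<omega> * (f (X (stop_at (T \<omega>) t) \<omega>) - f (X (stop_at (T \<omega>) s) \<omega>))) \<in> borel_measurable M"
      using AM C0_stopped_measurable[OF T t0 f] C0_stopped_measurable[OF T st(1) f]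
      by (intro borel_measurable_times borel_measurable_diff borel_measurable_indicator)
    show "(\<lambda>\<omega>. indicator A \<omega> * U N \<omega>) \<in> borel_measurable M" for N
      by (subst measurable_cong[OF AU], assumption)
         (intro borel_measurable_sum borel_measurable_diff borel_measurable_integrable int f)
    show "integrable M (\<lambda>_. 2 * Bf)" by simp
    show "AE \<omega> in M. (\<lambda>N. indicator A \<omega> * U N \<omega>)
        \<longlonglongrightarrow> indicator A \<omega> * (f (X (stop_at (T \<omega>) t) \<omega>) - f (X (stop_at (T \<omega>) s) \<omega>))"
    proof (rule AE_I2)
      fix \<omega> assume "\<omega> \<in> space M"
      then have rc: "((\<lambda>r. f (X r \<omega>)) \<longlongrightarrow> f (X r \<omega>)) (at_right r)" if "r \<ge> 0" for r
        using that f by (intro C0_X_right_continuous)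
      show "(\<lambda>N. indicator A \<omega> * U N \<omega>)
        \<longlonglongrightarrow> indicator A \<omega> * (f (X (stop_at (T \<omega>) t) \<omega>) - f (X (stop_at (T \<omega>) s) \<omega>))"
        unfolding U_def G_def
        by (rule tendsto_mult[OF tendsto_const
              stopped_increments_tendsto[where p="\<lambda>r. f (X r \<omega>)", OF st rc]])
    qed
    show "AE \<omega> in M. norm (indicator A \<omega> * U N \<omega>) \<le> 2 * Bf" for N
    proof (rule AE_I2)
      fix \<omega> assume \<omega>: "\<omega> \<in> space M"
      have "\<bar>U N \<omega>\<bar> \<le> 2 * Bf"
      proof (rule truncated_telescope[of "\<lambda>i. ennreal (G N i) < T \<omega>" "Suc N" "\<lambda>i. f (X (G N i) \<omega>)"])
        show "ennreal (G N i) < T \<omega>" if "i \<le> j" "ennreal (G N j) < T \<omega>" for i j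
          using grid_mono[OF st(2) that(1), of N] that(2) unfolding G_def
          by (meson ennreal_leI order_le_less_trans)
        fix j assume "(\<Sum>i<Suc N. if ennreal (G N i) < T \<omega> then f (X (G N (Suc i)) \<omega>) - f (X (G N i) \<omega>) else 0)
            = f (X (G N j) \<omega>) - f (X (G N 0) \<omega>)"
        then have "U N \<omega> = f (X (G N j) \<omega>) - f (X (G N 0) \<omega>)" by (simp only: U_def)
        then show "\<bar>U N \<omega>\<bar> \<le> 2 * Bf"
          using Bf(2)[OF X_in[OF G0 \<omega>], of N j] Bf(2)[OF X_in[OF G0 \<omega>], of N 0] by linarith
      qed
      then show "norm (indicator A \<omega> * U N \<omega>) \<le> 2 * Bf"
        using Bf(1) by (simp add: indicator_def)
    qed
  qed
  have limV: "(\<lambda>N. \<integral>z. indicator A (fst z) * V N z \<partial>time_product s t)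
    \<longlonglongrightarrow> (\<integral>z. indicator A (fst z) * (if ennreal (snd z) < T (fst z) then g (X (snd z) (fst z)) else 0)
          \<partial>time_product s t)"
  proof (rule integral_dominated_convergence)
    show "(\<lambda>z. indicator A (fst z) * (if ennreal (snd z) < T (fst z) then g (X (snd z) (fst z)) else 0))
        \<in> borel_measurable (time_product s t)"
      by (rule time_product_integrand_measurable[OF TM st AM C0_measurable[OF g]])
    show "(\<lambda>z. indicator A (fst z) * V N z) \<in> borel_measurable (time_product s t)" for N
      by (subst measurable_cong[OF AV], assumption)
         (rule borel_measurable_sum, rule borel_measurable_integrable, rule step(1), simp only: lessThan_iff)
    interpret Q: finite_measure "time_product s t" by (rule finite_measure_time_product)
    show "integrable (time_product s t) (\<lambda>_. Bg)" by simp
    show "AE z in time_product s t. (\<lambda>N. indicator A (fst z) * V N z)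
        \<longlonglongrightarrow> indicator A (fst z) * (if ennreal (snd z) < T (fst z) then g (X (snd z) (fst z)) else 0)"
      using AE_time_product_neq[OF TM st(1), of t] AE_space
    proof eventually_elim
      case (elim z)
      then have z: "fst z \<in> space M" "s \<le> snd z" "snd z < t" "0 \<le> snd z"
        using st by (auto simp: space_time_product)
      show ?case
        unfolding V_def G_def
        by (rule tendsto_mult[OF tendsto_const
              stopped_riemann_tendsto[where p="\<lambda>r. g (X r (fst z))", OF st(1) z(2,3) elim(1)
                C0_X_right_continuous[OF z(4,1) g]]])
    qed
    show "AE z in time_product s t. norm (indicator A (fst z) * V N z) \<le> Bg" for N
    proof (rule AE_I2)
      fix z assume "z \<in> space (time_product s t)"
      then have z: "fst z \<in> space M" "s \<le> snd z" "snd z < t"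
        by (auto simp: space_time_product)
      obtain j where j: "j < Suc N" "\<And>i. snd z \<in> {grid s t N i..<grid s t N (Suc i)} \<longleftrightarrow> i = j"
        by (rule grid_cell[OF z(2,3), of N]) (rule that)
      have ind: "indicator {G N i..<G N (Suc i)} (snd z) = (if i = j then 1 else 0 :: real)" for i
        unfolding indicator_def G_def j(2) by simp
      have "V N z = (\<Sum>i<Suc N. if i = j then (if ennreal (G N i) < T (fst z) then g (X (G N (Suc i)) (fst z)) else 0) else 0)"
        unfolding V_def by (intro sum.cong refl) (simp only: ind, simp)
      also have "\<dots> = (if ennreal (G N j) < T (fst z) then g (X (G N (Suc j)) (fst z)) else 0)"
        using j(1) by (simp only: sum.delta finite_lessThan lessThan_iff if_True)
      finally have "\<bar>V N z\<bar> \<le> Bg"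
        using Bg(2)[OF X_in[OF G0 z(1)], of N "Suc j"] Bg(1) by simp
      then show "norm (indicator A (fst z) * V N z) \<le> Bg"
        using Bg(1) by (simp add: indicator_def)
    qed
  qed
  have "(\<integral>\<omega>. indicator A \<omega> * (f (X (stop_at (T \<omega>) t) \<omega>) - f (X (stop_at (T \<omega>) s) \<omega>)) \<partial>M)
      = (\<integral>z. indicator A (fst z) * (if ennreal (snd z) < T (fst z) then g (X (snd z) (fst z)) else 0)
          \<partial>time_product s t)"
    using LIMSEQ_unique[OF tendsto_diff[OF limU limV] small] by simp
  moreover have "(\<integral>\<omega>. indicator A \<omega> * (f (X (stop_at (T \<omega>) t) \<omega>) - f (X (stop_at (T \<omega>) s) \<omega>)) \<partial>M)
      = (\<integral>\<omega>. indicator A \<omega> * f (X (stop_at (T \<omega>) t) \<omega>) \<partial>M)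
       - (\<integral>\<omega>. indicator A \<omega> * f (X (stop_at (T \<omega>) s) \<omega>) \<partial>M)"
    unfolding right_diff_distrib
    by (rule Bochner_Integration.integral_diff[OF C0_stopped_indicator_integrable[OF T t0 f AM]
          C0_stopped_indicator_integrable[OF T st(1) f AM]])
  ultimately show ?thesis by (simp only:)
qed

end

section \<open>First passage times\<close>

definition first_passage :: "(real \<Rightarrow> 'a \<Rightarrow> real) \<Rightarrow> real \<Rightarrow> 'a \<Rightarrow> ennreal" where
  "first_passage Y c \<omega> = (INF t\<in>{t. 0 \<le> t \<and> c < Y t \<omega>}. ennreal t)"

lemma less_first_passageD:
  assumes r: "0 \<le> r" and less: "ennreal r < first_passage Y c \<omega>"
  shows "Y r \<omega> \<le> c"
proof (rule ccontr)
  assume "\<not> Y r \<omega> \<le> c"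
  then have "r \<in> {t. 0 \<le> t \<and> c < Y t \<omega>}" using r by simp
  then have "first_passage Y c \<omega> \<le> ennreal r"
    unfolding first_passage_def by (rule INF_lower)
  with less show False by (meson leD)
qed

lemma first_passage_mono:
  assumes "c \<le> c'"
  shows "first_passage Y c \<omega> \<le> first_passage Y c' \<omega>"
  unfolding first_passage_def
proof (rule INF_superset_mono[OF _ order_refl])
  show "{t. 0 \<le> t \<and> c' < Y t \<omega>} \<subseteq> {t. 0 \<le> t \<and> c < Y t \<omega>}"
    using assms by auto
qed

text \<open>Near every point the path is bounded, to the right by right-continuity and to the left by the left
limit; bisection makes this global. For the process it follows that passage times to high levels
come late.\<close>

lemma cadlag_bounded_above:
  fixes p :: "real \<Rightarrow> real"
  assumes right: "\<And>t. t \<ge> 0 \<Longrightarrow> (p \<longlongrightarrow> p t) (at_right t)"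
    and left: "\<And>t. t > 0 \<Longrightarrow> \<exists>l. (p \<longlongrightarrow> l) (at_left t)"
    and C: "C \<ge> 0"
  obtains B where "\<And>r. 0 \<le> r \<Longrightarrow> r \<le> C \<Longrightarrow> p r \<le> B"
proof -
  have "\<exists>B. \<forall>r\<in>{0..C}. 0 \<le> r \<longrightarrow> p r \<le> B"
    using C
  proof (rule Bolzano[where P="\<lambda>a b. \<exists>B. \<forall>r\<in>{a..b}. 0 \<le> r \<longrightarrow> p r \<le> B"])
    fix a b c
    assume trans: "\<exists>B. \<forall>r\<in>{a..b}. 0 \<le> r \<longrightarrow> p r \<le> B" "\<exists>B. \<forall>r\<in>{b..c}. 0 \<le> r \<longrightarrow> p r \<le> B"
    from trans(1) obtain B1 where B1: "\<forall>r\<in>{a..b}. 0 \<le> r \<longrightarrow> p r \<le> B1" ..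
    from trans(2) obtain B2 where B2: "\<forall>r\<in>{b..c}. 0 \<le> r \<longrightarrow> p r \<le> B2" ..
    show "\<exists>B. \<forall>r\<in>{a..c}. 0 \<le> r \<longrightarrow> p r \<le> B"
    proof (intro exI[of _ "max B1 B2"] ballI impI)
      fix r assume r: "r \<in> {a..c}" "0 \<le> r"
      show "p r \<le> max B1 B2"
      proof (cases "r \<le> b")
        case True
        then have "p r \<le> B1" using r B1 by simp
        then show ?thesis by simp
      next
        case False
        then have "p r \<le> B2" using r B2 by simp
        then show ?thesis by simp
      qed
    qed
  next
    fix x assume x: "0 \<le> x" "x \<le> C"
    have "eventually (\<lambda>r. p r < p x + 1) (at_right x)"
      using right[OF x(1)] by (rule order_tendstoD) simp
    then obtain z where z: "z > x" "\<And>r. x < r \<Longrightarrow> r < z \<Longrightarrow> p r < p x + 1"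
      by (auto simp: eventually_at_right_field)
    have "\<exists>y B. y < x \<and> (\<forall>r. y < r \<longrightarrow> r < x \<longrightarrow> 0 \<le> r \<longrightarrow> p r \<le> B)"
    proof (cases "x = 0")
      case True
      then show ?thesis by (intro exI[of _ "-1"]) auto
    next
      case False
      then have "x > 0" using x(1) by simp
      then obtain l where l: "(p \<longlongrightarrow> l) (at_left x)" using left by blast
      have "eventually (\<lambda>r. p r < l + 1) (at_left x)"
        using l by (rule order_tendstoD) simp
      then obtain y where "y < x" "\<And>r. y < r \<Longrightarrow> r < x \<Longrightarrow> p r < l + 1"
        by (auto simp: eventually_at_left_field)
      then show ?thesis by (intro exI[of _ y] exI[of _ "l + 1"]) (auto intro: less_imp_le)
    qed
    then obtain y B where y: "y < x" "\<And>r. y < r \<Longrightarrow> r < x \<Longrightarrow> 0 \<le> r \<Longrightarrow> p r \<le> B" by blast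
    show "\<exists>d>0. \<forall>a b. a \<le> x \<and> x \<le> b \<and> b - a < d \<longrightarrow> (\<exists>B. \<forall>r\<in>{a..b}. 0 \<le> r \<longrightarrow> p r \<le> B)"
    proof (rule exI[of _ "min (z - x) (x - y)"], intro conjI allI impI)
      show "min (z - x) (x - y) > 0" using y z by simp
      fix a b assume ab: "a \<le> x \<and> x \<le> b \<and> b - a < min (z - x) (x - y)"
      show "\<exists>B. \<forall>r\<in>{a..b}. 0 \<le> r \<longrightarrow> p r \<le> B"
      proof (intro exI[of _ "max B (p x + 1)"] ballI impI)
        fix r assume r: "r \<in> {a..b}" "0 \<le> r"
        consider "r < x" | "r = x" | "r > x" by linarith
        then show "p r \<le> max B (p x + 1)"
        proof cases
          case 1
          then have "p r \<le> B" using r ab by (intro y(2)) auto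
          then show ?thesis by simp
        next
          case 3
          then have "p r < p x + 1" using r ab by (intro z(2)) auto
          then show ?thesis by simp
        qed simp
      qed
    qed
  qed
  then obtain B where B: "\<forall>r\<in>{0..C}. 0 \<le> r \<longrightarrow> p r \<le> B" ..
  show ?thesis
  proof (rule that)
    fix r assume "0 \<le> r" "r \<le> C"
    then show "p r \<le> B" using B by simp
  qed
qed

context cadlag_feller_process
begin

text \<open>By right-continuity a level that is exceeded at all is exceeded at a rational time, so
\<open>{first_passage X c < t}\<close> is a countable union of events known by time \<open>t\<close>.\<close>

lemma first_passage_less_iff:
  assumes \<omega>: "\<omega> \<in> space M"
  shows "first_passage X c \<omega> < ennreal t \<longleftrightarrow> (\<exists>q\<in>\<rat>. 0 \<le> q \<and> q < t \<and> c < X q \<omega>)"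
proof
  assume "first_passage X c \<omega> < ennreal t"
  then obtain r where r: "0 \<le> r" "c < X r \<omega>" "ennreal r < ennreal t"
    unfolding first_passage_def INF_less_iff by blast
  then have rt: "r < t" by (simp add: ennreal_less_iff)
  have "eventually (\<lambda>s. c < X s \<omega>) (at_right r)"
    using X_right_continuous[OF r(1) \<omega>] r(2) by (rule order_tendstoD)
  then obtain z where z: "z > r" "\<And>s. r < s \<Longrightarrow> s < z \<Longrightarrow> c < X s \<omega>"
    by (auto simp: eventually_at_right_field)
  obtain q where q: "q \<in> \<rat>" "r < q" "q < min z t"
    using Rats_dense_in_real[of r "min z t"] z(1) rt by auto
  then have "0 \<le> q \<and> q < t \<and> c < X q \<omega>" using r(1) z(2)[of q] by auto
  then show "\<exists>q\<in>\<rat>. 0 \<le> q \<and> q < t \<and> c < X q \<omega>" using q(1) by blast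
next
  assume "\<exists>q\<in>\<rat>. 0 \<le> q \<and> q < t \<and> c < X q \<omega>"
  then obtain q where "0 \<le> q" "q < t" "c < X q \<omega>" by blast
  then show "first_passage X c \<omega> < ennreal t"
    unfolding first_passage_def INF_less_iff by (intro bexI[of _ q]) (auto simp: ennreal_less_iff)
qed

lemma first_passage_less_sets:
  assumes t: "0 \<le> t"
  shows "{\<omega> \<in> space M. first_passage X c \<omega> < ennreal t} \<in> sets (F t)"
proof -
  have "{\<omega> \<in> space M. first_passage X c \<omega> < ennreal t}
      = (\<Union>q\<in>{q \<in> \<rat>. 0 \<le> q \<and> q < t}. {\<omega> \<in> space (F t). c < X q \<omega>})"
    using space_F[OF t] by (auto simp: first_passage_less_iff)
  also have "\<dots> \<in> sets (F t)"
  proof (rule sets.countable_UN'')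
    show "countable {q \<in> \<rat>. 0 \<le> q \<and> q < t}"
      by (rule countable_subset[OF _ countable_rat]) auto
    fix q assume q: "q \<in> {q \<in> \<rat>. 0 \<le> q \<and> q < t}"
    have "X q \<in> borel_measurable (F t)"
      by (rule measurable_F_mono[OF _ _ X_measurable_F]) (use q in auto)
    then show "{\<omega> \<in> space (F t). c < X q \<omega>} \<in> sets (F t)"
      by (rule borel_measurable_less[OF borel_measurable_const])
  qed
  finally show ?thesis .
qed

text \<open>The event \<open>{first_passage X c \<le> t}\<close> is known at every time after \<open>t\<close>, hence at \<open>t\<close> by right-continuity of
the filtration.\<close>

lemma first_passage_stopping_time:
  assumes usual: "usual_conditions M F"
  shows "stopping_time (extended_filtration M F) (first_passage X c)"
proof (rule stopping_timeI)
  fix t :: ennreal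
  show "Measurable.pred (extended_filtration M F t) (\<lambda>\<omega>. first_passage X c \<omega> \<le> t)"
  proof (cases t)
    case top
    then show ?thesis by simp
  next
    case (real r)
    have "{\<omega> \<in> space M. first_passage X c \<omega> \<le> ennreal r} \<in> sets (F s)" if s: "s > r" for s
    proof -
      let ?d = "\<lambda>k. r + (s - r) / real (Suc k)"
      have d: "?d k > r" "?d k \<le> s" "0 \<le> ?d k" for k
      proof -
        have "0 < (s - r) / real (Suc k)" using s by simp
        moreover have "(s - r) / real (Suc k) \<le> s - r"
          using s divide_left_mono[of 1 "real (Suc k)" "s - r"] by simp
        ultimately show "?d k > r" "?d k \<le> s" "0 \<le> ?d k" using real by auto
      qed
      have "first_passage X c \<omega> \<le> ennreal r \<longleftrightarrow> (\<forall>k. first_passage X c \<omega> < ennreal (?d k))" for \<omega>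
      proof
        assume le: "first_passage X c \<omega> \<le> ennreal r"
        show "\<forall>k. first_passage X c \<omega> < ennreal (?d k)"
        proof
          fix k
          have "ennreal r < ennreal (?d k)" using d(1)[of k] real by (simp add: ennreal_less_iff)
          with le show "first_passage X c \<omega> < ennreal (?d k)" by (rule order_le_less_trans)
        qed
      next
        assume less: "\<forall>k. first_passage X c \<omega> < ennreal (?d k)"
        have "?d \<longlonglongrightarrow> r + 0" by (intro tendsto_add tendsto_const mesh_tendsto_0)
        then have "(\<lambda>k. ennreal (?d k)) \<longlonglongrightarrow> ennreal r"
          by (intro tendsto_ennrealI) simp
        then show "first_passage X c \<omega> \<le> ennreal r"
          by (rule LIMSEQ_le_const) (use less in \<open>blast intro: less_imp_le\<close>)
      qed
      then have "{\<omega> \<in> space M. first_passage X c \<omega> \<le> ennreal r}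
          = (\<Inter>k. {\<omega> \<in> space M. first_passage X c \<omega> < ennreal (?d k)})"
        by (intro set_eqI) (simp only: mem_Collect_eq INT_iff, blast)
      also have "\<dots> \<in> sets (F s)"
      proof (rule sets.countable_INT)
        have "{\<omega> \<in> space M. first_passage X c \<omega> < ennreal (?d k)} \<in> sets (F s)" for k
          by (rule sets_F_mono[OF d(3) d(2) first_passage_less_sets[OF d(3)]])
        then show "(\<lambda>k. {\<omega> \<in> space M. first_passage X c \<omega> < ennreal (?d k)}) ` UNIV \<subseteq> sets (F s)"
          by (rule image_subsetI)
      qed (rule UNIV_not_empty)
      finally show ?thesis .
    qed
    then have "{\<omega> \<in> space M. first_passage X c \<omega> \<le> ennreal r} \<in> (\<Inter>s\<in>{r<..}. sets (F s))"
      by (intro INT_I) (simp only: greaterThan_iff)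
    moreover have "\<forall>t\<ge>0. sets (F t) = (\<Inter>s\<in>{t<..}. sets (F s))"
      using usual unfolding usual_conditions_def by (elim conjE)
    from this[rule_format, OF real(1)] have "sets (F r) = (\<Inter>s\<in>{r<..}. sets (F s))" .
    ultimately have "{\<omega> \<in> space M. first_passage X c \<omega> \<le> ennreal r} \<in> sets (F r)"
      by (rule back_subst[where P="\<lambda>S. _ \<in> S", OF _ sym])
    then show ?thesis
      using real space_F[of r] by (simp add: extended_filtration_def Measurable.pred_def)
  qed
qed

lemma first_passage_tendsto:
  assumes \<omega>: "\<omega> \<in> space M"
  shows "(\<lambda>n. first_passage X (real n) \<omega>) \<longlonglongrightarrow> \<infinity>"
proof -
  have ex: "\<exists>n. ennreal C < first_passage X (real n) \<omega>" if "C \<ge> 0" for C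
  proof -
    have "0 \<le> C + 1" using that by simp
    obtain B where B: "\<And>r. 0 \<le> r \<Longrightarrow> r \<le> C + 1 \<Longrightarrow> X r \<omega> \<le> B"
    proof (rule cadlag_bounded_above[OF _ _ \<open>0 \<le> C + 1\<close>])
      show "((\<lambda>r. X r \<omega>) \<longlongrightarrow> X t \<omega>) (at_right t)" if "0 \<le> t" for t
        using that \<omega> by (rule X_right_continuous)
      show "\<exists>l. ((\<lambda>r. X r \<omega>) \<longlongrightarrow> l) (at_left t)" if "0 < t" for t
        using cadlag \<omega> that by (simp add: cadlag_def)
    qed (rule that)
    from real_arch_simple[of B] obtain n where n: "B \<le> real n" ..
    have "ennreal (C + 1) \<le> first_passage X (real n) \<omega>"
      unfolding first_passage_def
    proof (rule INF_greatest)
      fix t assume "t \<in> {t. 0 \<le> t \<and> real n < X t \<omega>}"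
      then have t: "0 \<le> t" "real n < X t \<omega>" by simp_all
      have "C + 1 \<le> t"
      proof (rule ccontr)
        assume "\<not> C + 1 \<le> t"
        then have "X t \<omega> \<le> B" using t by (intro B) auto
        then show False using t n by simp
      qed
      then show "ennreal (C + 1) \<le> ennreal t" by (rule ennreal_leI)
    qed
    moreover have "ennreal C < ennreal (C + 1)" using that by (simp add: ennreal_less_iff)
    ultimately show ?thesis by (meson order_less_le_trans)
  qed
  have ev: "eventually (\<lambda>n. ennreal C < first_passage X (real n) \<omega>) sequentially" if "C \<ge> 0" for C
  proof -
    from ex[OF that] obtain n0 where n0: "ennreal C < first_passage X (real n0) \<omega>" ..
    show ?thesis
      unfolding eventually_sequentially
    proof (intro exI allI impI)
      fix n assume "n0 \<le> n"
      then have "first_passage X (real n0) \<omega> \<le> first_passage X (real n) \<omega>"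
        by (intro first_passage_mono) simp
      with n0 show "ennreal C < first_passage X (real n) \<omega>" by (rule order_less_le_trans)
    qed
  qed
  show ?thesis
    unfolding infinity_ennreal_def tendsto_top_iff_ennreal using ev by blast
qed

end

section \<open>The exponential of an affine process\<close>

text \<open>The factor \<open>y x exp (- y x)\<close> with \<open>y = 1 / 2 ^ (k + 4)\<close> is bounded below when \<open>1 \<le> y x \<le> 2\<close>, which some
\<open>k\<close> achieves if \<open>x \<ge> 16\<close>; for smaller \<open>x\<close> the choice \<open>k = 0\<close> and \<open>exp x - 1 \<le> x exp x\<close> suffice. The
exponent 4 matches the range in which the branching mechanism has been estimated.\<close>

lemma exp_minus_1_le_dyadic:
  fixes x :: real
  assumes x: "0 \<le> x"
  obtains k where "exp (-2) / 16 * (exp x - 1) \<le> 1 / 2 ^ (k + 4) * (x * exp ((1 - 1 / 2 ^ (k + 4)) * x))"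
proof (cases "x < 16")
  case True
  have "(1 + - x) * exp x \<le> exp (- x) * exp x"
    by (intro mult_right_mono exp_ge_add_one_self) simp
  also have "\<dots> = 1" by (simp add: mult_exp_exp)
  finally have "exp x - x * exp x \<le> 1" by (simp add: left_diff_distrib)
  then have "exp x - 1 \<le> x * exp x" by linarith
  then have "exp (-2) * (exp x - 1) \<le> exp (- (x / 16)) * (x * exp x)"
    using x True by (intro mult_mono) auto
  also have "\<dots> = x * exp (- (x / 16) + x)" by (simp only: mult_exp_exp[symmetric] mult.left_commute)
  also have "- (x / 16) + x = (1 - 1 / 2 ^ (0 + 4)) * x" by simp
  finally have "exp (-2) / 16 * (exp x - 1) \<le> 1 / 2 ^ (0 + 4) * (x * exp ((1 - 1 / 2 ^ (0 + 4)) * x))"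
    by simp
  then show ?thesis by (rule that)
next
  case False
  define L where "L = log 2 (x / 16)"
  define k where "k = nat \<lfloor>L\<rfloor>"
  have "L \<ge> 0" using False by (simp add: L_def)
  then have "real k = of_int \<lfloor>L\<rfloor>" by (simp add: k_def)
  then have k: "real k \<le> L" "L < real k + 1"
    using floor_correct[of L] by simp_all
  have pos: "x / 16 > 0" using False by simp
  have "2 powr real k \<le> 2 powr L" using k(1) by simp
  also have "\<dots> = x / 16" using pos by (simp add: L_def)
  finally have lo: "2 ^ (k + 4) \<le> x" by (simp add: powr_realpow power_add)
  have "x / 16 = 2 powr L" using pos by (simp add: L_def)
  also have "\<dots> < 2 powr (real k + 1)" using k(2) by simp
  finally have hi: "x < 2 * 2 ^ (k + 4)" by (simp add: powr_add powr_realpow power_add)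
  define y :: real where "y = 1 / 2 ^ (k + 4)"
  have y: "1 \<le> y * x" "y * x \<le> 2" "y > 0" using lo hi by (simp_all add: y_def pos_divide_le_eq)
  have "exp (-2) / 16 * (exp x - 1) \<le> exp (-2) * exp x"
    using x by (intro mult_mono) auto
  also have "\<dots> \<le> exp (- (y * x)) * exp x" using y by (intro mult_right_mono) auto
  also have "\<dots> = exp (- (y * x) + x)" by (rule mult_exp_exp)
  also have "- (y * x) + x = (1 - y) * x" by (simp add: left_diff_distrib)
  also have "exp ((1 - y) * x) \<le> (y * x) * exp ((1 - y) * x)" using y(1) by simp
  finally have "exp (-2) / 16 * (exp x - 1) \<le> y * (x * exp ((1 - y) * x))"
    by (simp only: mult.assoc)
  then show ?thesis unfolding y_def by (rule that)
qed

locale exponential_affine_process =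
  cadlag_feller_process M F "{0..}" P X + exponential_levy_measure \<mu>
  for M :: "'a measure" and F P X \<mu> +
  fixes b x0 :: real
  assumes gen: "\<And>f. f \<in> Cc_infinity_nonneg \<Longrightarrow> (f, affine_generator b \<mu> f) \<in> generator {0..} P"
    and usual: "usual_conditions M F"
    and start: "AE \<omega> in M. X 0 \<omega> = x0"
begin

abbreviation passage :: "real \<Rightarrow> 'a \<Rightarrow> ennreal" where
  "passage c \<equiv> first_passage X c"

text \<open>The factor next to \<open>R(u)\<close> when \<open>x R(u) exp (u x)\<close> is integrated along the path before the
passage time, on the event \<open>A\<close>.\<close>

definition occupation :: "real \<Rightarrow> real \<Rightarrow> 'a set \<Rightarrow> real \<Rightarrow> real \<Rightarrow> real" where
  "occupation u c A s t = (\<integral>z. indicator A (fst z) *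
     (if ennreal (snd z) < passage c (fst z) then X (snd z) (fst z) * exp (u * X (snd z) (fst z)) else 0)
     \<partial>time_product s t)"

lemma X_nonneg: "t \<ge> 0 \<Longrightarrow> \<omega> \<in> space M \<Longrightarrow> X t \<omega> \<ge> 0"
  using X_in by simp

lemma passage_stopping_time: "stopping_time (extended_filtration M F) (passage c)"
  by (rule first_passage_stopping_time[OF usual])

lemma passage_measurable: "passage c \<in> borel_measurable M"
  by (rule stopping_time_measurable[OF passage_stopping_time])

lemma damped_generator:
  "(damped_exp u m 1, affine_generator b \<mu> (damped_exp u m 1)) \<in> generator {0..} P"
  by (rule gen[OF damped_exp_in_Cc])

lemma damped_C0: "damped_exp u m 1 \<in> C0 {0..}" "affine_generator b \<mu> (damped_exp u m 1) \<in> C0 {0..}"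
  using damped_generator by (simp_all add: generator_def)

text \<open>Strictly before the passage time the process stays in \<open>[0, c]\<close>, although the jump over the level may
make its value at that time arbitrarily large.\<close>

lemma X_before_passage:
  assumes "0 \<le> s" "z \<in> space (time_product s t)" "ennreal (snd z) < passage c (fst z)"
  shows "0 \<le> X (snd z) (fst z)" "X (snd z) (fst z) \<le> c"
proof -
  have z: "fst z \<in> space M" "0 \<le> snd z"
    using assms(1,2) by (auto simp: space_time_product)
  show "0 \<le> X (snd z) (fst z)" using z by (intro X_nonneg)
  show "X (snd z) (fst z) \<le> c" by (rule less_first_passageD[OF z(2) assms(3)])
qed

text \<open>Before the passage time the process lives on a bounded interval, where the generator of the
approximations is bounded uniformly and converges.\<close>

lemma damped_integral_tendsto:
  assumes u: "0 \<le> u" "u \<le> 1" and st: "0 \<le> s" "s \<le> t" and A: "A \<in> sets M"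
  shows "(\<lambda>n. \<integral>z. indicator A (fst z) * (if ennreal (snd z) < passage c (fst z)
            then affine_generator b \<mu> (damped_exp u (real n) 1) (X (snd z) (fst z)) else 0) \<partial>time_product s t)
    \<longlonglongrightarrow> branching_mechanism b \<mu> u * occupation u c A s t"
proof -
  define R where "R = branching_mechanism b \<mu> u"
  obtain C where C: "C \<ge> 0"
    "\<And>m x. 0 \<le> x \<Longrightarrow> x \<le> c \<Longrightarrow> \<bar>affine_generator b \<mu> (damped_exp u m 1) x\<bar> \<le> C"
    by (rule affine_generator_damped_exp_bounded[OF u, of c b]) (rule that)
  interpret Q: finite_measure "time_product s t" by (rule finite_measure_time_product)
  have g_meas: "(\<lambda>x. x * exp (u * x) * R) \<in> borel_measurable (restrict_space borel {0..})"
    by (rule measurable_restrict_space1) measurable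
  have "(\<lambda>n. \<integral>z. indicator A (fst z) * (if ennreal (snd z) < passage c (fst z)
            then affine_generator b \<mu> (damped_exp u (real n) 1) (X (snd z) (fst z)) else 0) \<partial>time_product s t)
    \<longlonglongrightarrow> (\<integral>z. indicator A (fst z) * (if ennreal (snd z) < passage c (fst z)
            then X (snd z) (fst z) * exp (u * X (snd z) (fst z)) * R else 0) \<partial>time_product s t)"
  proof (rule integral_dominated_convergence)
    show "(\<lambda>z. indicator A (fst z) * (if ennreal (snd z) < passage c (fst z)
            then X (snd z) (fst z) * exp (u * X (snd z) (fst z)) * R else 0)) \<in> borel_measurable (time_product s t)"
      by (rule time_product_integrand_measurable[OF passage_measurable st A g_meas])
    show "(\<lambda>z. indicator A (fst z) * (if ennreal (snd z) < passage c (fst z)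
            then affine_generator b \<mu> (damped_exp u (real n) 1) (X (snd z) (fst z)) else 0))
          \<in> borel_measurable (time_product s t)" for n
      by (rule time_product_integrand_measurable[OF passage_measurable st A C0_measurable[OF damped_C0(2)]])
    show "integrable (time_product s t) (\<lambda>_. C)" by simp
    show "AE z in time_product s t. (\<lambda>n. indicator A (fst z) * (if ennreal (snd z) < passage c (fst z)
            then affine_generator b \<mu> (damped_exp u (real n) 1) (X (snd z) (fst z)) else 0))
        \<longlonglongrightarrow> indicator A (fst z) * (if ennreal (snd z) < passage c (fst z)
            then X (snd z) (fst z) * exp (u * X (snd z) (fst z)) * R else 0)"
    proof (rule AE_I2)
      fix z assume z: "z \<in> space (time_product s t)"
      show "(\<lambda>n. indicator A (fst z) * (if ennreal (snd z) < passage c (fst z)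
            then affine_generator b \<mu> (damped_exp u (real n) 1) (X (snd z) (fst z)) else 0))
        \<longlonglongrightarrow> indicator A (fst z) * (if ennreal (snd z) < passage c (fst z)
            then X (snd z) (fst z) * exp (u * X (snd z) (fst z)) * R else 0)"
      proof (cases "ennreal (snd z) < passage c (fst z)")
        case True
        have "(\<lambda>n. affine_generator b \<mu> (damped_exp u (real n) 1) (X (snd z) (fst z)))
            \<longlonglongrightarrow> X (snd z) (fst z) * exp (u * X (snd z) (fst z)) * R"
          unfolding R_def
          by (rule affine_generator_damped_exp_tendsto[OF u X_before_passage(1)[OF st(1) z True]])
        then show ?thesis
          unfolding if_P[OF True] by (rule tendsto_mult_left)
      next
        case False
        show ?thesis unfolding if_not_P[OF False] by (rule tendsto_const)
      qed
    qed
    show "AE z in time_product s t. norm (indicator A (fst z) * (if ennreal (snd z) < passage c (fst z)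
            then affine_generator b \<mu> (damped_exp u (real n) 1) (X (snd z) (fst z)) else 0)) \<le> C" for n
    proof (rule AE_I2)
      fix z assume z: "z \<in> space (time_product s t)"
      show "norm (indicator A (fst z) * (if ennreal (snd z) < passage c (fst z)
            then affine_generator b \<mu> (damped_exp u (real n) 1) (X (snd z) (fst z)) else 0)) \<le> C"
      proof (cases "ennreal (snd z) < passage c (fst z)")
        case True
        then show ?thesis
          using C(2)[OF X_before_passage[OF st(1) z True], of "real n"] C(1) by (simp add: indicator_def)
      next
        case False
        then show ?thesis using C(1) by simp
      qed
    qed
  qed
  also have "(\<integral>z. indicator A (fst z) * (if ennreal (snd z) < passage c (fst z)
            then X (snd z) (fst z) * exp (u * X (snd z) (fst z)) * R else 0) \<partial>time_product s t)
     = (\<integral>z. R * (indicator A (fst z) * (if ennreal (snd z) < passage c (fst z)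
            then X (snd z) (fst z) * exp (u * X (snd z) (fst z)) else 0)) \<partial>time_product s t)"
    by (rule Bochner_Integration.integral_cong[OF refl]) simp
  also have "\<dots> = R * occupation u c A s t"
    unfolding occupation_def by (rule integral_mult_right_zero)
  finally show ?thesis unfolding R_def .
qed

lemma damped_start_tendsto:
  "(\<lambda>n. \<integral>\<omega>. damped_exp u (real n) 1 (X 0 \<omega>) \<partial>M) \<longlonglongrightarrow> exp (u * x0)"
proof -
  have "(\<integral>\<omega>. damped_exp u m 1 (X 0 \<omega>) \<partial>M) = damped_exp u m 1 x0" for m
  proof -
    have "(\<integral>\<omega>. damped_exp u m 1 (X 0 \<omega>) \<partial>M) = (\<integral>\<omega>. damped_exp u m 1 x0 \<partial>M)"
      using start by (intro integral_cong_AE C0_X_measurable damped_C0 borel_measurable_const) auto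
    then show ?thesis by (simp add: prob_space)
  qed
  then show ?thesis using damped_exp_tendsto[of u 1 x0] by simp
qed

lemma integral_indicator_space: "(\<integral>\<omega>. indicator (space M) \<omega> * f \<omega> \<partial>M) = (\<integral>\<omega>. f \<omega> \<partial>M)"
  for f :: "'a \<Rightarrow> real"
  by (rule Bochner_Integration.integral_cong) simp_all

lemma stopped_exp_measurable:
  assumes "t \<ge> 0"
  shows "(\<lambda>\<omega>. exp (u * X (stop_at (passage c \<omega>) t) \<omega>)) \<in> borel_measurable (F t)"
  using stopped_measurable[OF passage_stopping_time assms, of c] by measurable

text \<open>The jump over the level is unbounded, so integrability is not evident. It comes out of monotone
convergence: the approximations increase to the exponential, and by Dynkin's formula their
expectations converge to a finite limit.\<close>

lemma stopped_exp:
  assumes u: "0 \<le> u" "u \<le> 1" and t: "0 \<le> t"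
  shows stopped_exp_integrable: "integrable M (\<lambda>\<omega>. exp (u * X (stop_at (passage c \<omega>) t) \<omega>))"
    and stopped_exp_expectation: "(\<integral>\<omega>. exp (u * X (stop_at (passage c \<omega>) t) \<omega>) \<partial>M)
      = exp (u * x0) + branching_mechanism b \<mu> u * occupation u c (space M) 0 t"
proof -
  let ?f = "\<lambda>n \<omega>. damped_exp u (real n) 1 (X (stop_at (passage c \<omega>) t) \<omega>)"
  have int: "integrable M (?f n)" for n
    by (rule C0_stopped_integrable[OF passage_stopping_time t damped_C0(1)])
  have mono: "AE \<omega> in M. mono (\<lambda>n. ?f n \<omega>)"
    by (intro AE_I2 monoI damped_exp_1_mono) simp
  have nonneg: "AE \<omega> in M. 0 \<le> ?f n \<omega>" for n
    by (intro AE_I2 damped_exp_1_nonneg)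
  have lim: "AE \<omega> in M. (\<lambda>n. ?f n \<omega>) \<longlonglongrightarrow> exp (u * X (stop_at (passage c \<omega>) t) \<omega>)"
    using damped_exp_tendsto[of u 1] by (intro AE_I2) simp
  have dynkin: "(\<integral>\<omega>. ?f n \<omega> \<partial>M) = (\<integral>\<omega>. damped_exp u (real n) 1 (X 0 \<omega>) \<partial>M)
    + (\<integral>z. indicator (space M) (fst z) * (if ennreal (snd z) < passage c (fst z)
            then affine_generator b \<mu> (damped_exp u (real n) 1) (X (snd z) (fst z)) else 0) \<partial>time_product 0 t)" for n
  proof -
    have top: "space M \<in> sets (F 0)" using space_F[of 0] sets.top[of "F 0"] by simp
    show ?thesis
      using stopped_dynkin_formula[OF damped_generator[of u "real n"] passage_stopping_time[of c] order_refl t top]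
      unfolding integral_indicator_space stop_at_0 by linarith
  qed
  have ilim: "(\<lambda>n. \<integral>\<omega>. ?f n \<omega> \<partial>M)
      \<longlonglongrightarrow> exp (u * x0) + branching_mechanism b \<mu> u * occupation u c (space M) 0 t"
    unfolding dynkin
    by (rule tendsto_add[OF damped_start_tendsto damped_integral_tendsto[OF u order_refl t sets.top]])
  have meas: "(\<lambda>\<omega>. exp (u * X (stop_at (passage c \<omega>) t) \<omega>)) \<in> borel_measurable M"
    by (rule measurable_from_subalg[OF subalg[OF t] stopped_exp_measurable[OF t]])
  show "integrable M (\<lambda>\<omega>. exp (u * X (stop_at (passage c \<omega>) t) \<omega>))"
    by (rule integral_monotone_convergence_nonneg(1)[OF int mono nonneg lim ilim meas])
  show "(\<integral>\<omega>. exp (u * X (stop_at (passage c \<omega>) t) \<omega>) \<partial>M)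
      = exp (u * x0) + branching_mechanism b \<mu> u * occupation u c (space M) 0 t"
    by (rule integral_monotone_convergence_nonneg(2)[OF int mono nonneg lim ilim meas])
qed

lemma stopped_exp_indicator_integrable:
  assumes u: "0 \<le> u" "u \<le> 1" and t: "0 \<le> t" and A: "A \<in> sets M"
  shows "integrable M (\<lambda>\<omega>. indicator A \<omega> * exp (u * X (stop_at (passage c \<omega>) t) \<omega>))"
  using integrable_mult_indicator[OF A stopped_exp_integrable[OF u t, of c]] by simp

lemma stopped_damped_tendsto:
  assumes u: "0 \<le> u" "u \<le> 1" and t: "0 \<le> t" and A: "A \<in> sets M"
  shows "(\<lambda>n. \<integral>\<omega>. indicator A \<omega> * damped_exp u (real n) 1 (X (stop_at (passage c \<omega>) t) \<omega>) \<partial>M)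
    \<longlonglongrightarrow> (\<integral>\<omega>. indicator A \<omega> * exp (u * X (stop_at (passage c \<omega>) t) \<omega>) \<partial>M)"
proof (rule integral_dominated_convergence)
  show "(\<lambda>\<omega>. indicator A \<omega> * exp (u * X (stop_at (passage c \<omega>) t) \<omega>)) \<in> borel_measurable M"
    by (rule borel_measurable_integrable[OF stopped_exp_indicator_integrable[OF u t A]])
  show "(\<lambda>\<omega>. indicator A \<omega> * damped_exp u (real n) 1 (X (stop_at (passage c \<omega>) t) \<omega>)) \<in> borel_measurable M" for n
    by (rule borel_measurable_integrable[OF
          C0_stopped_indicator_integrable[OF passage_stopping_time t damped_C0(1) A]])
  show "integrable M (\<lambda>\<omega>. exp (u * X (stop_at (passage c \<omega>) t) \<omega>))"
    by (rule stopped_exp_integrable[OF u t])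
  show "AE \<omega> in M. (\<lambda>n. indicator A \<omega> * damped_exp u (real n) 1 (X (stop_at (passage c \<omega>) t) \<omega>))
      \<longlonglongrightarrow> indicator A \<omega> * exp (u * X (stop_at (passage c \<omega>) t) \<omega>)"
  proof (rule AE_I2)
    fix \<omega>
    have "(\<lambda>n. damped_exp u (real n) 1 (X (stop_at (passage c \<omega>) t) \<omega>))
        \<longlonglongrightarrow> exp (u * X (stop_at (passage c \<omega>) t) \<omega>)"
      using damped_exp_tendsto[of u 1 "X (stop_at (passage c \<omega>) t) \<omega>"] by simp
    then show "(\<lambda>n. indicator A \<omega> * damped_exp u (real n) 1 (X (stop_at (passage c \<omega>) t) \<omega>))
      \<longlonglongrightarrow> indicator A \<omega> * exp (u * X (stop_at (passage c \<omega>) t) \<omega>)"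
      by (rule tendsto_mult_left)
  qed
  show "AE \<omega> in M. norm (indicator A \<omega> * damped_exp u (real n) 1 (X (stop_at (passage c \<omega>) t) \<omega>))
      \<le> exp (u * X (stop_at (passage c \<omega>) t) \<omega>)" for n
  proof (rule AE_I2)
    fix \<omega>
    show "norm (indicator A \<omega> * damped_exp u (real n) 1 (X (stop_at (passage c \<omega>) t) \<omega>))
      \<le> exp (u * X (stop_at (passage c \<omega>) t) \<omega>)"
      using damped_exp_1_nonneg[of u "real n" "X (stop_at (passage c \<omega>) t) \<omega>"]
        damped_exp_1_le[of u "real n" "X (stop_at (passage c \<omega>) t) \<omega>"]
      by (simp add: indicator_def)
  qed
qed

lemma stopped_exp_increment:
  assumes u: "0 \<le> u" "u \<le> 1" and st: "0 \<le> s" "s \<le> t" and A: "A \<in> sets (F s)"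
  shows "(\<integral>\<omega>. indicator A \<omega> * exp (u * X (stop_at (passage c \<omega>) t) \<omega>) \<partial>M)
      - (\<integral>\<omega>. indicator A \<omega> * exp (u * X (stop_at (passage c \<omega>) s) \<omega>) \<partial>M)
    = branching_mechanism b \<mu> u * occupation u c A s t"
proof -
  have AM: "A \<in> sets M" by (rule sets_F[OF st(1) A])
  have t: "0 \<le> t" using st by simp
  have "(\<lambda>n. (\<integral>\<omega>. indicator A \<omega> * damped_exp u (real n) 1 (X (stop_at (passage c \<omega>) t) \<omega>) \<partial>M)
      - (\<integral>\<omega>. indicator A \<omega> * damped_exp u (real n) 1 (X (stop_at (passage c \<omega>) s) \<omega>) \<partial>M))
    \<longlonglongrightarrow> (\<integral>\<omega>. indicator A \<omega> * exp (u * X (stop_at (passage c \<omega>) t) \<omega>) \<partial>M)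
      - (\<integral>\<omega>. indicator A \<omega> * exp (u * X (stop_at (passage c \<omega>) s) \<omega>) \<partial>M)"
    by (rule tendsto_diff[OF stopped_damped_tendsto[OF u t AM] stopped_damped_tendsto[OF u st(1) AM]])
  from LIMSEQ_unique[OF this[unfolded stopped_dynkin_formula[OF damped_generator passage_stopping_time st A]]
      damped_integral_tendsto[OF u st AM]]
  show ?thesis .
qed

text \<open>Here \<open>R(1) = 0\<close> turns Dynkin's formula into the equality of the integrals over events of \<open>F s\<close>.\<close>

lemma stopped_exp_martingale:
  assumes R: "branching_mechanism b \<mu> 1 = 0"
  shows "is_martingale M F
    (\<lambda>t \<omega>. stopped (passage c) (\<lambda>t \<omega>. exp (X t \<omega>) - 1) t \<omega> - (exp (X 0 \<omega>) - 1))"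
proof -
  define Z where "Z = (\<lambda>t \<omega>. exp (1 * X (stop_at (passage c \<omega>) t) \<omega>) - exp (1 * X 0 \<omega>))"
  have Z_eq: "(\<lambda>t \<omega>. stopped (passage c) (\<lambda>t \<omega>. exp (X t \<omega>) - 1) t \<omega> - (exp (X 0 \<omega>) - 1)) = Z"
    by (simp add: Z_def stopped_eq_stop_at fun_eq_iff)
  have Z_meas: "Z t \<in> borel_measurable (F t)" if t: "t \<ge> 0" for t
    unfolding Z_def
  proof (rule borel_measurable_diff[OF stopped_exp_measurable[OF t]])
    have [measurable]: "X 0 \<in> borel_measurable (F t)"
      by (rule measurable_F_mono[OF order_refl t X_measurable_F[OF order_refl]])
    show "(\<lambda>\<omega>. exp (1 * X 0 \<omega>)) \<in> borel_measurable (F t)" by measurable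
  qed
  have int0: "integrable M (\<lambda>\<omega>. exp (1 * X 0 \<omega>))"
    using stopped_exp_integrable[of 1 0 c] by (simp add: stop_at_0)
  have Z_int: "integrable M (Z t)" if t: "t \<ge> 0" for t
    unfolding Z_def by (rule Bochner_Integration.integrable_diff[OF stopped_exp_integrable[OF _ _ t] int0]) simp_all
  have Z_set: "(\<integral>\<omega>\<in>A. Z t \<omega> \<partial>M) = (\<integral>\<omega>\<in>A. Z s \<omega> \<partial>M)"
    if st: "0 \<le> s" "s \<le> t" and A: "A \<in> sets (F s)" for A s t
  proof -
    have t: "0 \<le> t" using st by simp
    have AM: "A \<in> sets M" by (rule sets_F[OF st(1) A])
    have int0A: "integrable M (\<lambda>\<omega>. indicator A \<omega> * exp (1 * X 0 \<omega>))"
      using integrable_mult_indicator[OF AM int0] by simp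
    have split: "(\<integral>\<omega>\<in>A. Z r \<omega> \<partial>M) = (\<integral>\<omega>. indicator A \<omega> * exp (1 * X (stop_at (passage c \<omega>) r) \<omega>) \<partial>M)
        - (\<integral>\<omega>. indicator A \<omega> * exp (1 * X 0 \<omega>) \<partial>M)" if r: "r \<ge> 0" for r
      unfolding set_lebesgue_integral_def Z_def real_scaleR_def right_diff_distrib
      by (rule Bochner_Integration.integral_diff[OF stopped_exp_indicator_integrable[OF _ _ r AM] int0A]) simp_all
    have "(\<integral>\<omega>. indicator A \<omega> * exp (1 * X (stop_at (passage c \<omega>) t) \<omega>) \<partial>M)
        - (\<integral>\<omega>. indicator A \<omega> * exp (1 * X (stop_at (passage c \<omega>) s) \<omega>) \<partial>M) = 0"
      using stopped_exp_increment[of 1, OF _ _ st A, of c] unfolding R by simp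
    then show ?thesis unfolding split[OF t] split[OF st(1)] by linarith
  qed
  show ?thesis
    unfolding Z_eq is_martingale_def
  proof (intro conjI allI impI)
    show "adapted F borel Z" using Z_meas by (simp add: adapted_def)
    show "integrable M (Z t)" if "0 \<le> t" for t using that by (rule Z_int)
    fix s t :: real assume st: "0 \<le> s" "s \<le> t"
    then have t: "0 \<le> t" by simp
    interpret S: sigma_finite_subalgebra M "F s" by (rule sigma_finite_subalgebra[OF st(1)])
    show "AE \<omega> in M. real_cond_exp M (F s) (Z t) \<omega> = Z s \<omega>"
      by (rule S.real_cond_exp_charact[OF Z_set[OF st] Z_int[OF t] Z_int[OF st(1)] Z_meas[OF st(1)]])
  qed
qed

lemma exp_local_martingale:
  assumes R: "branching_mechanism b \<mu> 1 = 0"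
  shows "is_local_martingale M F (\<lambda>t \<omega>. exp (X t \<omega>) - 1)"
  unfolding is_local_martingale_def
proof (intro conjI exI[of _ "\<lambda>n. passage (real n)"] allI)
  show "adapted F borel (\<lambda>t \<omega>. exp (X t \<omega>) - 1)"
    unfolding adapted_def
  proof (intro allI impI)
    fix t :: real assume "0 \<le> t"
    then have [measurable]: "X t \<in> borel_measurable (F t)" by (rule X_measurable_F)
    show "(\<lambda>\<omega>. exp (X t \<omega>) - 1) \<in> borel_measurable (F t)" by measurable
  qed
  show "cadlag M (\<lambda>t \<omega>. exp (X t \<omega>) - 1)"
    unfolding cadlag_def
  proof (intro ballI conjI allI impI)
    fix \<omega> t assume \<omega>: "\<omega> \<in> space M"
    show "((\<lambda>s. exp (X s \<omega>) - 1) \<longlongrightarrow> exp (X t \<omega>) - 1) (at_right t)" if "0 \<le> t"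
      by (rule tendsto_diff[OF tendsto_exp[OF X_right_continuous[OF that \<omega>]] tendsto_const])
    assume "0 < t"
    then have "\<exists>l. ((\<lambda>s. X s \<omega>) \<longlongrightarrow> l) (at_left t)"
      using cadlag \<omega> by (simp add: cadlag_def)
    then obtain l where l: "((\<lambda>s. X s \<omega>) \<longlongrightarrow> l) (at_left t)" ..
    show "\<exists>l. ((\<lambda>s. exp (X s \<omega>) - 1) \<longlongrightarrow> l) (at_left t)"
      by (rule exI, rule tendsto_diff[OF tendsto_exp[OF l] tendsto_const])
  qed
  show "stopping_time (extended_filtration M F) (passage (real n))" for n
    by (rule passage_stopping_time)
  show "AE \<omega> in M. incseq (\<lambda>n. passage (real n) \<omega>) \<and> (\<lambda>n. passage (real n) \<omega>) \<longlonglongrightarrow> \<infinity>"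
  proof (rule AE_I2, rule conjI)
    fix \<omega> assume "\<omega> \<in> space M"
    then show "(\<lambda>n. passage (real n) \<omega>) \<longlonglongrightarrow> \<infinity>" by (rule first_passage_tendsto)
    show "incseq (\<lambda>n. passage (real n) \<omega>)"
      by (rule incseq_SucI, rule first_passage_mono) simp
  qed
  show "is_martingale M F (\<lambda>t \<omega>. stopped (passage (real n)) (\<lambda>t \<omega>. exp (X t \<omega>) - 1) t \<omega> - (exp (X 0 \<omega>) - 1))" for n
    by (rule stopped_exp_martingale[OF R])
qed

text \<open>Up to a passage time this is Dynkin's formula with the nonnegative stopped expectation dropped:
\<open>- R(u)\<close> times the integral is at most \<open>exp (u x0)\<close>. The bound does not depend on the level, and
monotone convergence lets the level tend to infinity.\<close>

lemma nn_integral_exp_bound: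
  assumes u: "0 \<le> u" "u \<le> 1" and t: "0 \<le> t" and R: "branching_mechanism b \<mu> u < 0"
  shows "(\<integral>\<^sup>+z. ennreal (X (snd z) (fst z) * exp (u * X (snd z) (fst z))) \<partial>time_product 0 t)
    \<le> ennreal (exp (u * x0) / - branching_mechanism b \<mu> u)"
proof -
  define h where "h = (\<lambda>n z. if ennreal (snd z) < passage (real n) (fst z)
      then X (snd z) (fst z) * exp (u * X (snd z) (fst z)) else 0)"
  interpret Q: finite_measure "time_product 0 t" by (rule finite_measure_time_product)
  have h_nonneg: "0 \<le> h n z" if z: "z \<in> space (time_product 0 t)" for n z
    unfolding h_def using X_before_passage(1)[OF order_refl z, of "real n"] by simp
  have h_int: "integrable (time_product 0 t) (\<lambda>z. indicator (space M) (fst z) * h n z)" for n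
  proof (rule Q.integrable_const_bound)
    show "(\<lambda>z. indicator (space M) (fst z) * h n z) \<in> borel_measurable (time_product 0 t)"
      unfolding h_def
      by (rule time_product_integrand_measurable[OF passage_measurable order_refl t sets.top])
         (rule measurable_restrict_space1, measurable)
    show "AE z in time_product 0 t. norm (indicator (space M) (fst z) * h n z) \<le> real n * exp (real n)"
    proof (rule AE_I2)
      fix z assume z: "z \<in> space (time_product 0 t)"
      show "norm (indicator (space M) (fst z) * h n z) \<le> real n * exp (real n)"
      proof (cases "ennreal (snd z) < passage (real n) (fst z)")
        case True
        note X = X_before_passage[OF order_refl z True]
        have "u * X (snd z) (fst z) \<le> 1 * real n" using u X by (intro mult_mono) auto
        then have "X (snd z) (fst z) * exp (u * X (snd z) (fst z)) \<le> real n * exp (real n)"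
          using X by (intro mult_mono) auto
        then show ?thesis using True X by (simp add: h_def indicator_def)
      next
        case False
        then show ?thesis by (simp add: h_def)
      qed
    qed
  qed
  have h_le: "(\<integral>\<^sup>+z. ennreal (h n z) \<partial>time_product 0 t) \<le> ennreal (exp (u * x0) / - branching_mechanism b \<mu> u)" for n
  proof -
    have "(\<integral>\<^sup>+z. ennreal (h n z) \<partial>time_product 0 t)
        = (\<integral>\<^sup>+z. ennreal (indicator (space M) (fst z) * h n z) \<partial>time_product 0 t)"
      by (rule nn_integral_cong) (auto simp: space_time_product)
    also have "\<dots> = ennreal (\<integral>z. indicator (space M) (fst z) * h n z \<partial>time_product 0 t)"
      by (rule nn_integral_eq_integral[OF h_int]) (rule AE_I2, simp add: h_nonneg)
    also have "(\<integral>z. indicator (space M) (fst z) * h n z \<partial>time_product 0 t)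
        = occupation u (real n) (space M) 0 t"
      by (simp only: occupation_def h_def)
    also have "occupation u (real n) (space M) 0 t \<le> exp (u * x0) / - branching_mechanism b \<mu> u"
    proof -
      have "0 \<le> (\<integral>\<omega>. exp (u * X (stop_at (passage (real n) \<omega>) t) \<omega>) \<partial>M)"
        by (rule Bochner_Integration.integral_nonneg) simp
      then have "0 \<le> exp (u * x0) + branching_mechanism b \<mu> u * occupation u (real n) (space M) 0 t"
        by (simp only: stopped_exp_expectation[OF u t])
      then have "occupation u (real n) (space M) 0 t * - branching_mechanism b \<mu> u \<le> exp (u * x0)"
        by (simp add: mult.commute)
      moreover have "0 < - branching_mechanism b \<mu> u" using R by simp
      ultimately show ?thesis by (simp only: pos_le_divide_eq)
    qed
    finally show ?thesis by (simp add: ennreal_leI)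
  qed
  have "(\<integral>\<^sup>+z. ennreal (X (snd z) (fst z) * exp (u * X (snd z) (fst z))) \<partial>time_product 0 t)
    \<le> (\<integral>\<^sup>+z. (SUP n. ennreal (indicator (space M) (fst z) * h n z)) \<partial>time_product 0 t)"
  proof (rule nn_integral_mono)
    fix z assume z: "z \<in> space (time_product 0 t)"
    then have \<omega>: "fst z \<in> space M" by (auto simp: space_time_product)
    have "eventually (\<lambda>n. ennreal (snd z) < passage (real n) (fst z)) sequentially"
      using first_passage_tendsto[OF \<omega>] by (rule order_tendstoD) simp
    then obtain n where "ennreal (snd z) < passage (real n) (fst z)"
      by (auto simp: eventually_sequentially)
    then have "h n z = X (snd z) (fst z) * exp (u * X (snd z) (fst z))"
      by (simp add: h_def)
    then have "ennreal (X (snd z) (fst z) * exp (u * X (snd z) (fst z)))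
        \<le> ennreal (indicator (space M) (fst z) * h n z)" using \<omega> by simp
    then show "ennreal (X (snd z) (fst z) * exp (u * X (snd z) (fst z)))
        \<le> (SUP n. ennreal (indicator (space M) (fst z) * h n z))"
      by (rule SUP_upper2[OF UNIV_I])
  qed
  also have "\<dots> = (SUP n. \<integral>\<^sup>+z. ennreal (indicator (space M) (fst z) * h n z) \<partial>time_product 0 t)"
  proof (rule nn_integral_monotone_convergence_SUP_AE)
    show "(\<lambda>z. ennreal (indicator (space M) (fst z) * h n z)) \<in> borel_measurable (time_product 0 t)" for n
      by (rule measurable_compose[OF borel_measurable_integrable[OF h_int] measurable_ennreal])
    show "AE z in time_product 0 t. ennreal (indicator (space M) (fst z) * h n z)
        \<le> ennreal (indicator (space M) (fst z) * h (Suc n) z)" for n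
    proof (rule AE_I2)
      fix z assume z: "z \<in> space (time_product 0 t)"
      have "h n z \<le> h (Suc n) z"
      proof (cases "ennreal (snd z) < passage (real n) (fst z)")
        case True
        have "passage (real n) (fst z) \<le> passage (real (Suc n)) (fst z)"
          by (rule first_passage_mono) simp
        with True have "ennreal (snd z) < passage (real (Suc n)) (fst z)" by (rule order_less_le_trans)
        with True show ?thesis by (simp add: h_def)
      next
        case False
        then have "h n z = 0" by (simp add: h_def)
        with h_nonneg[OF z, of "Suc n"] show ?thesis by simp
      qed
      then show "ennreal (indicator (space M) (fst z) * h n z)
        \<le> ennreal (indicator (space M) (fst z) * h (Suc n) z)"
        by (intro ennreal_leI mult_left_mono) simp_all
    qed
  qed
  also have "\<dots> \<le> ennreal (exp (u * x0) / - branching_mechanism b \<mu> u)"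
  proof (rule SUP_least)
    fix n
    have "(\<integral>\<^sup>+z. ennreal (indicator (space M) (fst z) * h n z) \<partial>time_product 0 t)
        = (\<integral>\<^sup>+z. ennreal (h n z) \<partial>time_product 0 t)"
      by (rule nn_integral_cong) (auto simp: space_time_product)
    with h_le[of n] show "(\<integral>\<^sup>+z. ennreal (indicator (space M) (fst z) * h n z) \<partial>time_product 0 t)
        \<le> ennreal (exp (u * x0) / - branching_mechanism b \<mu> u)" by simp
  qed
  finally show ?thesis .
qed

text \<open>Multiply the bounds for \<open>u = 1 - 1 / 2 ^ (k + 4)\<close> by \<open>1 / 2 ^ (k + 4)\<close> and add them. The right-hand sides
are summable, and on the left one of the terms already dominates a multiple of \<open>exp X - 1\<close>. The
constant is the same for all \<open>t\<close>.\<close>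

lemma nn_integral_exp_minus_1_bounded:
  assumes neg: "\<And>k. k \<ge> 4 \<Longrightarrow> branching_mechanism b \<mu> (1 - 1 / 2 ^ k) < 0"
    and sum: "summable (\<lambda>k. 1 / 2 ^ k / (- branching_mechanism b \<mu> (1 - 1 / 2 ^ k)))"
  obtains K where "\<And>t. 0 \<le> t \<Longrightarrow>
    (\<integral>\<^sup>+z. ennreal (exp (X (snd z) (fst z)) - 1) \<partial>time_product 0 t) \<le> ennreal K"
proof -
  define y :: "nat \<Rightarrow> real" where "y = (\<lambda>k. 1 / 2 ^ (k + 4))"
  define R where "R = (\<lambda>k. - branching_mechanism b \<mu> (1 - y k))"
  have y: "0 < y k" "y k \<le> 1" for k by (simp_all add: y_def field_simps)
  have R: "R k > 0" for k using neg[of "k + 4"] by (simp add: R_def y_def)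
  define a where "a = (\<lambda>k. exp \<bar>x0\<bar> * (y k / R k))"
  have "summable (\<lambda>k. y k / R k)"
    using summable_ignore_initial_segment[OF sum, of 4] by (simp only: y_def R_def)
  then have a_sum: "summable a" unfolding a_def by (rule summable_mult)
  have a_nonneg: "a k \<ge> 0" for k
    using y(1)[of k] R[of k] by (simp add: a_def)
  define \<kappa> :: real where "\<kappa> = exp (-2) / 16"
  have \<kappa>: "\<kappa> > 0" by (simp add: \<kappa>_def)
  show ?thesis
  proof (rule that[of "(\<Sum>k. a k) / \<kappa>"])
    fix t :: real assume t: "0 \<le> t"
    have meas_X: "(\<lambda>z. X (snd z) (fst z)) \<in> borel_measurable (time_product 0 t)"
      by (rule time_product_X_measurable[OF order_refl t])
    note [measurable] = meas_X
    have le: "(\<integral>\<^sup>+z. ennreal (y k) * ennreal (X (snd z) (fst z) * exp ((1 - y k) * X (snd z) (fst z)))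
        \<partial>time_product 0 t) \<le> ennreal (a k)" for k
    proof -
      have "(\<integral>\<^sup>+z. ennreal (y k) * ennreal (X (snd z) (fst z) * exp ((1 - y k) * X (snd z) (fst z)))
          \<partial>time_product 0 t)
        = ennreal (y k) * (\<integral>\<^sup>+z. ennreal (X (snd z) (fst z) * exp ((1 - y k) * X (snd z) (fst z)))
          \<partial>time_product 0 t)"
        by (rule nn_integral_cmult) measurable
      also have "\<dots> \<le> ennreal (y k) * ennreal (exp ((1 - y k) * x0) / R k)"
        unfolding R_def
        using y[of k] R[of k] by (intro mult_left_mono nn_integral_exp_bound t) (auto simp: R_def)
      also have "\<dots> = ennreal (y k * (exp ((1 - y k) * x0) / R k))"
        using y[of k] R[of k] by (intro ennreal_mult[symmetric]) auto
      also have "\<dots> \<le> ennreal (a k)"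
      proof (rule ennreal_leI)
        have "(1 - y k) * x0 \<le> (1 - y k) * \<bar>x0\<bar>" using y[of k] by (intro mult_left_mono) auto
        also have "\<dots> \<le> \<bar>x0\<bar>" using y[of k] by (intro mult_left_le_one_le) auto
        finally have "exp ((1 - y k) * x0) / R k \<le> exp \<bar>x0\<bar> / R k"
          using R[of k] by (intro divide_right_mono) auto
        then have "y k * (exp ((1 - y k) * x0) / R k) \<le> y k * (exp \<bar>x0\<bar> / R k)"
          using y[of k] by (intro mult_left_mono) auto
        also have "\<dots> = a k" by (simp add: a_def)
        finally show "y k * (exp ((1 - y k) * x0) / R k) \<le> a k" .
      qed
      finally show ?thesis .
    qed
    have "ennreal \<kappa> * (\<integral>\<^sup>+z. ennreal (exp (X (snd z) (fst z)) - 1) \<partial>time_product 0 t)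
        = (\<integral>\<^sup>+z. ennreal \<kappa> * ennreal (exp (X (snd z) (fst z)) - 1) \<partial>time_product 0 t)"
      by (rule nn_integral_cmult[symmetric]) measurable
    also have "\<dots> \<le> (\<integral>\<^sup>+z. (\<Sum>k. ennreal (y k) * ennreal (X (snd z) (fst z) * exp ((1 - y k) * X (snd z) (fst z))))
        \<partial>time_product 0 t)"
    proof (rule nn_integral_mono)
      fix z assume "z \<in> space (time_product 0 t)"
      then have X: "0 \<le> X (snd z) (fst z)" by (intro X_nonneg) (auto simp: space_time_product)
      let ?x = "X (snd z) (fst z)"
      obtain k where "exp (-2) / 16 * (exp ?x - 1) \<le> 1 / 2 ^ (k + 4) * (?x * exp ((1 - 1 / 2 ^ (k + 4)) * ?x))"
        by (rule exp_minus_1_le_dyadic[OF X]) (rule that)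
      then have k: "\<kappa> * (exp ?x - 1) \<le> y k * (?x * exp ((1 - y k) * ?x))"
        by (simp only: \<kappa>_def y_def)
      have "ennreal \<kappa> * ennreal (exp ?x - 1) = ennreal (\<kappa> * (exp ?x - 1))"
        using \<kappa> X by (intro ennreal_mult[symmetric]) auto
      also have "\<dots> \<le> ennreal (y k * (?x * exp ((1 - y k) * ?x)))" using k by (rule ennreal_leI)
      also have "\<dots> = ennreal (y k) * ennreal (?x * exp ((1 - y k) * ?x))"
        using X y[of k] by (intro ennreal_mult) auto
      also have "\<dots> \<le> (\<Sum>k. ennreal (y k) * ennreal (?x * exp ((1 - y k) * ?x)))"
        using sum_le_suminf[of "\<lambda>k. ennreal (y k) * ennreal (?x * exp ((1 - y k) * ?x))" "{k}"]
        by (simp add: summableI)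
      finally show "ennreal \<kappa> * ennreal (exp ?x - 1)
        \<le> (\<Sum>k. ennreal (y k) * ennreal (?x * exp ((1 - y k) * ?x)))" .
    qed
    also have "\<dots> = (\<Sum>k. \<integral>\<^sup>+z. ennreal (y k) * ennreal (X (snd z) (fst z) * exp ((1 - y k) * X (snd z) (fst z)))
        \<partial>time_product 0 t)"
      by (rule nn_integral_suminf) measurable
    also have "\<dots> \<le> (\<Sum>k. ennreal (a k))"
      by (rule suminf_le[OF le]) (rule summableI)+
    also have "\<dots> = ennreal (\<Sum>k. a k)"
      by (rule suminf_ennreal2[OF a_nonneg a_sum])
    finally have "ennreal (1 / \<kappa>) * (ennreal \<kappa> * (\<integral>\<^sup>+z. ennreal (exp (X (snd z) (fst z)) - 1) \<partial>time_product 0 t))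
        \<le> ennreal (1 / \<kappa>) * ennreal (\<Sum>k. a k)"
      by (rule mult_left_mono) simp
    also have "ennreal (1 / \<kappa>) * ennreal (\<Sum>k. a k) = ennreal ((\<Sum>k. a k) / \<kappa>)"
      using \<kappa> suminf_nonneg[OF a_sum a_nonneg] by (subst ennreal_mult[symmetric]) auto
    also have "ennreal (1 / \<kappa>) * (ennreal \<kappa> * (\<integral>\<^sup>+z. ennreal (exp (X (snd z) (fst z)) - 1) \<partial>time_product 0 t))
        = (ennreal (1 / \<kappa>) * ennreal \<kappa>) * (\<integral>\<^sup>+z. ennreal (exp (X (snd z) (fst z)) - 1) \<partial>time_product 0 t)"
      by (rule mult.assoc[symmetric])
    also have "ennreal (1 / \<kappa>) * ennreal \<kappa> = 1"
      using \<kappa> by (subst ennreal_mult[symmetric]) auto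
    finally show "(\<integral>\<^sup>+z. ennreal (exp (X (snd z) (fst z)) - 1) \<partial>time_product 0 t) \<le> ennreal ((\<Sum>k. a k) / \<kappa>)"
      by (simp only: mult_1_left)
  qed
qed

lemma martingale_expectation:
  assumes mart: "is_martingale M F Y" and t: "0 \<le> t"
  shows "(\<integral>\<omega>. Y t \<omega> \<partial>M) = (\<integral>\<omega>. Y 0 \<omega> \<partial>M)"
proof -
  interpret S: sigma_finite_subalgebra M "F 0" by (rule sigma_finite_subalgebra[OF order_refl])
  have int: "integrable M (Y t)" "integrable M (Y 0)"
    and ae: "AE \<omega> in M. real_cond_exp M (F 0) (Y t) \<omega> = Y 0 \<omega>"
    using mart t by (simp_all add: is_martingale_def)
  have "(\<integral>\<omega>. Y t \<omega> \<partial>M) = (\<integral>\<omega>. real_cond_exp M (F 0) (Y t) \<omega> \<partial>M)"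
    by (rule S.real_cond_exp_int(2)[OF int(1), symmetric])
  also have "\<dots> = (\<integral>\<omega>. Y 0 \<omega> \<partial>M)"
    by (rule integral_cong_AE[OF borel_measurable_integrable[OF S.real_cond_exp_int(1)[OF int(1)]]
          borel_measurable_integrable[OF int(2)] ae])
  finally show ?thesis .
qed

text \<open>A martingale has constant expectation, here \<open>exp x0 - 1 > 0\<close>, so its integral over \<open>[0, t]\<close> grows
linearly in \<open>t\<close> and violates the uniform bound.\<close>

lemma exp_not_martingale:
  assumes x0: "x0 > 0"
    and neg: "\<And>k. k \<ge> 4 \<Longrightarrow> branching_mechanism b \<mu> (1 - 1 / 2 ^ k) < 0"
    and sum: "summable (\<lambda>k. 1 / 2 ^ k / (- branching_mechanism b \<mu> (1 - 1 / 2 ^ k)))"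
  shows "\<not> is_martingale M F (\<lambda>t \<omega>. exp (X t \<omega>) - 1)"
proof
  assume mart: "is_martingale M F (\<lambda>t \<omega>. exp (X t \<omega>) - 1)"
  have int: "integrable M (\<lambda>\<omega>. exp (X t \<omega>) - 1)" if "0 \<le> t" for t
    using mart that by (simp add: is_martingale_def)
  have "(\<integral>\<omega>. exp (X 0 \<omega>) - 1 \<partial>M) = (\<integral>\<omega>. exp x0 - 1 \<partial>M)"
    by (rule integral_cong_AE[OF borel_measurable_integrable[OF int[OF order_refl]] borel_measurable_const])
       (use start in eventually_elim, simp)
  then have E: "(\<integral>\<omega>. exp (X t \<omega>) - 1 \<partial>M) = exp x0 - 1" if "0 \<le> t" for t
    using martingale_expectation[OF mart that] by (simp add: prob_space)
  have nnE: "(\<integral>\<^sup>+\<omega>. ennreal (exp (X t \<omega>) - 1) \<partial>M) = ennreal (exp x0 - 1)" if t: "0 \<le> t" for t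
    unfolding E[OF t, symmetric]
    by (rule nn_integral_eq_integral[OF int[OF t]]) (rule AE_I2, simp add: X_nonneg[OF t])
  obtain K where K: "\<And>t. 0 \<le> t \<Longrightarrow>
    (\<integral>\<^sup>+z. ennreal (exp (X (snd z) (fst z)) - 1) \<partial>time_product 0 t) \<le> ennreal K"
    by (rule nn_integral_exp_minus_1_bounded[OF neg sum]) (assumption, rule that)
  have bound: "t * (exp x0 - 1) \<le> max K 0" if t: "0 \<le> t" for t
  proof -
    interpret I: finite_measure "restrict_space lborel {0..<t}" by (rule finite_measure_interval)
    interpret Q: pair_sigma_finite M "restrict_space lborel {0..<t}" by unfold_locales
    have meas_X: "(\<lambda>z. X (snd z) (fst z)) \<in> borel_measurable (time_product 0 t)"
      by (rule time_product_X_measurable[OF order_refl t])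
    have "(\<integral>\<^sup>+z. ennreal (exp (X (snd z) (fst z)) - 1) \<partial>time_product 0 t)
        = (\<integral>\<^sup>+r. (\<integral>\<^sup>+\<omega>. ennreal (exp (X (snd (\<omega>, r)) (fst (\<omega>, r))) - 1) \<partial>M) \<partial>restrict_space lborel {0..<t})"
      by (rule Q.nn_integral_snd[symmetric]) (use meas_X in measurable)
    also have "\<dots> = (\<integral>\<^sup>+r. ennreal (exp x0 - 1) \<partial>restrict_space lborel {0..<t})"
      by (rule nn_integral_cong) (simp add: space_restrict_space nnE)
    also have "\<dots> = ennreal (exp x0 - 1) * ennreal t"
      using t by (simp add: space_restrict_space emeasure_restrict_space)
    also have "\<dots> = ennreal ((exp x0 - 1) * t)"
      using t x0 by (intro ennreal_mult[symmetric]) auto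
    finally have "ennreal ((exp x0 - 1) * t) \<le> ennreal K"
      using K[OF t] by simp
    also have "\<dots> \<le> ennreal (max K 0)" by (rule ennreal_leI) simp
    finally show ?thesis by (subst (asm) ennreal_le_iff) (simp_all add: mult.commute)
  qed
  have pos: "exp x0 - 1 > 0" using x0 by simp
  have "(max K 0 + 1) / (exp x0 - 1) * (exp x0 - 1) \<le> max K 0"
    using pos by (intro bound divide_nonneg_pos) auto
  then show False using pos by simp
qed

end

theorem theorem3:
  fixes M :: "'a measure" and F :: "real \<Rightarrow> 'a measure"
    and X :: "real \<Rightarrow> 'a \<Rightarrow> real" and P :: "real \<Rightarrow> real \<Rightarrow> real measure"
    and \<mu> :: "real measure" and l :: "real \<Rightarrow> real" and c \<alpha> b x0 :: real
  assumes filt: "filtered_prob_space M F" and usual: "usual_conditions M F"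
    and c: "c > 0" and \<alpha>: "1 < \<alpha>" "\<alpha> < 2"
    and l: "slowly_varying l" "bounded_at_zero l"
    and \<mu>: "\<mu> = density (restrict_space lborel {0..})
                   (\<lambda>\<xi>. ennreal (c * exp (- \<xi>) * \<xi> powr (- \<alpha>) * l \<xi>))"
    and levy: "levy_measure_nonneg \<mu>"
    and exp_moment: "(\<integral>\<^sup>+\<xi>\<in>{1..}. ennreal (exp \<xi>) \<partial>\<mu>) < \<infinity>"
    and b: "b = (\<integral>\<xi>. exp \<xi> - 1 - \<xi> \<partial>\<mu>)"
    and feller: "feller_process M F {0..} P X"
    and cadlag: "cadlag M X"
    and start: "x0 > 0" "AE \<omega> in M. X 0 \<omega> = x0"
    and gen: "\<forall>f\<in>Cc_infinity_nonneg. (f, affine_generator b \<mu> f) \<in> generator {0..} P"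
    and core: "is_core {0..} P Cc_infinity_nonneg"
  shows "strict_local_martingale M F (\<lambda>t \<omega>. exp (X t \<omega>) - 1)"
proof -
  interpret L: tempered_levy_measure \<mu> c \<alpha> l
    by unfold_locales (fact levy exp_moment c \<alpha> l(1) \<mu>)+
  interpret A: exponential_affine_process M F P X \<mu> b x0
  proof unfold_locales
    show "(f, affine_generator b \<mu> f) \<in> generator {0..} P" if "f \<in> Cc_infinity_nonneg" for f
      using gen that by blast
  qed (fact filt feller cadlag usual start(2))+
  show ?thesis
    unfolding strict_local_martingale_def
    using A.exp_local_martingale[OF L.branching_mechanism_1[OF b]]
      A.exp_not_martingale[OF start(1) L.summable_inverse_branching_mechanism[OF b]]
    by blast
qed

end
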